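(* Let $Y$ be a 3-manifold with an ideal triangulation $\mathcal T$ and shape parameters satisfying the shape parameter relations and the gluing relations, with associated homomorphism $r:\pi_1(Y)\to\mathrm{PSL}_2(\mathbb C)$. Let $\gamma$ be a closed curve in $Y$ that transversally meets the edge cones $Ce_1,Ce_2,\dots,Ce_k,Ce_{k+1}=Ce_1$, in that order, let $M_i=\begin{bmatrix} m_i^{++} & m_i^{+-} \\ m_i^{-+} & m_i^{--} \end{bmatrix}$ be the associated turning matrices, and let $Z_i$ be the shape parameter associated to $Ce_i$. If $\hat r(\gamma)\in\mathrm{SL}_2(\mathbb C)$ is a lift of $r(\gamma)$, then, up to sign, $$\mathrm{Tr}(\hat r(\gamma))=\pm\sum_s m_1^{s_1s_2}m_2^{s_2s_3}\cdots m_k^{s_ks_1}\,(-Z_1)^{s_1/2}(-Z_2)^{s_2/2}\cdots(-Z_k)^{s_k/2},$$ where the sum is over all states $s=(s_1,\dots,s_k)\in\{\pm1\}^k$.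
   Context: **Shape parameters.** An ideal tetrahedron in $\mathbb H^3$ is the convex hull of four points at infinity; "bare" vertices/edges are those of tetrahedra before gluing. The shape parameter of a bare edge is the complex number $z$ such that an orientation preserving isometry puts the endpoints of the edge at $0,\infty$ and the other two vertices at $1$ and $z$, with $\mathrm{Im}\,z>0$. Opposite edges have equal parameters; the three parameters $Z,Z',Z''$ of a tetrahedron (suitably ordered) satisfy $ZZ'Z''=-1$, $Z''^{-1}+Z=1$, $Z^{-1}+Z'=1$, $Z'^{-1}+Z''=1$. Gluing relations: for each internal edge of $\mathcal T$ with bare edges $e_1,\dots,e_k$ glued around it, $\sum_i\log Z_{e_i}=2\pi i$ (principal branch). **The homomorphism $r$.** Lift $\mathcal T$ to the universal cover $\widetilde Y$; the shape parameters determine an orientation preserving immersion $\widetilde g:\widetilde Y\to\mathbb H^3$ sending each lifted tetrahedron to an ideal tetrahedron of the given shape, unique up to isotopy respecting the lifted triangulation and composition with $\mathrm{PSL}_2(\mathbb C)$. $r$ is determined (up to conjugation) by $\widetilde g(\gamma\widetilde T)=r(\gamma)\widetilde g(\widetilde T)$ for all $T\in\mathcal T$. **Cones and suspensions.** The barycenter of an ideal tetrahedron $T$ is the common intersection point of the three common perpendiculars of opposite edges. The vertex cone $Cv$ of a bare vertex $v$ is the geodesic from the barycenter to $v$. The edge cone $Ce$ of a bare edge $e$ is the part of the geodesic hemisphere (totally geodesic plane) through $e$ and the barycenter bounded by $e$ and the two vertex cones of its endpoints; it carries the shape parameter of $e$. For a face $f$ of $\mathcal T$ the face suspension $Sf$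 is the region bounded by the six edge cones over the three edges of $f$ (three in each adjacent tetrahedron). **Turning matrices.** After crossing $Ce_i$ (in tetrahedron $T_i$), $\gamma$ enters a face suspension $Sf_i$ and exits across $Ce_{i+1}$. View from the barycenter of $T_i$: - $Ce_{i+1}$ is immediately to the left of $Ce_i$ after crossing into $Sf_i$ (in $T_i$): $M_i=\begin{bmatrix}1&1\\0&1\end{bmatrix}$; - immediately to the right (in $T_i$): $M_i=\begin{bmatrix}1&0\\1&1\end{bmatrix}$; - $Ce_{i+1}=Ce_i$: $M_i=\begin{bmatrix}0&1\\-1&0\end{bmatrix}$; - across $f_i$ and to the left: $M_i=\begin{bmatrix}(-1)^{1/2}&(-1)^{1/2}\\(-1)^{1/2}&0\end{bmatrix}$; - across $f_i$ and to the right: $M_i=\begin{bmatrix}0&(-1)^{1/2}\\(-1)^{1/2}&(-1)^{1/2}\end{bmatrix}$; - across $f_i$ and directly below (edge cone over the same edge of $f_i$ in the other tetrahedron): $M_i=\begin{bmatrix}(-1)^{-1/2}&0\\0&(-1)^{1/2}\end{bmatrix}$. A fixed square root $(-Z_i)^{1/2}$ is chosen for each $i$, and a fixed $(-1)^{1/2}$. *)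

theory Defs
  imports "HOL-Analysis.Analysis"
begin

section \<open>Hyperbolic space\<close>

text \<open>
  The hyperboloid model of hyperbolic 3-space: Minkowski space is the space of Hermitian
  \<open>2 \<times> 2\<close> matrices with quadratic form \<open>det\<close> (signature \<open>(1,3)\<close>), and hyperbolic space is the sheet
  of positive definite matrices of determinant 1. The orientation preserving isometries are
  \<open>X \<mapsto> A X A\<^sup>*\<close> with \<open>A\<close> in \<open>SL\<^sub>2(C)\<close>. A point at infinity is a point of the complex projective
  line, given by a nonzero vector \<open>w\<close> of homogeneous coordinates; it corresponds to the light ray
  through \<open>w w\<^sup>*\<close>, and \<open>A\<close> acts on it as the Moebius transformation \<open>w \<mapsto> A w\<close>.
\<close>

type_synonym cmat2 = "complex^2^2"

definition adjoint_mat :: "cmat2 \<Rightarrow> cmat2" where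
  "adjoint_mat A = (\<chi> i j. cnj (A $ j $ i))"

definition H3 :: "cmat2 set" where
  "H3 = {X. adjoint_mat X = X \<and> det X = 1 \<and> 0 < Re (trace X)}"

definition act :: "cmat2 \<Rightarrow> cmat2 \<Rightarrow> cmat2" where
  "act A X = A ** X ** adjoint_mat A"

text \<open>The polarisation of \<open>det\<close>; \<open>mink P Q\<close> is the hyperbolic cosine of the distance on \<open>H3\<close>.\<close>

definition mink :: "cmat2 \<Rightarrow> cmat2 \<Rightarrow> real" where
  "mink X Y = Re (det (X + Y) - det X - det Y) / 2"

definition null_vector :: "complex^2 \<Rightarrow> cmat2" where
  "null_vector w = (\<chi> i j. w $ i * cnj (w $ j))"

definition same_ideal_point :: "complex^2 \<Rightarrow> complex^2 \<Rightarrow> bool" where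
  "same_ideal_point w w' \<longleftrightarrow> (\<exists>c. c \<noteq> 0 \<and> w' = c *s w)"

definition ideal_infinity :: "complex^2" where
  "ideal_infinity = vector [1, 0]"

definition ideal_number :: "complex \<Rightarrow> complex^2" where
  "ideal_number z = vector [z, 1]"

text \<open>An element of \<open>PSL\<^sub>2(C)\<close> is represented by the set of its two lifts to \<open>SL\<^sub>2(C)\<close>.\<close>

definition psl_class :: "cmat2 \<Rightarrow> cmat2 set" where
  "psl_class A = {A, - A}"

text \<open>
  In this model a geodesic is the intersection of \<open>H3\<close> with a plane through the origin.
  Two geodesics meet perpendicularly at \<open>X\<close> if the tangent vectors at \<open>X\<close> obtained by projecting
  their points to the orthogonal complement of \<open>X\<close> are orthogonal.
\<close>

definition geodesic :: "cmat2 set \<Rightarrow> bool" where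
  "geodesic L \<longleftrightarrow> (\<exists>P\<in>H3. \<exists>Q\<in>H3. P \<noteq> Q \<and> L = {X \<in> H3. \<exists>a b. X = a *\<^sub>R P + b *\<^sub>R Q})"

definition tangent_part :: "cmat2 \<Rightarrow> cmat2 \<Rightarrow> cmat2" where
  "tangent_part X P = P - mink P X *\<^sub>R X"

definition perpendicular_at :: "cmat2 \<Rightarrow> cmat2 set \<Rightarrow> cmat2 set \<Rightarrow> bool" where
  "perpendicular_at X L N \<longleftrightarrow> X \<in> L \<inter> N \<and>
     (\<forall>P\<in>L. \<forall>Q\<in>N. mink (tangent_part X P) (tangent_part X Q) = 0)"

definition common_perpendicular ::
    "cmat2 set \<Rightarrow> cmat2 set \<Rightarrow> cmat2 set \<Rightarrow> bool" where
  "common_perpendicular N L L' \<longleftrightarrow>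
     geodesic N \<and> (\<exists>X. perpendicular_at X L N) \<and> (\<exists>X. perpendicular_at X L' N)"


section \<open>Ideal tetrahedra\<close>

text \<open>
  The vertices of a tetrahedron are labelled by the type \<open>4\<close>; a bare edge is a two-element
  set of labels and its opposite edge is the complement; a face is named by the opposite vertex.
  Hyperbolic convex hulls are intersections of \<open>H3\<close> with convex cones in Minkowski space.
\<close>

definition ideal_simplex :: "(4 \<Rightarrow> complex^2) \<Rightarrow> 4 set \<Rightarrow> cmat2 set" where
  "ideal_simplex v S =
     {X \<in> H3. \<exists>c. (\<forall>i\<in>S. 0 \<le> c i) \<and> X = (\<Sum>i\<in>S. c i *\<^sub>R null_vector (v i))}"

abbreviation ideal_tetrahedron :: "(4 \<Rightarrow> complex^2) \<Rightarrow> cmat2 set" where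
  "ideal_tetrahedron v \<equiv> ideal_simplex v UNIV"

text \<open>Nondegenerate, with the labels 0, 1, 2, 3 in the order of \<open>\<infinity>, 0, 1, z\<close> with \<open>Im z > 0\<close>.\<close>

definition positively_labelled :: "(4 \<Rightarrow> complex^2) \<Rightarrow> bool" where
  "positively_labelled v \<longleftrightarrow>
     (\<exists>A z. det A = 1 \<and> 0 < Im z \<and>
        same_ideal_point (A *v v 0) ideal_infinity \<and>
        same_ideal_point (A *v v 1) (ideal_number 0) \<and>
        same_ideal_point (A *v v 2) (ideal_number 1) \<and>
        same_ideal_point (A *v v 3) (ideal_number z))"

definition has_shape_parameter :: "(4 \<Rightarrow> complex^2) \<Rightarrow> 4 set \<Rightarrow> complex \<Rightarrow> bool" where
  "has_shape_parameter v e z \<longleftrightarrow> 0 < Im z \<and>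
     (\<exists>a b c d A. distinct [a, b, c, d] \<and> e = {a, b} \<and> det A = 1 \<and>
        same_ideal_point (A *v v a) (ideal_number 0) \<and>
        same_ideal_point (A *v v b) ideal_infinity \<and>
        same_ideal_point (A *v v c) (ideal_number 1) \<and>
        same_ideal_point (A *v v d) (ideal_number z))"

definition barycenter :: "(4 \<Rightarrow> complex^2) \<Rightarrow> cmat2" where
  "barycenter v = (THE X. X \<in> H3 \<and>
     (\<forall>e. card e = 2 \<longrightarrow>
        (\<exists>N. common_perpendicular N (ideal_simplex v e) (ideal_simplex v (- e)) \<and> X \<in> N)))"

text \<open>
  The geodesic cone from the barycenter over the ideal simplex spanned by \<open>S\<close>: the vertex cone
  for a singleton, the edge cone for an edge, and for a face the part of its face suspension that
  lies in this tetrahedron.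
\<close>

definition bary_cone :: "(4 \<Rightarrow> complex^2) \<Rightarrow> 4 set \<Rightarrow> cmat2 set" where
  "bary_cone v S =
     {X \<in> H3. \<exists>c \<beta>. (\<forall>i\<in>S. 0 \<le> c i) \<and> 0 \<le> \<beta> \<and>
        X = (\<Sum>i\<in>S. c i *\<^sub>R null_vector (v i)) + \<beta> *\<^sub>R barycenter v}"

definition open_edge_cone :: "(4 \<Rightarrow> complex^2) \<Rightarrow> 4 set \<Rightarrow> cmat2 set" where
  "open_edge_cone v e = bary_cone v e - ideal_simplex v e - (\<Union>a\<in>e. bary_cone v {a})"

text \<open>The face itself is kept; only the bounding edge cones (with the edges) are removed.\<close>

definition half_suspension :: "(4 \<Rightarrow> complex^2) \<Rightarrow> 4 \<Rightarrow> cmat2 set" where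
  "half_suspension v q = bary_cone v (- {q}) - (\<Union>e\<in>{e. e \<subseteq> - {q} \<and> card e = 2}. bary_cone v e)"


section \<open>Ideal triangulations\<close>

text \<open>
  \<open>glue T i = Some (T', \<sigma>)\<close> means that the face of \<open>T\<close> opposite \<open>i\<close> is glued to the face of \<open>T'\<close>
  opposite \<open>\<sigma> i\<close>, each vertex \<open>j \<noteq> i\<close> being matched with \<open>\<sigma> j\<close>. Since all tetrahedra are positively
  labelled, the gluing is compatible with the orientations iff \<open>\<sigma>\<close> is odd. Unglued faces form the
  boundary of the manifold.
\<close>

type_synonym 't gluing = "'t \<Rightarrow> 4 \<Rightarrow> ('t \<times> (4 \<Rightarrow> 4)) option"

definition face_pairing :: "'t set \<Rightarrow> 't gluing \<Rightarrow> bool" where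
  "face_pairing tets glue \<longleftrightarrow>
     (\<forall>T i T' \<sigma>. glue T i = Some (T', \<sigma>) \<longrightarrow>
        T \<in> tets \<and> T' \<in> tets \<and> bij \<sigma> \<and> \<not> evenperm \<sigma> \<and> (T', \<sigma> i) \<noteq> (T, i) \<and>
        glue T' (\<sigma> i) = Some (T, inv \<sigma>))"

definition edge_step :: "'t gluing \<Rightarrow> 't \<times> 4 set \<Rightarrow> 't \<times> 4 set \<Rightarrow> bool" where
  "edge_step glue = (\<lambda>(T, e) (T', e').
     \<exists>i \<sigma>. i \<notin> e \<and> glue T i = Some (T', \<sigma>) \<and> e' = \<sigma> ` e)"

definition edge_class :: "'t gluing \<Rightarrow> 't \<times> 4 set \<Rightarrow> ('t \<times> 4 set) set" where
  "edge_class glue b = {b'. equivclp (edge_step glue) b b'}"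

definition internal_edge :: "'t gluing \<Rightarrow> ('t \<times> 4 set) set \<Rightarrow> bool" where
  "internal_edge glue E \<longleftrightarrow> (\<forall>(T, e)\<in>E. \<forall>i. i \<notin> e \<longrightarrow> glue T i \<noteq> None)"

definition shape_relations :: "'t set \<Rightarrow> ('t \<Rightarrow> 4 set \<Rightarrow> complex) \<Rightarrow> bool" where
  "shape_relations tets Z \<longleftrightarrow>
     (\<forall>T\<in>tets.
        (\<forall>e. card e = 2 \<longrightarrow> 0 < Im (Z T e) \<and> Z T (- e) = Z T e) \<and>
        (let z = Z T {0, 1}; z' = Z T {0, 3}; z'' = Z T {0, 2} in
           z * z' * z'' = - 1 \<and> inverse z'' + z = 1 \<and> inverse z + z' = 1 \<and> inverse z' + z'' = 1))"

definition gluing_relations :: "'t set \<Rightarrow> 't gluing \<Rightarrow> ('t \<Rightarrow> 4 set \<Rightarrow> complex) \<Rightarrow> bool" where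
  "gluing_relations tets glue Z \<longleftrightarrow>
     (\<forall>T\<in>tets. \<forall>e. card e = 2 \<longrightarrow> internal_edge glue (edge_class glue (T, e)) \<longrightarrow>
        (\<Sum>(T', e')\<in>edge_class glue (T, e). Ln (Z T' e')) = 2 * of_real pi * \<i>)"

text \<open>
  Points of the disjoint union of the tetrahedra are pairs \<open>(T, X)\<close>. Faces are glued by the unique
  isometry matching their ideal vertices.
\<close>

definition glued_points ::
    "'t gluing \<Rightarrow> ('t \<Rightarrow> 4 \<Rightarrow> complex^2) \<Rightarrow> 't \<times> cmat2 \<Rightarrow> 't \<times> cmat2 \<Rightarrow> bool" where
  "glued_points glue v = (\<lambda>(T, X) (T', X').
     \<exists>i \<sigma> A. glue T i = Some (T', \<sigma>) \<and> det A = 1 \<and>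
       (\<forall>j. j \<noteq> i \<longrightarrow> same_ideal_point (A *v v T j) (v T' (\<sigma> j))) \<and>
       X \<in> ideal_simplex (v T) (- {i}) \<and> X' = act A X)"

text \<open>
  \<open>Y\<close> is the quotient, by the face gluings, of the disjoint union of ideal tetrahedra with vertices
  \<open>v T\<close> and shape parameters \<open>Z T\<close>, with quotient map \<open>\<pi>\<close>. The ideal vertices are not part of \<open>Y\<close>.
  The triangulation may be infinite, but only finitely many bare edges are glued together, so that
  \<open>Y\<close> is a 3-manifold, possibly with boundary.
\<close>

definition ideal_triangulation ::
    "'a::topological_space set \<Rightarrow> 't set \<Rightarrow> 't gluing \<Rightarrow> ('t \<Rightarrow> 4 set \<Rightarrow> complex) \<Rightarrow>
     ('t \<Rightarrow> 4 \<Rightarrow> complex^2) \<Rightarrow> ('t \<times> cmat2 \<Rightarrow> 'a) \<Rightarrow> bool" where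
  "ideal_triangulation Y tets glue Z v \<pi> \<longleftrightarrow>
     face_pairing tets glue \<and>
     (\<forall>T\<in>tets. \<forall>e. card e = 2 \<longrightarrow> finite (edge_class glue (T, e))) \<and>
     (\<forall>T\<in>tets. positively_labelled (v T)) \<and>
     (\<forall>T\<in>tets. \<forall>e. card e = 2 \<longrightarrow> has_shape_parameter (v T) e (Z T e)) \<and>
     quotient_map (sum_topology (\<lambda>T. top_of_set (ideal_tetrahedron (v T))) tets) (top_of_set Y) \<pi> \<and>
     (\<forall>x \<in> Sigma tets (\<lambda>T. ideal_tetrahedron (v T)).
        \<forall>y \<in> Sigma tets (\<lambda>T. ideal_tetrahedron (v T)).
          \<pi> x = \<pi> y \<longleftrightarrow> equivclp (glued_points glue v) x y)"


section \<open>Developing map and holonomy\<close>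

definition universal_cover ::
    "'b::topological_space set \<Rightarrow> ('b \<Rightarrow> 'a::topological_space) \<Rightarrow> 'a set \<Rightarrow> bool" where
  "universal_cover Yt p Y \<longleftrightarrow> Yt \<noteq> {} \<and> covering_space Yt p Y \<and> simply_connected Yt"

definition lifted_tetrahedron ::
    "'b::topological_space set \<Rightarrow> ('b \<Rightarrow> 'a) \<Rightarrow> ('t \<Rightarrow> 4 \<Rightarrow> complex^2) \<Rightarrow>
     ('t \<times> cmat2 \<Rightarrow> 'a) \<Rightarrow> 't \<Rightarrow> (cmat2 \<Rightarrow> 'b) \<Rightarrow> bool" where
  "lifted_tetrahedron Yt p v \<pi> T \<phi> \<longleftrightarrow>
     continuous_on (ideal_tetrahedron (v T)) \<phi> \<and> \<phi> ` ideal_tetrahedron (v T) \<subseteq> Yt \<and>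
     (\<forall>X\<in>ideal_tetrahedron (v T). p (\<phi> X) = \<pi> (T, X))"

text \<open>
  The representative, in its isotopy class, of the developing map that is an orientation
  preserving isometry on each lifted tetrahedron. The lift of \<open>T\<close> through a given point of \<open>Yt\<close>
  exists and is unique, so the condition concerns all lifted tetrahedra. Local injectivity off the
  boundary follows from the orientations and the gluing relations and is not required separately.
\<close>

definition developing_map ::
    "'b::topological_space set \<Rightarrow> ('b \<Rightarrow> 'a) \<Rightarrow> 't set \<Rightarrow> ('t \<Rightarrow> 4 \<Rightarrow> complex^2) \<Rightarrow>
     ('t \<times> cmat2 \<Rightarrow> 'a) \<Rightarrow> ('b \<Rightarrow> cmat2) \<Rightarrow> bool" where
  "developing_map Yt p tets v \<pi> dev \<longleftrightarrow>
     continuous_on Yt dev \<and> dev ` Yt \<subseteq> H3 \<and>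
     (\<forall>T\<in>tets. \<forall>X\<in>ideal_tetrahedron (v T). \<forall>y\<in>Yt. p y = \<pi> (T, X) \<longrightarrow>
        (\<exists>\<phi> A. lifted_tetrahedron Yt p v \<pi> T \<phi> \<and> \<phi> X = y \<and> det A = 1 \<and>
           (\<forall>X'\<in>ideal_tetrahedron (v T). dev (\<phi> X') = act A X')))"

definition deck_transformation ::
    "'b::topological_space set \<Rightarrow> ('b \<Rightarrow> 'a) \<Rightarrow> ('b \<Rightarrow> 'b) \<Rightarrow> bool" where
  "deck_transformation Yt p \<delta> \<longleftrightarrow>
     (\<exists>\<delta>'. homeomorphism Yt Yt \<delta> \<delta>') \<and> (\<forall>y\<in>Yt. p (\<delta> y) = p y)"

definition loop_at :: "'a::topological_space set \<Rightarrow> 'a \<Rightarrow> (real \<Rightarrow> 'a) \<Rightarrow> bool" where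
  "loop_at Y y0 \<gamma> \<longleftrightarrow> path \<gamma> \<and> path_image \<gamma> \<subseteq> Y \<and> pathstart \<gamma> = y0 \<and> pathfinish \<gamma> = y0"

text \<open>
  The deck transformation corresponding to a loop \<open>\<gamma>\<close> takes the base point \<open>yt0\<close> of the universal
  cover to the end of the lift of \<open>\<gamma>\<close> starting there. The homomorphism \<open>r\<close> is given on the loops
  that represent the elements of the fundamental group.
\<close>

definition holonomy ::
    "'a::topological_space set \<Rightarrow> 'b::topological_space set \<Rightarrow> ('b \<Rightarrow> 'a) \<Rightarrow> 'b \<Rightarrow>
     ('b \<Rightarrow> cmat2) \<Rightarrow> ((real \<Rightarrow> 'a) \<Rightarrow> cmat2 set) \<Rightarrow> bool" where
  "holonomy Y Yt p yt0 dev r \<longleftrightarrow>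
     (\<forall>\<gamma>. loop_at Y (p yt0) \<gamma> \<longrightarrow>
        (\<exists>\<gamma>t \<delta> A. path \<gamma>t \<and> path_image \<gamma>t \<subseteq> Yt \<and> pathstart \<gamma>t = yt0 \<and>
           (\<forall>s\<in>{0..1}. p (\<gamma>t s) = \<gamma> s) \<and>
           deck_transformation Yt p \<delta> \<and> \<delta> yt0 = pathfinish \<gamma>t \<and>
           det A = 1 \<and> r \<gamma> = psl_class A \<and>
           (\<forall>y\<in>Yt. dev (\<delta> y) = act A (dev y))))"


section \<open>Curves and turning matrices\<close>

text \<open>
  A crossing \<open>(T, p, q)\<close> goes through the cone, in \<open>T\<close>, of the edge containing neither \<open>p\<close> nor \<open>q\<close>.
  It leaves the suspension of the face of \<open>T\<close> opposite \<open>p\<close> and enters that of the face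
  opposite \<open>q\<close>; these are the two faces that contain the edge.
\<close>

type_synonym 't crossing = "'t \<times> 4 \<times> 4"

fun crossed_edge :: "'t crossing \<Rightarrow> 't \<times> 4 set" where
  "crossed_edge (T, p, q) = (T, - {p, q})"

definition suspension_region ::
    "'t gluing \<Rightarrow> ('t \<Rightarrow> 4 \<Rightarrow> complex^2) \<Rightarrow> ('t \<times> cmat2 \<Rightarrow> 'a) \<Rightarrow> 't \<Rightarrow> 4 \<Rightarrow> 'a set" where
  "suspension_region glue v \<pi> T q =
     \<pi> ` ({T} \<times> half_suspension (v T) q) \<union>
     (case glue T q of None \<Rightarrow> {}
      | Some (T', \<sigma>) \<Rightarrow> \<pi> ` ({T'} \<times> half_suspension (v T') (\<sigma> q)))"

text \<open>
  \<open>x 0, \<dots>, x (k - 1)\<close> are the crossings of the closed curve \<open>\<gamma>\<close> with the edge cones, in order.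
  The curve is traversed periodically through \<open>\<lambda>s. \<gamma> (frac s)\<close>, with crossing times \<open>t i\<close>, so that
  the base point is arbitrary. Transversality means that the curve meets only the
  interiors of edge cones and passes at each crossing from one side to the other.
\<close>

definition meets_edge_cones ::
    "'t set \<Rightarrow> 't gluing \<Rightarrow> ('t \<Rightarrow> 4 \<Rightarrow> complex^2) \<Rightarrow> ('t \<times> cmat2 \<Rightarrow> 'a) \<Rightarrow>
     (real \<Rightarrow> 'a) \<Rightarrow> nat \<Rightarrow> (nat \<Rightarrow> 't crossing) \<Rightarrow> bool" where
  "meets_edge_cones tets glue v \<pi> \<gamma> k x \<longleftrightarrow>
     (\<exists>t :: nat \<Rightarrow> real. (\<forall>i. t i < t (Suc i)) \<and> (\<forall>i. t (i + k) = t i + 1) \<and>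
        (\<forall>i. case x (i mod k) of (T, p, q) \<Rightarrow>
           T \<in> tets \<and> p \<noteq> q \<and>
           \<gamma> (frac (t i)) \<in> \<pi> ` ({T} \<times> open_edge_cone (v T) (- {p, q})) \<and>
           (\<forall>\<^sub>F s in at_left (t i). \<gamma> (frac s) \<in> \<pi> ` ({T} \<times> half_suspension (v T) p)) \<and>
           (\<forall>\<^sub>F s in at_right (t i). \<gamma> (frac s) \<in> \<pi> ` ({T} \<times> half_suspension (v T) q)) \<and>
           (\<forall>s. t i < s \<and> s < t (Suc i) \<longrightarrow> \<gamma> (frac s) \<in> suspension_region glue v \<pi> T q)))"

text \<open>
  If \<open>ccw_face q a b c\<close>, then the face of a positively labelled tetrahedron opposite \<open>q\<close> has the
  vertices \<open>a, b, c\<close> in counterclockwise order as seen from inside: for \<open>\<infinity>, 0, 1, z\<close> the face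
  \<open>0, 1, z\<close> is seen from above. After entering across the edge \<open>{a, b}\<close>, the edge \<open>{a, c}\<close> is
  on the left and \<open>{b, c}\<close> on the right.
\<close>

definition ccw_face :: "4 \<Rightarrow> 4 \<Rightarrow> 4 \<Rightarrow> 4 \<Rightarrow> bool" where
  "ccw_face q a b c \<longleftrightarrow>
     (\<exists>\<tau>. bij \<tau> \<and> evenperm \<tau> \<and> \<tau> 0 = q \<and> \<tau> 1 = a \<and> \<tau> 2 = b \<and> \<tau> 3 = c)"

definition mat2 :: "complex \<Rightarrow> complex \<Rightarrow> complex \<Rightarrow> complex \<Rightarrow> cmat2" where
  "mat2 a b c d = vector [vector [a, b], vector [c, d]]"

text \<open>
  \<open>u\<close> is the chosen square root of \<open>- 1\<close>. The relation holds between two consecutive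
  crossings and the turning matrix; in each rule the edge crossed first is \<open>{a, b}\<close> and the face
  entered is \<open>{a, b, c}\<close>. The next crossing leaves the suspension of this face, seen from the same
  or from the other tetrahedron.
\<close>

inductive turning_matrix ::
    "'t gluing \<Rightarrow> complex \<Rightarrow> 't crossing \<Rightarrow> 't crossing \<Rightarrow> cmat2 \<Rightarrow> bool"
  for glue :: "'t gluing" and u :: complex where
  left: "ccw_face q a b c \<Longrightarrow> turning_matrix glue u (T, c, q) (T, q, b) (mat2 1 1 0 1)"
| right: "ccw_face q a b c \<Longrightarrow> turning_matrix glue u (T, c, q) (T, q, a) (mat2 1 0 1 1)"
| same: "ccw_face q a b c \<Longrightarrow> turning_matrix glue u (T, c, q) (T, q, c) (mat2 0 1 (- 1) 0)"
| across_left: "ccw_face q a b c \<Longrightarrow> glue T q = Some (T', \<sigma>) \<Longrightarrow>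
    turning_matrix glue u (T, c, q) (T', \<sigma> q, \<sigma> b) (mat2 u u u 0)"
| across_right: "ccw_face q a b c \<Longrightarrow> glue T q = Some (T', \<sigma>) \<Longrightarrow>
    turning_matrix glue u (T, c, q) (T', \<sigma> q, \<sigma> a) (mat2 0 u u u)"
| across_below: "ccw_face q a b c \<Longrightarrow> glue T q = Some (T', \<sigma>) \<Longrightarrow>
    turning_matrix glue u (T, c, q) (T', \<sigma> q, \<sigma> c) (mat2 (inverse u) 0 0 u)"

text \<open>Entry of a turning matrix, rows and columns being indexed by the signs \<open>1\<close>, \<open>- 1\<close> in this order.\<close>

definition sign_entry :: "cmat2 \<Rightarrow> int \<Rightarrow> int \<Rightarrow> complex" where
  "sign_entry M s s' = M $ (if s = 1 then 1 else 2) $ (if s' = 1 then 1 else 2)"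

end

theory Submission
  imports Defs
begin

text \<open>
  Attach to each crossing a frame: the matrix taking \<open>\<infinity>, 0, - 1\<close> to the developed images of the two
  ends of the crossed edge and of the vertex opposite to the face that is entered. By the definition
  of the shape parameter \<open>Z\<close> the frame takes \<open>- Z\<close> to the remaining vertex, and consecutive frames
  differ, up to scalars, by right multiplication with \<open>diag(w, 1 / w) M\<close> where \<open>w\<^sup>2 = - Z\<close> and \<open>M\<close> is
  the turning matrix. After one period the frame has been multiplied on the left by the holonomy,
  which is therefore conjugate, up to sign, to the product of these matrices; expanding the trace
  of the product gives the state sum.

  That the developed lift of the curve passes from each tetrahedron to the one prescribed by the
  turning matrix is seen in barycentric coordinates normalised by the barycenter: the half
  suspension of a face is the relatively open set where the coordinate of the opposite vertex is
  the strictly smallest one. Hence suspensions are open and embedded in \<open>Y\<close>, and lift to sections of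
  the universal cover that the lifted curve has to follow.
\<close>


section \<open>Labels and permutations\<close>

text \<open>The point - 1 makes the turning matrices independent of the shapes. Since
  \<open>diag(w, 1 / w)\<close> takes 1 to \<open>w\<^sup>2 = - Z\<close>, multiplying by it puts
  the third vertex of the entered face at 1, so that this face becomes the standard ideal triangle
  infinity, 0, 1. A turning matrix takes infinity, 0, - 1 to the vertices of this triangle in the
  order that the next crossing requires. Hence all points of the next frame are vertices of the face
  just entered, and the frame is the same seen from either side of that face. Frames are kept
  projective until the end. All factors have determinant 1, so the scalar left after one period has
  square 1; this is the sign in the theorem. The obstacle is to know which lift of a tetrahedron is
  entered, as a tetrahedron may be glued to itself. Crossing points are interior to tetrahedra,
  where \<open>\<pi>\<close> is injective, and a half suspension meets the boundary only in its open
  face, where a fibre of \<open>\<pi>\<close> has at most two points.\<close>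

abbreviation swap :: "'a \<Rightarrow> 'a \<Rightarrow> 'a \<Rightarrow> 'a" where
  "swap \<equiv> Transposition.transpose"

text \<open>In the type \<open>4\<close> the numeral 4 equals 0; the labels from 0 on follow the
  order infinity, 0, 1, z of \<open>positively_labelled\<close>.\<close>

lemma UNIV_4_from_0: "(UNIV :: 4 set) = {0, 1, 2, 3}"
proof -
  have "(4::4) = 0" by simp
  then show ?thesis by (simp only: UNIV_4) (simp only: insert_commute)
qed

lemma exhaust_4_from_0: "(i::4) = 0 \<or> i = 1 \<or> i = 2 \<or> i = 3"
  using UNIV_4_from_0 by blast

lemma sum_4_from_0: "sum f (UNIV :: 4 set) = f 0 + f 1 + f 2 + f 3"
  unfolding UNIV_4_from_0 by (simp add: ac_simps)

lemma UNIV_4_distinct: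
  fixes a b c d :: 4
  assumes "distinct [a, b, c, d]"
  shows "UNIV = {a, b, c, d}"
proof -
  have "card {a, b, c, d} = CARD(4)"
    using assms by simp
  then show ?thesis
    by (metis card_subset_eq finite subset_UNIV)
qed

lemma sum_4_distinct:
  fixes a b c d :: 4
  assumes "distinct [a, b, c, d]"
  shows "sum f UNIV = f a + f b + f c + f d"
  using assms by (simp add: UNIV_4_distinct[OF assms] ac_simps)

lemma Compl_4_distinct:
  fixes a b c d :: 4
  assumes "distinct [a, b, c, d]"
  shows "- {a, b} = {c, d}" "- {d} = {a, b, c}"
  using assms UNIV_4_distinct[OF assms] by auto

lemma card_2_labels:
  fixes e :: "4 set"
  assumes "card e = 2"
  obtains a b c d where "distinct [a, b, c, d]" "e = {a, b}" "- e = {c, d}"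
proof -
  obtain a b where ab: "e = {a, b}" "a \<noteq> b"
    using assms by (auto simp: card_2_iff)
  have "card (- e) = 2"
    using assms by (simp add: Compl_eq_Diff_UNIV card_Diff_subset)
  then obtain c d where cd: "- e = {c, d}" "c \<noteq> d"
    by (auto simp: card_2_iff)
  have "c \<notin> e" "d \<notin> e"
    using cd by auto
  then have "distinct [a, b, c, d]"
    using ab cd by auto
  then show thesis
    using that ab cd by blast
qed

lemma permutation_finite_type: "bij (f :: 'n::finite \<Rightarrow> 'n) \<Longrightarrow> permutation f"
  by (simp add: permutation)

lemma evenperm_comp_finite:
  "bij (f :: 'n::finite \<Rightarrow> 'n) \<Longrightarrow> bij g \<Longrightarrow> evenperm (f \<circ> g) \<longleftrightarrow> evenperm f = evenperm g"
  by (simp add: evenperm_comp permutation_finite_type)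

lemma ccw_face_distinct:
  assumes "ccw_face q a b c"
  shows "distinct [q, a, b, c]"
proof -
  obtain \<tau> :: "4 \<Rightarrow> 4" where "bij \<tau>" "\<tau> 0 = q" "\<tau> 1 = a" "\<tau> 2 = b" "\<tau> 3 = c"
    using assms by (auto simp: ccw_face_def)
  then show ?thesis
    by (auto simp: bij_def inj_eq)
qed

text \<open>These are the crossings that can follow inside the same tetrahedron: the face opposite
  \<open>q\<close>, whose suspension is left next, takes the place of the one opposite
  \<open>c\<close>. Each relabelling is a product of two transpositions and therefore respects the
  orientation.\<close>

lemma ccw_face_step:
  assumes "ccw_face q a b c"
  shows ccw_face_left: "ccw_face b a c q"
    and ccw_face_right: "ccw_face a c b q"
    and ccw_face_same: "ccw_face c b a q"
proof -
  obtain \<tau> :: "4 \<Rightarrow> 4" where \<tau>: "bij \<tau>" "evenperm \<tau>" "\<tau> 0 = q" "\<tau> 1 = a" "\<tau> 2 = b" "\<tau> 3 = c"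
    using assms by (auto simp: ccw_face_def)
  have *: "ccw_face ((\<tau> \<circ> \<rho>) 0) ((\<tau> \<circ> \<rho>) 1) ((\<tau> \<circ> \<rho>) 2) ((\<tau> \<circ> \<rho>) 3)"
    if "bij \<rho>" "evenperm \<rho>" for \<rho> :: "4 \<Rightarrow> 4"
    unfolding ccw_face_def using that \<tau>
    by (intro exI[of _ "\<tau> \<circ> \<rho>"]) (auto simp: evenperm_comp_finite bij_comp)
  have ev: "evenperm (swap i j \<circ> swap k l)" "bij (swap i j \<circ> swap k l)"
    if "i \<noteq> j" "k \<noteq> l" for i j k l :: 4
    using that by (auto simp: evenperm_comp_finite bij_comp evenperm_swap)
  show "ccw_face b a c q"
    using *[of "swap 0 2 \<circ> swap 2 3"] ev[of 0 2 2 3] \<tau>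
    by (simp add: Transposition.transpose_def)
  show "ccw_face a c b q"
    using *[of "swap 0 1 \<circ> swap 1 3"] ev[of 0 1 1 3] \<tau>
    by (simp add: Transposition.transpose_def)
  show "ccw_face c b a q"
    using *[of "swap 0 3 \<circ> swap 1 2"] ev[of 0 3 1 2] \<tau>
    by (simp add: Transposition.transpose_def)
qed

text \<open>Exchanging the ends of the edge makes up for the oddness of the gluing, so the rules on
  the far side of a face are those of \<open>ccw_face_step\<close> with the two ends
  exchanged.\<close>

lemma ccw_face_cross:
  assumes "ccw_face q a b c" and \<sigma>: "bij \<sigma>" "\<not> evenperm \<sigma>"
  shows ccw_face_cross_left: "ccw_face (\<sigma> b) (\<sigma> c) (\<sigma> a) (\<sigma> q)"
    and ccw_face_cross_right: "ccw_face (\<sigma> a) (\<sigma> b) (\<sigma> c) (\<sigma> q)"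
    and ccw_face_cross_below: "ccw_face (\<sigma> c) (\<sigma> a) (\<sigma> b) (\<sigma> q)"
proof -
  have odd: "ccw_face (\<sigma> q') (\<sigma> b') (\<sigma> a') (\<sigma> c')" if ccw': "ccw_face q' a' b' c'" for q' a' b' c'
  proof -
    obtain \<tau> :: "4 \<Rightarrow> 4" where "bij \<tau>" "evenperm \<tau>" "\<tau> 0 = q'" "\<tau> 1 = a'" "\<tau> 2 = b'" "\<tau> 3 = c'"
      using ccw' by (auto simp: ccw_face_def)
    then show ?thesis
      unfolding ccw_face_def using \<sigma>
      by (intro exI[of _ "\<sigma> \<circ> (\<tau> \<circ> swap 1 2)"])
        (auto simp: evenperm_comp_finite bij_comp evenperm_swap Transposition.transpose_def)
  qed
  show "ccw_face (\<sigma> b) (\<sigma> c) (\<sigma> a) (\<sigma> q)"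
    by (rule odd[OF ccw_face_left[OF assms(1)]])
  show "ccw_face (\<sigma> a) (\<sigma> b) (\<sigma> c) (\<sigma> q)"
    by (rule odd[OF ccw_face_right[OF assms(1)]])
  show "ccw_face (\<sigma> c) (\<sigma> a) (\<sigma> b) (\<sigma> q)"
    by (rule odd[OF ccw_face_same[OF assms(1)]])
qed

text \<open>The labels \<open>q\<close> and \<open>c\<close> leave only the order of the ends of the
  edge open, and exchanging them would change the parity. Hence a crossing determines which end of
  its edge the frame puts at infinity.\<close>

lemma ccw_face_unique:
  assumes "ccw_face q a b c" "ccw_face q a' b' c"
  shows "a' = a \<and> b' = b"
proof (rule ccontr)
  assume neq: "\<not> (a' = a \<and> b' = b)"
  have dist: "distinct [q, a, b, c]" "distinct [q, a', b', c]"
    using assms by (auto dest: ccw_face_distinct)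
  have "i \<in> {q, a, b, c}" for i
    using UNIV_4_distinct[OF dist(1)] by blast
  from this[of a'] this[of b'] have swap: "a' = b" "b' = a"
    using neq dist by auto
  obtain \<tau> :: "4 \<Rightarrow> 4" where \<tau>: "bij \<tau>" "evenperm \<tau>" "\<tau> 0 = q" "\<tau> 1 = a" "\<tau> 2 = b" "\<tau> 3 = c"
    using assms by (auto simp: ccw_face_def)
  obtain \<tau>' :: "4 \<Rightarrow> 4" where \<tau>': "bij \<tau>'" "evenperm \<tau>'" "\<tau>' 0 = q" "\<tau>' 1 = b" "\<tau>' 2 = a" "\<tau>' 3 = c"
    using assms swap by (auto simp: ccw_face_def)
  have "\<tau>' i = (\<tau> \<circ> swap 1 2) i" for i
    using exhaust_4_from_0[of i] \<tau> \<tau>' by (auto simp: Transposition.transpose_def)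
  then have "\<tau>' = \<tau> \<circ> swap 1 2"
    by blast
  then have "\<not> evenperm \<tau>'"
    using \<tau> by (simp add: evenperm_comp_finite evenperm_swap)
  then show False
    using \<tau>' by blast
qed


section \<open>Brackets and cross ratios\<close>

text \<open>The determinant with columns \<open>x\<close> and \<open>y\<close>. Cross ratios are
  quotients of products of brackets, with no special role for infinity.\<close>

definition bracket :: "complex^2 \<Rightarrow> complex^2 \<Rightarrow> complex" where
  "bracket x y = x $ 1 * y $ 2 - x $ 2 * y $ 1"

lemma vec2_eq_iff: "x = y \<longleftrightarrow> x $ 1 = y $ 1 \<and> x $ 2 = (y :: 'a^2) $ 2"
  by (simp add: vec_eq_iff forall_2)

lemma matrix_vector_mult_2:
  "(A *v x) $ i = A $ i $ 1 * x $ 1 + A $ i $ 2 * (x :: 'a::semiring_1^2) $ 2"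
  by (simp add: matrix_vector_mult_def sum_2)

lemma matrix_matrix_mult_2:
  "(A ** B) $ i $ j = A $ i $ 1 * B $ 1 $ j + A $ i $ 2 * (B :: 'a::semiring_1^'n^2) $ 2 $ j"
  by (simp add: matrix_matrix_mult_def sum_2)

lemma bracket_self [simp]: "bracket x x = 0"
  by (simp add: bracket_def)

lemma bracket_swap: "bracket y x = - bracket x y"
  by (simp add: bracket_def)

lemma bracket_scale [simp]:
  "bracket (c *s x) y = c * bracket x y" "bracket x (c *s y) = c * bracket x y"
  by (simp_all add: bracket_def algebra_simps)

lemma bracket_mult: "bracket (A *v x) (A *v y) = det A * bracket x y"
  by (simp add: bracket_def matrix_vector_mult_2 det_2 algebra_simps)

lemma bracket_plucker:
  "bracket q a * bracket b c - bracket q b * bracket a c + bracket q c * bracket a b = 0"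
  by (simp add: bracket_def algebra_simps)

lemma same_ideal_point_refl [simp]: "same_ideal_point x x"
  unfolding same_ideal_point_def by (rule exI[of _ 1]) (simp add: vec2_eq_iff)

lemma same_ideal_point_sym: "same_ideal_point x y \<Longrightarrow> same_ideal_point y x"
  unfolding same_ideal_point_def
proof (elim exE conjE)
  fix c :: complex assume "c \<noteq> 0" "y = c *s x"
  then show "\<exists>c. c \<noteq> 0 \<and> x = c *s y"
    by (intro exI[of _ "inverse c"]) (simp add: vec2_eq_iff)
qed

lemma same_ideal_point_trans:
  "same_ideal_point x y \<Longrightarrow> same_ideal_point y z \<Longrightarrow> same_ideal_point x z"
  unfolding same_ideal_point_def
  by (metis mult_eq_0_iff vector_smult_assoc)

lemma same_ideal_point_scale: "c \<noteq> 0 \<Longrightarrow> same_ideal_point (c *s x) x"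
  by (rule same_ideal_point_sym) (auto simp: same_ideal_point_def)

lemma same_ideal_point_mult: "same_ideal_point x y \<Longrightarrow> same_ideal_point (A *v x) (A *v y)"
  unfolding same_ideal_point_def
  by (metis vector_scalar_commute)

lemma same_ideal_point_scaled_matrix:
  fixes A :: cmat2
  assumes "c \<noteq> 0"
  shows "same_ideal_point (mat c ** A *v x) y \<longleftrightarrow> same_ideal_point (A *v x) y"
proof -
  have "mat c ** A *v x = c *s (A *v x)"
    by (simp add: vec2_eq_iff matrix_vector_mult_2 matrix_matrix_mult_2 mat_def algebra_simps)
  then show ?thesis
    by (metis assms same_ideal_point_scale same_ideal_point_sym same_ideal_point_trans)
qed

lemma same_ideal_point_iff_bracket:
  assumes "x \<noteq> 0" "y \<noteq> 0"
  shows "same_ideal_point x y \<longleftrightarrow> bracket x y = 0"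
proof
  assume "same_ideal_point x y"
  then show "bracket x y = 0"
    by (auto simp: same_ideal_point_def)
next
  assume b: "bracket x y = 0"
  show "same_ideal_point x y"
  proof (cases "x $ 1 = 0")
    case True
    then have "x $ 2 \<noteq> 0" using assms by (auto simp: vec2_eq_iff)
    with True b have "y $ 1 = 0" by (simp add: bracket_def)
    then have "y $ 2 \<noteq> 0" using assms by (auto simp: vec2_eq_iff)
    then show ?thesis
      unfolding same_ideal_point_def using True \<open>x $ 2 \<noteq> 0\<close> \<open>y $ 1 = 0\<close>
      by (intro exI[of _ "y $ 2 / x $ 2"]) (simp add: vec2_eq_iff)
  next
    case False
    have eq: "y $ 2 = x $ 2 * y $ 1 / x $ 1"
      using b False by (simp add: bracket_def field_simps)
    then have "y $ 1 \<noteq> 0" using assms by (auto simp: vec2_eq_iff)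
    then show ?thesis
      unfolding same_ideal_point_def using False eq
      by (intro exI[of _ "y $ 1 / x $ 1"]) (simp add: vec2_eq_iff)
  qed
qed

lemma ideal_bracket [simp]:
  "bracket ideal_infinity (ideal_number z) = 1"
  "bracket (ideal_number z) ideal_infinity = - 1"
  "bracket (ideal_number z) (ideal_number z') = z - z'"
  by (simp_all add: bracket_def ideal_infinity_def ideal_number_def)

text \<open>The sign of this real number is the orientation of the tetrahedron with the vertices
  \<open>q, a, b, c\<close>; it is the imaginary part of their cross ratio, with denominators cleared.\<close>

definition orientation :: "(4 \<Rightarrow> complex^2) \<Rightarrow> real" where
  "orientation v = Im (bracket (v 0) (v 1) * bracket (v 2) (v 3) *
     cnj (bracket (v 0) (v 2) * bracket (v 1) (v 3)))"

text \<open>A transposition permutes, up to signs, the three products of brackets over pairs of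
  opposite edges. The Pluecker relation \<open>N = D - E\<close> shows that every permutation that
  occurs reverses the sign of \<open>Im (N * cnj D)\<close>.\<close>

lemma orientation_transpose:
  assumes "i \<noteq> j"
  shows "orientation (v \<circ> swap i j) = - orientation v"
proof -
  define b where "b i j = bracket (v i) (v j)" for i j
  define N D E where "N = b 0 1 * b 2 3" and "D = b 0 2 * b 1 3" and "E = b 0 3 * b 1 2"
  have bs: "b j i = - b i j" for i j
    unfolding b_def by (rule bracket_swap)
  have o: "orientation (v \<circ> \<rho>) =
      Im (b (\<rho> 0) (\<rho> 1) * b (\<rho> 2) (\<rho> 3) * cnj (b (\<rho> 0) (\<rho> 2) * b (\<rho> 1) (\<rho> 3)))" for \<rho>
    by (simp add: orientation_def b_def)
  have "N = D - E"
    unfolding N_def D_def E_def b_def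
    using bracket_plucker[of "v 0" "v 1" "v 2" "v 3"] by (simp add: algebra_simps)
  then have NDE: "Im (N * cnj E) = Im (N * cnj D)" "Im (E * cnj D) = - Im (N * cnj D)"
    "Im (D * cnj N) = - Im (N * cnj D)"
    by (simp_all add: \<open>N = D - E\<close> algebra_simps)
  have v: "orientation v = Im (N * cnj D)"
    using o[of id] by (simp add: N_def D_def)
  let ?t = "\<lambda>i j. orientation (v \<circ> swap i j) = - orientation v"
  have *: "?t i j" if "b (swap i j 0) (swap i j 1) *
      b (swap i j 2) (swap i j 3) = N'"
      "b (swap i j 0) (swap i j 2) *
      b (swap i j 1) (swap i j 3) = D'"
      "(N', D') = (- N, E) \<or> (N', D') = (- E, - D) \<or> (N', D') = (D, N)"
    for i j N' D'
  proof -
    have "orientation (v \<circ> swap i j) = Im (N' * cnj D')"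
      using o[of "swap i j"] that(1,2) by simp
    then show ?thesis
      using that(3) NDE unfolding v by auto
  qed
  have "?t 0 1"
    by (rule *[of 0 1 "- N" E]) (simp_all add: Transposition.transpose_def N_def E_def bs[of 1 0])
  moreover have "?t 2 3"
    by (rule *[of 2 3 "- N" E]) (simp_all add: Transposition.transpose_def N_def E_def bs[of 3 2])
  moreover have "?t 0 2"
    by (rule *[of 0 2 "- E" "- D"])
      (simp_all add: Transposition.transpose_def D_def E_def bs[of 2 0] bs[of 2 1])
  moreover have "?t 1 3"
    by (rule *[of 1 3 "- E" "- D"])
      (simp_all add: Transposition.transpose_def D_def E_def bs[of 3 1] bs[of 2 1])
  moreover have "?t 1 2"
    by (rule *[of 1 2 D N]) (simp_all add: Transposition.transpose_def D_def N_def)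
  moreover have "?t 0 3"
    by (rule *[of 0 3 D N])
      (simp_all add: Transposition.transpose_def D_def N_def bs[of 3 1] bs[of 3 2] bs[of 1 0] bs[of 2 0])
  ultimately show ?thesis
    using assms exhaust_4_from_0[of i] exhaust_4_from_0[of j]
    by (metis Transposition.transpose_commute)
qed

lemma orientation_permute:
  assumes "bij \<tau>"
  shows "orientation (v \<circ> \<tau>) = (if evenperm \<tau> then orientation v else - orientation v)"
proof -
  have "finite (UNIV :: 4 set)" "\<tau> permutes UNIV"
    using assms bij_imp_permutes[of \<tau> UNIV] by simp_all
  then show ?thesis
  proof (induction rule: permutes_rev_induct)
    case id
    then show ?case by simp
  next
    case (swap i j \<rho>)
    have "orientation (v \<circ> (\<rho> \<circ> swap i j)) = - orientation (v \<circ> \<rho>)"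
      using orientation_transpose[OF swap.hyps(3), of "v \<circ> \<rho>"] by (simp add: comp_assoc)
    moreover have "evenperm (\<rho> \<circ> swap i j) \<longleftrightarrow> \<not> evenperm \<rho>"
      using swap.hyps by (simp add: evenperm_comp_finite permutes_bij evenperm_swap)
    ultimately show ?case
      using swap.IH by (cases "evenperm \<rho>")
        (simp_all only: if_True if_False not_True_eq_False not_False_eq_True minus_minus)
  qed
qed

lemma positively_labelled_orientation:
  assumes "positively_labelled v"
  shows "0 < orientation v"
proof -
  obtain A z c where A: "det A = 1" "0 < Im z"
    and c: "\<And>i. c i \<noteq> 0"
      "ideal_infinity = c 0 *s (A *v v 0)" "ideal_number 0 = c (1::4) *s (A *v v 1)"
      "ideal_number 1 = c 2 *s (A *v v 2)" "ideal_number z = c 3 *s (A *v v 3)"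
  proof -
    obtain A z c0 c1 c2 c3 where *: "det A = 1" "0 < Im z" "c0 \<noteq> 0" "c1 \<noteq> 0" "c2 \<noteq> 0" "c3 \<noteq> 0"
      "ideal_infinity = c0 *s (A *v v 0)" "ideal_number 0 = c1 *s (A *v v 1)"
      "ideal_number 1 = c2 *s (A *v v 2)" "ideal_number z = c3 *s (A *v v 3)"
      using assms unfolding positively_labelled_def same_ideal_point_def by blast
    show thesis
      by (rule that[of A z "\<lambda>i. if i = 0 then c0 else if i = 1 then c1 else if i = 2 then c2 else c3"])
        (use * in auto)
  qed
  define C where "C = c 0 * c 1 * c 2 * c 3"
  have br: "bracket (v 0) (v 1) = 1 / (c 0 * c 1)" "bracket (v 2) (v 3) = (1 - z) / (c 2 * c 3)"
    "bracket (v 0) (v 2) = 1 / (c 0 * c 2)" "bracket (v 1) (v 3) = - z / (c 1 * c 3)"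
    using ideal_bracket(1)[of 0] ideal_bracket(1)[of 1] ideal_bracket(3)[of 1 z] ideal_bracket(3)[of 0 z] c(1) A(1)
    unfolding c(2-5) by (simp_all add: bracket_mult field_simps del: ideal_bracket)
  have "C \<noteq> 0" using c by (simp add: C_def)
  have "bracket (v 0) (v 1) * bracket (v 2) (v 3) = (1 - z) / C"
    "bracket (v 0) (v 2) * bracket (v 1) (v 3) = - z / C"
    using c(1) by (simp_all add: br C_def field_simps)
  \<comment> \<open>The scaling factors of the four vertices enter only through the positive number
    \<open>C * cnj C\<close>.\<close>
  then have "orientation v = Im ((1 - z) * (- cnj z) / (C * cnj C))"
    unfolding orientation_def by simp
  also have "C * cnj C = of_real ((cmod C)\<^sup>2)"
    by (rule complex_norm_square[symmetric])
  also have "Im ((1 - z) * (- cnj z) / of_real ((cmod C)\<^sup>2)) = Im z / (cmod C)\<^sup>2"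
    by (simp add: algebra_simps)
  finally show ?thesis
    using A(2) \<open>C \<noteq> 0\<close> by simp
qed

lemma ccw_face_orientation:
  assumes "positively_labelled v" "ccw_face q a b c"
  shows "0 < Im (bracket (v q) (v a) * bracket (v b) (v c) * cnj (bracket (v q) (v b) * bracket (v a) (v c)))"
proof -
  obtain \<tau> :: "4 \<Rightarrow> 4" where "bij \<tau>" "evenperm \<tau>" "\<tau> 0 = q" "\<tau> 1 = a" "\<tau> 2 = b" "\<tau> 3 = c"
    using assms by (auto simp: ccw_face_def)
  then show ?thesis
    using orientation_permute[of \<tau> v] positively_labelled_orientation[OF assms(1)]
    by (simp add: orientation_def)
qed

text \<open>If this bracket vanished, so would the orientation of a relabelling with
  \<open>i\<close> and \<open>j\<close> in the first two places.\<close>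

lemma positively_labelled_bracket_nonzero:
  assumes "positively_labelled v" "i \<noteq> j"
  shows "bracket (v i) (v j) \<noteq> 0"
proof -
  obtain \<tau> :: "4 \<Rightarrow> 4" where \<tau>: "bij \<tau>" "\<tau> 0 = i" "\<tau> 1 = j"
  proof -
    \<comment> \<open>The label that \<open>swap 0 i\<close> takes to \<open>j\<close>; it has to be
      brought to place 1 beforehand.\<close>
    define k where "k = swap 0 i j"
    have "k \<noteq> 0"
      using assms(2) by (auto simp: k_def Transposition.transpose_def split: if_splits)
    then have 0: "swap 1 k 0 = 0"
      by (simp add: Transposition.transpose_def)
    show thesis
      by (rule that[of "swap 0 i \<circ> swap 1 k"])
        (simp_all add: 0 bij_comp, simp add: k_def)
  qed
  have "orientation (v \<circ> \<tau>) \<noteq> 0"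
    using orientation_permute[OF \<tau>(1), of v] positively_labelled_orientation[OF assms(1)] by simp
  then show ?thesis
    using \<tau> by (auto simp: orientation_def)
qed

text \<open>Two of the four labellings admitted by the definition have the wrong orientation and would give
  a parameter in the lower half plane; the other two give the same cross ratio.\<close>

lemma shape_parameter_cross_ratio:
  assumes pos: "positively_labelled v" and ccw: "ccw_face q a b c"
    and shape: "has_shape_parameter v {a, b} z"
  shows "z * (bracket (v q) (v b) * bracket (v a) (v c)) = bracket (v q) (v a) * bracket (v b) (v c)"
proof -
  obtain a' b' c' d' A where *: "0 < Im z" "distinct [a', b', c', d']" "{a, b} = {a', b'}" "det A = 1"
    "same_ideal_point (A *v v a') (ideal_number 0)"
    "same_ideal_point (A *v v b') ideal_infinity"
    "same_ideal_point (A *v v c') (ideal_number 1)"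
    "same_ideal_point (A *v v d') (ideal_number z)"
    using shape unfolding has_shape_parameter_def by blast
  obtain ca cb cc cd where k: "ca \<noteq> 0" "cb \<noteq> 0" "cc \<noteq> 0" "cd \<noteq> 0"
    "ideal_number 0 = ca *s (A *v v a')" "ideal_infinity = cb *s (A *v v b')"
    "ideal_number 1 = cc *s (A *v v c')" "ideal_number z = cd *s (A *v v d')"
    using *(5-8) unfolding same_ideal_point_def by blast
  have br: "bracket (v b') (v d') = 1 / (cb * cd)" "bracket (v a') (v c') = - 1 / (ca * cc)"
    "bracket (v b') (v c') = 1 / (cb * cc)" "bracket (v a') (v d') = - z / (ca * cd)"
    using ideal_bracket(1)[of z] ideal_bracket(1)[of 1] ideal_bracket(3)[of 0 1] ideal_bracket(3)[of 0 z] k(1-4) *(4)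
    unfolding k(5-8) by (simp_all add: bracket_mult field_simps del: ideal_bracket)
  have eq: "z * (bracket (v b') (v d') * bracket (v a') (v c')) = bracket (v b') (v c') * bracket (v a') (v d')"
    using k(1-4) by (simp add: br field_simps)
  have ori: "0 < Im (bracket (v b') (v c') * bracket (v a') (v d') * cnj (bracket (v b') (v d') * bracket (v a') (v c')))"
  proof -
    define W where "W = bracket (v b') (v d') * bracket (v a') (v c')"
    have "W \<noteq> 0"
      unfolding W_def using *(2) by (auto intro!: positively_labelled_bracket_nonzero[OF pos])
    have "bracket (v b') (v c') * bracket (v a') (v d') * cnj W = z * (W * cnj W)"
      using eq unfolding W_def[symmetric] by (simp add: mult.assoc)
    also have "\<dots> = z * of_real ((cmod W)\<^sup>2)"
      by (simp only: complex_norm_square)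
    finally show ?thesis
      unfolding W_def[symmetric] using *(1) \<open>W \<noteq> 0\<close> by simp
  qed
  note pos' = ccw_face_orientation[OF pos ccw]
  have dist: "distinct [a, b, q, c]"
    using ccw_face_distinct[OF ccw] by auto
  have "i \<in> {a, b, q, c}" for i
    using UNIV_4_distinct[OF dist] by blast
  from this[of c'] this[of d'] have "(a' = a \<and> b' = b \<or> a' = b \<and> b' = a) \<and> (c' = q \<and> d' = c \<or> c' = c \<and> d' = q)"
    using *(2,3) dist by (auto simp: doubleton_eq_iff)
  then consider "a' = a" "b' = b" "c' = q" "d' = c" | "a' = a" "b' = b" "c' = c" "d' = q"
    | "a' = b" "b' = a" "c' = q" "d' = c" | "a' = b" "b' = a" "c' = c" "d' = q"
    by blast
  then show ?thesis
  proof cases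
    case 1
    with ori pos' have False
      by (simp add: bracket_swap[of "v q" "v b"] bracket_swap[of "v q" "v a"])
        (simp add: algebra_simps)
    then show ?thesis ..
  next
    case 2
    with eq show ?thesis
      by (simp add: bracket_swap[of "v q" "v b"] bracket_swap[of "v q" "v a"] mult.commute)
  next
    case 3
    with eq show ?thesis
      by (simp add: bracket_swap[of "v q" "v b"] bracket_swap[of "v q" "v a"] mult.commute)
  next
    case 4
    with ori pos' have False
      by (simp add: bracket_swap[of "v q" "v b"] bracket_swap[of "v q" "v a"])
        (simp add: algebra_simps)
    then show ?thesis ..
  qed
qed


section \<open>Frames\<close>

lemma mat2_nth [simp]:
  "mat2 a b c d $ 1 $ 1 = a" "mat2 a b c d $ 1 $ 2 = b"
  "mat2 a b c d $ 2 $ 1 = c" "mat2 a b c d $ 2 $ 2 = d"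
  by (simp_all add: mat2_def)

lemma ideal_nth [simp]:
  "ideal_infinity $ 1 = 1" "ideal_infinity $ 2 = 0"
  "ideal_number z $ 1 = z" "ideal_number z $ 2 = 1"
  by (simp_all add: ideal_infinity_def ideal_number_def)

text \<open>No determinant is prescribed: frames are projective maps, and no square root has to be
  chosen to normalise them. Scalars are compared once, after a full period.\<close>

definition frame :: "cmat2 \<Rightarrow> complex^2 \<Rightarrow> complex^2 \<Rightarrow> complex^2 \<Rightarrow> bool" where
  "frame F x y z \<longleftrightarrow> det F \<noteq> 0 \<and> same_ideal_point (F *v ideal_infinity) x \<and>
     same_ideal_point (F *v ideal_number 0) y \<and> same_ideal_point (F *v ideal_number (- 1)) z"

lemma frame_cong:
  assumes "frame F x y z" "same_ideal_point x x'" "same_ideal_point y y'" "same_ideal_point z z'"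
  shows "frame F x' y' z'"
  using assms same_ideal_point_trans unfolding frame_def by blast

lemma frame_transform: "det A \<noteq> 0 \<Longrightarrow> frame F x y z \<Longrightarrow> frame (A ** F) (A *v x) (A *v y) (A *v z)"
  by (auto simp: frame_def det_mul matrix_vector_mul_assoc[symmetric] intro: same_ideal_point_mult)

lemma frame_exists:
  assumes "bracket x y \<noteq> 0" "bracket z y \<noteq> 0" "bracket z x \<noteq> 0"
  obtains F where "frame F x y z"
proof -
  \<comment> \<open>The columns are multiples of \<open>x\<close> and \<open>y\<close> whose
    difference is, by Cramer's rule, a multiple of \<open>z\<close>.\<close>
  define F where "F = mat2 (bracket z y * x $ 1) (bracket z x * y $ 1) (bracket z y * x $ 2) (bracket z x * y $ 2)"
  have "det F = bracket z y * bracket z x * bracket x y"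
    by (simp add: F_def det_2 bracket_def algebra_simps)
  moreover have "F *v ideal_infinity = bracket z y *s x" "F *v ideal_number 0 = bracket z x *s y"
    "F *v ideal_number (- 1) = (- bracket x y) *s z"
    by (simp_all add: F_def vec2_eq_iff matrix_vector_mult_2 bracket_def algebra_simps)
  ultimately have "frame F x y z"
    using assms same_ideal_point_scale[of "- bracket x y" z]
    unfolding frame_def by (simp add: same_ideal_point_scale)
  then show thesis
    by (rule that)
qed

lemma frame_unique:
  assumes "frame F x y z" "frame F' x y z"
  obtains c where "c \<noteq> 0" "F' = mat c ** F"
proof -
  have "same_ideal_point (F *v ideal_infinity) (F' *v ideal_infinity)"
    "same_ideal_point (F *v ideal_number 0) (F' *v ideal_number 0)"
    "same_ideal_point (F *v ideal_number (- 1)) (F' *v ideal_number (- 1))"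
    using assms unfolding frame_def by (blast intro: same_ideal_point_trans same_ideal_point_sym)+
  then obtain a b c where *: "a \<noteq> 0" "F' *v ideal_infinity = a *s (F *v ideal_infinity)"
    "F' *v ideal_number 0 = b *s (F *v ideal_number 0)"
    "F' *v ideal_number (- 1) = c *s (F *v ideal_number (- 1))"
    unfolding same_ideal_point_def by blast
  have ab: "F' $ 1 $ 1 = a * F $ 1 $ 1" "F' $ 2 $ 1 = a * F $ 2 $ 1"
    "F' $ 1 $ 2 = b * F $ 1 $ 2" "F' $ 2 $ 2 = b * F $ 2 $ 2"
    "F' $ 1 $ 2 - F' $ 1 $ 1 = c * (F $ 1 $ 2 - F $ 1 $ 1)"
    "F' $ 2 $ 2 - F' $ 2 $ 1 = c * (F $ 2 $ 2 - F $ 2 $ 1)"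
    using *(2-4) by (simp_all add: vec2_eq_iff matrix_vector_mult_2)
  \<comment> \<open>This is a linear relation between the independent columns of \<open>F\<close>,
    so its coefficients \<open>a - c\<close> and \<open>b - c\<close> vanish.\<close>
  then have "(a - c) * F $ 1 $ 1 = (b - c) * F $ 1 $ 2" "(a - c) * F $ 2 $ 1 = (b - c) * F $ 2 $ 2"
    by (simp_all add: algebra_simps)
  then have e: "(a - c) * F $ 1 $ 1 * x = (b - c) * F $ 1 $ 2 * x"
      "(a - c) * F $ 2 $ 1 * x = (b - c) * F $ 2 $ 2 * x" for x
    by simp_all
  have "(a - c) * det F = (a - c) * F $ 1 $ 1 * F $ 2 $ 2 - (a - c) * F $ 2 $ 1 * F $ 1 $ 2"
    "(b - c) * det F = (b - c) * F $ 2 $ 2 * F $ 1 $ 1 - (b - c) * F $ 1 $ 2 * F $ 2 $ 1"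
    by (simp_all add: det_2 algebra_simps)
  then have "(a - c) * det F = 0" "(b - c) * det F = 0"
    using e(1)[of "F $ 2 $ 2"] e(2)[of "F $ 1 $ 2"] e(1)[of "F $ 2 $ 1"] e(2)[of "F $ 1 $ 1"]
    by (simp_all only: mult_ac diff_self)
  then have "b = a"
    using assms(1) by (simp add: frame_def)
  then have "F' = mat a ** F"
    using ab by (simp add: vec2_eq_iff matrix_matrix_mult_2 mat_def)
  then show thesis
    using that *(1) by blast
qed

text \<open>Since \<open>F\<close> multiplies every bracket by \<open>det F\<close> and the scaling
  factors cancel, the relation \<open>Z\<close> may be read with \<open>a\<close>, \<open>b\<close>,
  \<open>q\<close> at infinity, 0, - 1, where it places \<open>c\<close> at
  \<open>- Z\<close>.\<close>

lemma frame_cross_ratio: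
  assumes F: "frame F a b q"
    and Z: "Z * (bracket q b * bracket a c) = bracket q a * bracket b c"
    and "bracket a b \<noteq> 0" "c \<noteq> 0"
  shows "same_ideal_point (F *v ideal_number (- Z)) c"
proof -
  obtain i j k where *: "a = i *s (F *v ideal_infinity)" "b = j *s (F *v ideal_number 0)"
    "q = k *s (F *v ideal_number (- 1))" "i \<noteq> 0" "j \<noteq> 0" "k \<noteq> 0" "det F \<noteq> 0"
    using F unfolding frame_def same_ideal_point_def by blast
  have "invertible F"
    using * by (simp add: invertible_det_nz)
  then have ne: "F *v ideal_number (- Z) \<noteq> 0"
    by (metis ideal_nth(4) invertible_def matrix_left_invertible_injective matrix_vector_mult_0_right
        zero_index zero_neq_one inj_eq)
  have ab: "bracket q a = - k * i * det F" "bracket q b = - k * j * det F"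
    unfolding * by (simp_all add: bracket_mult)
  have "Z * (j * bracket a c) = i * bracket b c"
    using Z *(4-7) unfolding ab by simp
  then have "i * j * bracket (F *v ideal_number (- Z)) c = 0"
    unfolding *(1,2)
    by (simp add: bracket_def matrix_vector_mult_2 algebra_simps)
  then have "bracket (F *v ideal_number (- Z)) c = 0"
    using *(4,5) by simp
  then show ?thesis
    using ne \<open>c \<noteq> 0\<close> by (simp add: same_ideal_point_iff_bracket)
qed

lemma frame_mult:
  assumes "det F \<noteq> 0" "det P \<noteq> 0"
    and "same_ideal_point p1 (P *v ideal_infinity)" "same_ideal_point (F *v p1) x"
    and "same_ideal_point p2 (P *v ideal_number 0)" "same_ideal_point (F *v p2) y"
    and "same_ideal_point p3 (P *v ideal_number (- 1))" "same_ideal_point (F *v p3) z"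
  shows "frame (F ** P) x y z"
  unfolding frame_def
proof (intro conjI)
  have *: "same_ideal_point (F ** P *v e) x" if "same_ideal_point p (P *v e)" "same_ideal_point (F *v p) x" for p e x
    using that same_ideal_point_mult[of p "P *v e" F] unfolding matrix_vector_mul_assoc
    by (meson same_ideal_point_sym same_ideal_point_trans)
  show "same_ideal_point (F ** P *v ideal_infinity) x" "same_ideal_point (F ** P *v ideal_number 0) y"
    "same_ideal_point (F ** P *v ideal_number (- 1)) z"
    using * assms by blast+
qed (use assms in \<open>simp add: det_mul\<close>)

text \<open>A frame adapted to the crossing of an edge cone, with \<open>\<infinity>, 0, - 1\<close> at the ends of the edge and
  at the vertex of the tetrahedron facing the suspension to be entered, is carried by
  \<open>diag(w, 1 / w)\<close> to one with \<open>1\<close> at the third vertex \<open>t\<close> of the face entered. Each turning matrix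
  then permutes \<open>\<infinity>, 0, 1\<close> (up to \<open>- 1\<close>) so that the frame is adapted to the next crossing.\<close>

lemma frame_turning:
  assumes F: "frame F x y z" and t: "same_ideal_point (F *v ideal_number (- Z)) t"
    and w: "w\<^sup>2 = - Z" "Z \<noteq> 0" and u: "u\<^sup>2 = - 1"
  defines "D \<equiv> mat2 w 0 0 (inverse w)"
  shows "frame (F ** (D ** mat2 1 1 0 1)) x t y"
    and "frame (F ** (D ** mat2 1 0 1 1)) t y x"
    and "frame (F ** (D ** mat2 0 1 (- 1) 0)) y x t"
    and "frame (F ** (D ** mat2 u u u 0)) t x y"
    and "frame (F ** (D ** mat2 0 u u u)) y t x"
    and "frame (F ** (D ** mat2 (inverse u) 0 0 u)) x y t"
proof -
  have w0: "w \<noteq> 0" and u0: "u \<noteq> 0"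
    using w u by auto
  have u2: "u * u = - 1" and w2: "w * w = - Z"
    using u w by (simp_all add: power2_eq_square)
  have iu: "inverse u = - u"
    using u2 u0 by (simp add: field_simps)
  have Z: "Z = - (w * w)"
    using w2 by simp
  have F': "det F \<noteq> 0" "same_ideal_point (F *v ideal_infinity) x" "same_ideal_point (F *v ideal_number 0) y"
    using F by (auto simp: frame_def)
  note simps = D_def det_2 matrix_matrix_mult_2 matrix_vector_mult_2 vec2_eq_iff w0 u0 u2 Z iu
  have same: "same_ideal_point p q" if "c \<noteq> 0" "q = c *s p" for p q :: "complex^2" and c
    using that by (auto simp: same_ideal_point_def)
  show "frame (F ** (D ** mat2 1 1 0 1)) x t y"
    by (rule frame_mult[OF F'(1) _ same[of w] F'(2) same[of "inverse w"] t same[of "inverse w"] F'(3)])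
      (simp_all add: simps)
  show "frame (F ** (D ** mat2 1 0 1 1)) t y x"
    by (rule frame_mult[OF F'(1) _ same[of "inverse w"] t same[of "inverse w"] F'(3) same[of "- w"] F'(2)])
      (simp_all add: simps)
  show "frame (F ** (D ** mat2 0 1 (- 1) 0)) y x t"
    by (rule frame_mult[OF F'(1) _ same[of "- inverse w"] F'(3) same[of "w"] F'(2) same[of "inverse w"] t])
      (simp_all add: simps)
  show "frame (F ** (D ** mat2 u u u 0)) t x y"
    by (rule frame_mult[OF F'(1) _ same[of "u * inverse w"] t same[of "u * w"] F'(2) same[of "- u * inverse w"] F'(3)])
      (simp_all add: simps)
  show "frame (F ** (D ** mat2 0 u u u)) y t x"
    by (rule frame_mult[OF F'(1) _ same[of "u * inverse w"] F'(3) same[of "u * inverse w"] t same[of "u * w"] F'(2)])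
      (simp_all add: simps)
  show "frame (F ** (D ** mat2 (inverse u) 0 0 u)) x y t"
    by (rule frame_mult[OF F'(1) _ same[of "- u * w"] F'(2) same[of "u * inverse w"] F'(3) same[of "u * inverse w"] t])
      (simp_all add: simps)
qed


section \<open>State sums\<close>

primrec matrix_product :: "(nat \<Rightarrow> cmat2) \<Rightarrow> nat \<Rightarrow> cmat2" where
  "matrix_product N 0 = mat 1"
| "matrix_product N (Suc n) = matrix_product N n ** N n"

lemma det_matrix_product: "(\<And>i. i < n \<Longrightarrow> det (N i) = 1) \<Longrightarrow> det (matrix_product N n) = 1"
  by (induction n) (simp_all add: det_mul)

lemma sum_PiE_insert:
  assumes "i \<notin> I"
  shows "(\<Sum>s\<in>insert i I \<rightarrow>\<^sub>E S. h s) = (\<Sum>y\<in>S. \<Sum>s\<in>I \<rightarrow>\<^sub>E S. h (s(i := y)))"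
proof -
  have "(\<Sum>s\<in>insert i I \<rightarrow>\<^sub>E S. h s) = (\<Sum>(y, s)\<in>S \<times> (I \<rightarrow>\<^sub>E S). h (s(i := y)))"
    unfolding PiE_insert_eq
    by (subst sum.reindex[OF inj_combinator[OF assms]]) (simp add: case_prod_unfold)
  then show ?thesis
    by (simp add: sum.cartesian_product)
qed

text \<open>A sum over paths: \<open>s j\<close> is the row index of the factor \<open>N j\<close>,
  and its column index is the next row index, or \<open>b\<close> at the end. The first row index
  remains a summation variable, tied down by \<open>s 0 = a\<close>, so that for the trace all paths
  can be collected into closed states.\<close>

lemma sign_entry_matrix_product:
  assumes a: "a \<in> {1, - 1}" and b: "b \<in> {1, - 1}"
  shows "sign_entry (matrix_product N (Suc n)) a b =
    (\<Sum>s\<in>{..<Suc n} \<rightarrow>\<^sub>E {1, - 1}. if s 0 = a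
       then \<Prod>j<Suc n. sign_entry (N j) (s j) (if j < n then s (Suc j) else b) else 0)"
  using b
proof (induction n arbitrary: b)
  case 0
  have "{..<Suc 0} = insert 0 {}"
    by auto
  then have "(\<Sum>s\<in>{..<Suc 0} \<rightarrow>\<^sub>E {1, - 1}. h s) = (\<Sum>y\<in>{1, - 1}. h ((\<lambda>_. undefined)(0 := y)))"
    for h :: "(nat \<Rightarrow> int) \<Rightarrow> complex"
    by (simp only:) (subst sum_PiE_insert, simp_all add: fun_upd_def)
  then show ?case
    using a by (elim insertE) (simp_all add: sign_entry_def matrix_mul_lid del: lessThan_Suc)
next
  case (Suc n)
  let ?h = "\<lambda>s. if s 0 = a then \<Prod>j<Suc (Suc n). sign_entry (N j) (s j) (if j < Suc n then s (Suc j) else b) else 0"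
  have ins: "{..<Suc (Suc n)} = insert (Suc n) {..<Suc n}"
    by auto
  have h: "?h (s(Suc n := y)) = (if s 0 = a
      then \<Prod>j<Suc n. sign_entry (N j) (s j) (if j < n then s (Suc j) else y) else 0) * sign_entry (N (Suc n)) y b"
    for s y
  proof -
    have "(\<Prod>j<Suc n. sign_entry (N j) ((s(Suc n := y)) j) (if j < Suc n then (s(Suc n := y)) (Suc j) else b))
        = (\<Prod>j<Suc n. sign_entry (N j) (s j) (if j < n then s (Suc j) else y))"
      by (intro prod.cong) auto
    then show ?thesis
      by simp
  qed
  have "(\<Sum>s\<in>{..<Suc (Suc n)} \<rightarrow>\<^sub>E {1, - 1}. ?h s) = (\<Sum>y\<in>{1, - 1}. \<Sum>s\<in>{..<Suc n} \<rightarrow>\<^sub>E {1, - 1}. ?h (s(Suc n := y)))"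
    unfolding ins by (rule sum_PiE_insert) simp
  also have "\<dots> = (\<Sum>y\<in>{1, - 1}. sign_entry (matrix_product N (Suc n)) a y * sign_entry (N (Suc n)) y b)"
    unfolding h sum_distrib_right[symmetric] using Suc.IH by (intro sum.cong) simp_all
  also have "\<dots> = sign_entry (matrix_product N (Suc n) ** N (Suc n)) a b"
    by (simp add: sign_entry_def matrix_matrix_mult_2)
  finally show ?case
    by simp
qed

lemma trace_matrix_product:
  assumes "1 \<le> k"
  shows "trace (matrix_product N k) =
    (\<Sum>s\<in>{..<k} \<rightarrow>\<^sub>E {1, - 1}. \<Prod>i<k. sign_entry (N i) (s i) (s (Suc i mod k)))"
proof -
  obtain n where k: "k = Suc n"
    using assms by (cases k) auto
  let ?S = "{..<k} \<rightarrow>\<^sub>E {1, - 1 :: int}"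
  let ?h = "\<lambda>a s. if s 0 = a then \<Prod>j<k. sign_entry (N j) (s j) (if j < n then s (Suc j) else a) else 0"
  have "trace (matrix_product N k) = (\<Sum>a\<in>{1, - 1}. sign_entry (matrix_product N k) a a)"
    by (simp add: trace_def sum_2 sign_entry_def)
  also have "\<dots> = (\<Sum>a\<in>{1, - 1}. \<Sum>s\<in>?S. ?h a s)"
    unfolding k by (intro sum.cong sign_entry_matrix_product) auto
  also have "\<dots> = (\<Sum>s\<in>?S. \<Sum>a\<in>{1, - 1}. ?h a s)"
    by (rule sum.swap)
  also have "\<dots> = (\<Sum>s\<in>?S. \<Prod>i<k. sign_entry (N i) (s i) (s (Suc i mod k)))"
  proof (rule sum.cong)
    fix s assume "s \<in> ?S"
    then have s0: "s 0 \<in> {1, - 1}"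
      unfolding k by (auto dest!: PiE_mem[of _ _ _ 0])
    \<comment> \<open>Only \<open>a = s 0\<close> contributes, and with \<open>b = a\<close> the
      path closes up.\<close>
    then have "(\<Sum>a\<in>{1, - 1}. ?h a s) = ?h (s 0) s"
      by auto
    also have "\<dots> = (\<Prod>i<k. sign_entry (N i) (s i) (s (Suc i mod k)))"
      unfolding k by (auto intro!: prod.cong simp: mod_Suc)
    finally show "(\<Sum>a\<in>{1, - 1}. ?h a s) = (\<Prod>i<k. sign_entry (N i) (s i) (s (Suc i mod k)))" .
  qed simp
  finally show ?thesis .
qed

lemma sign_entry_diag_mult:
  assumes "s \<in> {1, - 1}"
  shows "sign_entry (mat2 w 0 0 (inverse w) ** M) s s' = w powi s * sign_entry M s s'"
  using assms by (auto simp: sign_entry_def matrix_matrix_mult_2 power_int_minus)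

lemma trace_state_sum:
  assumes "1 \<le> k"
  shows "trace (matrix_product (\<lambda>i. mat2 (w i) 0 0 (inverse (w i)) ** M i) k) =
    (\<Sum>s\<in>{..<k} \<rightarrow>\<^sub>E {1, - 1}.
       (\<Prod>i<k. sign_entry (M i) (s i) (s (Suc i mod k))) * (\<Prod>i<k. w i powi s i))"
  unfolding trace_matrix_product[OF assms]
proof (rule sum.cong)
  fix s assume "s \<in> {..<k} \<rightarrow>\<^sub>E {1, - 1 :: int}"
  then have "s i \<in> {1, - 1}" if "i < k" for i
    using that PiE_mem lessThan_iff by blast
  then show "(\<Prod>i<k. sign_entry (mat2 (w i) 0 0 (inverse (w i)) ** M i) (s i) (s (Suc i mod k))) =
      (\<Prod>i<k. sign_entry (M i) (s i) (s (Suc i mod k))) * (\<Prod>i<k. w i powi s i)"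
    by (simp only: prod.distrib[symmetric])
      (intro prod.cong refl, simp only: lessThan_iff sign_entry_diag_mult mult.commute)
qed simp


section \<open>Minkowski space\<close>

lemma mink_eq: "mink X Y = Re (X $ 1 $ 1 * Y $ 2 $ 2 + X $ 2 $ 2 * Y $ 1 $ 1 - X $ 1 $ 2 * Y $ 2 $ 1 - X $ 2 $ 1 * Y $ 1 $ 2) / 2"
  unfolding mink_def det_2 by (simp add: algebra_simps)

lemma mink_commute: "mink X Y = mink Y X"
  by (simp add: mink_def add.commute)

lemma mink_add_left: "mink (X + Y) W = mink X W + mink Y W"
  and mink_add_right: "mink W (X + Y) = mink W X + mink W Y"
  by (simp_all add: mink_eq algebra_simps add_divide_distrib diff_divide_distrib)

lemma mink_scaleR_left: "mink (c *\<^sub>R X) W = c * mink X W"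
  and mink_scaleR_right: "mink W (c *\<^sub>R X) = c * mink W X"
  by (simp_all add: mink_eq algebra_simps add_divide_distrib diff_divide_distrib)

lemma mink_diff_left: "mink (X - Y) W = mink X W - mink Y W"
  and mink_diff_right: "mink W (X - Y) = mink W X - mink W Y"
  by (simp_all add: mink_eq algebra_simps add_divide_distrib diff_divide_distrib)

lemma mink_zero [simp]: "mink 0 X = 0" "mink X 0 = 0"
  by (simp_all add: mink_eq)

lemma mink_sum_left: "mink (\<Sum>i\<in>I. f i) W = (\<Sum>i\<in>I. mink (f i) W)"
  by (induction I rule: infinite_finite_induct) (simp_all add: mink_add_left)

lemma mink_sum_right: "mink W (\<Sum>i\<in>I. f i) = (\<Sum>i\<in>I. mink W (f i))"
  by (simp add: mink_commute[of W] mink_sum_left)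

lemmas mink_linear = mink_add_left mink_add_right mink_scaleR_left mink_scaleR_right

lemma adjoint_mat_nth [simp]: "adjoint_mat A $ i $ j = cnj (A $ j $ i)"
  by (simp add: adjoint_mat_def)

lemma mat2_eq_iff: "X = Y \<longleftrightarrow> X $ 1 $ 1 = Y $ 1 $ 1 \<and> X $ 1 $ 2 = Y $ 1 $ 2 \<and>
    X $ 2 $ 1 = Y $ 2 $ 1 \<and> X $ 2 $ 2 = (Y :: 'a^2^2) $ 2 $ 2"
  by (auto simp: vec2_eq_iff)

lemma det_hermitian:
  assumes "adjoint_mat X = X"
  shows "det X = of_real (mink X X)"
proof -
  have "cnj (X $ 1 $ 1) = X $ 1 $ 1" "cnj (X $ 2 $ 2) = X $ 2 $ 2" "X $ 2 $ 1 = cnj (X $ 1 $ 2)"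
    using assms by (metis adjoint_mat_nth)+
  then show ?thesis
    unfolding det_2 mink_eq by (auto simp: complex_eq_iff)
qed

lemma H3_mink: "X \<in> H3 \<Longrightarrow> mink X X = 1"
  unfolding H3_def using det_hermitian by fastforce

lemma adjoint_add: "adjoint_mat (X + Y) = adjoint_mat X + adjoint_mat Y"
  by (simp add: vec_eq_iff)

lemma adjoint_scaleR: "adjoint_mat (c *\<^sub>R X) = c *\<^sub>R adjoint_mat X"
  by (simp add: vec_eq_iff)

lemma adjoint_sum: "adjoint_mat (\<Sum>i\<in>I. f i) = (\<Sum>i\<in>I. adjoint_mat (f i))"
  by (induction I rule: infinite_finite_induct) (simp_all add: adjoint_add, simp_all add: vec_eq_iff)

lemma null_vector_nth [simp]: "null_vector x $ i $ j = x $ i * cnj (x $ j)"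
  by (simp add: null_vector_def)

lemma adjoint_null_vector: "adjoint_mat (null_vector x) = null_vector x"
  by (simp add: vec_eq_iff mult.commute)

lemma mink_null_vector: "mink (null_vector x) (null_vector y) = (cmod (bracket x y))\<^sup>2 / 2"
proof -
  have "(cmod (bracket x y))\<^sup>2 = Re (bracket x y * cnj (bracket x y))"
    by (simp add: complex_norm_square[symmetric])
  then show ?thesis
    unfolding mink_eq bracket_def by (simp add: algebra_simps)
qed

lemma mink_null_vector_nonneg: "0 \<le> mink (null_vector x) (null_vector y)"
  by (simp add: mink_null_vector)

lemma mink_null_vector_self [simp]: "mink (null_vector x) (null_vector x) = 0"
  by (simp add: mink_null_vector)

lemma trace_null_vector: "trace (null_vector x) = of_real ((cmod (x $ 1))\<^sup>2 + (cmod (x $ 2))\<^sup>2)"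
  by (simp add: trace_def sum_2 complex_norm_square[symmetric] del: of_real_add)
    (simp add: complex_norm_square)

lemma trace_scaleR: "trace (c *\<^sub>R (X :: cmat2)) = c *\<^sub>R trace X"
  by (simp add: trace_def sum_2 scaleR_add_right)

lemma trace_sum: "trace (\<Sum>i\<in>I. f i :: cmat2) = (\<Sum>i\<in>I. trace (f i))"
  by (induction I rule: infinite_finite_induct) (simp_all add: trace_add, simp_all add: trace_def)

lemma null_vector_scale: "null_vector (c *s x) = (cmod c)\<^sup>2 *\<^sub>R null_vector x"
proof -
  have "null_vector (c *s x) $ i $ j = ((cmod c)\<^sup>2 *\<^sub>R null_vector x) $ i $ j" for i j
    unfolding vector_scaleR_component null_vector_nth
    by (simp only: scaleR_conv_of_real complex_norm_square) simp
  then show ?thesis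
    by (simp add: vec_eq_iff)
qed

lemma null_vector_same_ideal_point:
  assumes "same_ideal_point x y"
  obtains c where "0 < c" "null_vector y = c *\<^sub>R null_vector x"
  using assms unfolding same_ideal_point_def
  by (metis null_vector_scale zero_less_norm_iff zero_less_power)

lemma null_vector_eq_imp_same_ideal_point:
  assumes "null_vector x = null_vector y" "x \<noteq> 0" "y \<noteq> 0"
  shows "same_ideal_point x y"
  using mink_null_vector[of x y] mink_null_vector_self[of y] assms
  by (simp add: same_ideal_point_iff_bracket)

text \<open>A nonnegative combination of null vectors has nonnegative trace, which is zero only if
  every summand vanishes. This reduces membership in \<open>H3\<close> to the norm.\<close>

lemma null_combination_in_H3:
  fixes c :: "'i \<Rightarrow> real"
  assumes X: "X = (\<Sum>i\<in>S. c i *\<^sub>R null_vector (v i))" and c: "\<And>i. i \<in> S \<Longrightarrow> 0 \<le> c i"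
    and "mink X X = 1" "finite S"
  shows "X \<in> H3"
proof -
  have "adjoint_mat X = X"
    unfolding X by (simp add: adjoint_sum adjoint_scaleR adjoint_null_vector)
  moreover from this have "det X = 1"
    using assms by (simp add: det_hermitian)
  moreover have "0 < Re (trace X)"
  proof -
    let ?t = "\<lambda>i. c i * ((cmod (v i $ 1))\<^sup>2 + (cmod (v i $ 2))\<^sup>2)"
    have tr: "Re (trace X) = (\<Sum>i\<in>S. ?t i)"
      unfolding X trace_sum trace_scaleR trace_null_vector
      by (simp del: of_real_add)
    have t: "0 \<le> ?t i" if "i \<in> S" for i
      using c[OF that] by simp
    have "(\<Sum>i\<in>S. ?t i) \<noteq> 0"
    proof
      assume "(\<Sum>i\<in>S. ?t i) = 0"
      then have "?t i = 0" if "i \<in> S" for i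
        using that t \<open>finite S\<close> by (subst (asm) sum_nonneg_eq_0_iff) auto
      then have "c i *\<^sub>R null_vector (v i) = 0" if "i \<in> S" for i
        using that by (fastforce simp: vec_eq_iff forall_2 add_nonneg_eq_0_iff)
      then have "X = 0"
        unfolding X by (intro sum.neutral ballI)
      then show False
        using \<open>mink X X = 1\<close> by simp
    qed
    then show ?thesis
      unfolding tr using t by (simp add: order_less_le sum_nonneg)
  qed
  ultimately show ?thesis
    by (simp add: H3_def)
qed

lemma act_add: "act A (X + Y) = act A X + act A Y"
  by (simp add: act_def mat2_eq_iff matrix_matrix_mult_2 algebra_simps)

lemma act_scaleR: "act A (c *\<^sub>R X) = c *\<^sub>R act A X"
  by (simp add: act_def mat2_eq_iff matrix_matrix_mult_2 algebra_simps)

lemma act_sum: "act A (\<Sum>i\<in>I. f i) = (\<Sum>i\<in>I. act A (f i))"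
  by (induction I rule: infinite_finite_induct) (simp_all add: act_add, simp_all add: act_def)

lemma act_null_vector: "act A (null_vector x) = null_vector (A *v x)"
  by (simp add: act_def mat2_eq_iff matrix_matrix_mult_2 matrix_vector_mult_2 algebra_simps)

lemma act_mult: "act (A ** B) X = act A (act B X)"
proof -
  have "adjoint_mat (A ** B) = adjoint_mat B ** adjoint_mat A"
    by (simp add: mat2_eq_iff matrix_matrix_mult_2 mult.commute)
  then show ?thesis
    by (simp add: act_def matrix_mul_assoc)
qed

lemma act_mat_1 [simp]: "act (mat 1) X = X"
  by (simp add: act_def mat2_eq_iff matrix_matrix_mult_2 mat_def)

lemma act_scaled: "c = 1 \<or> c = - 1 \<Longrightarrow> act (mat c ** A) X = act A X"
  by (auto simp: act_def mat2_eq_iff matrix_matrix_mult_2 mat_def algebra_simps)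

lemma det_act: "det A = 1 \<Longrightarrow> det (act A X) = det X"
proof -
  assume "det A = 1"
  moreover have "det (adjoint_mat A) = cnj (det A)"
    by (simp add: det_2)
  ultimately show ?thesis
    by (simp add: act_def det_mul)
qed

lemma mink_act: "det A = 1 \<Longrightarrow> mink (act A X) (act A Y) = mink X Y"
  unfolding mink_def by (simp add: det_act act_add[symmetric])

lemma continuous_on_act: "continuous_on S (act A)"
  unfolding act_def matrix_matrix_mult_def by (intro continuous_intros)


section \<open>Barycentric coordinates\<close>

text \<open>In the position infinity, 0, 1, z the upper right entries of the null vectors are 0, 0,
  1, z. As z is not real, the last two coefficients vanish, and the diagonal entries then give the
  first two.\<close>

lemma null_vectors_independent:
  assumes "positively_labelled v" and 0: "(\<Sum>i\<in>UNIV. c i *\<^sub>R null_vector (v i)) = 0"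
  shows "c i = 0"
proof -
  obtain A z where A: "det A = 1" "0 < Im z"
    "same_ideal_point (ideal_infinity) (A *v v 0)"
    "same_ideal_point (ideal_number 0) (A *v v 1)"
    "same_ideal_point (ideal_number 1) (A *v v 2)"
    "same_ideal_point (ideal_number z) (A *v v 3)"
    using assms(1) unfolding positively_labelled_def by (blast intro: same_ideal_point_sym)
  from A(3) obtain k0 where k0: "0 < k0"
    "null_vector (A *v v 0) = k0 *\<^sub>R null_vector ideal_infinity"
    by (rule null_vector_same_ideal_point)
  from A(4) obtain k1 where k1: "0 < k1"
    "null_vector (A *v v 1) = k1 *\<^sub>R null_vector (ideal_number 0)"
    by (rule null_vector_same_ideal_point)
  from A(5) obtain k2 where k2: "0 < k2"
    "null_vector (A *v v 2) = k2 *\<^sub>R null_vector (ideal_number 1)"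
    by (rule null_vector_same_ideal_point)
  from A(6) obtain k3 where k3: "0 < k3"
    "null_vector (A *v v 3) = k3 *\<^sub>R null_vector (ideal_number z)"
    by (rule null_vector_same_ideal_point)
  note k = k0 k1 k2 k3
  have "act A 0 = 0"
    by (simp add: act_def)
  with 0 have "(\<Sum>i\<in>UNIV. c i *\<^sub>R null_vector (A *v v i)) = 0"
    by (metis (no_types, lifting) act_sum act_scaleR act_null_vector sum.cong)
  then have sum: "(c 0 * k0) *\<^sub>R null_vector ideal_infinity + (c 1 * k1) *\<^sub>R null_vector (ideal_number 0) +
      (c 2 * k2) *\<^sub>R null_vector (ideal_number 1) + (c 3 * k3) *\<^sub>R null_vector (ideal_number z) = 0" (is "?S = 0")
    by (simp add: sum_4_from_0 k)
  have "c 3 * k3 * Im z = 0" "c 2 * k2 + c 3 * k3 * Re z = 0"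
    using arg_cong[OF sum, of "\<lambda>X. Im (X $ 1 $ 2)"] arg_cong[OF sum, of "\<lambda>X. Re (X $ 1 $ 2)"] by simp_all
  then have 23: "c 3 = 0" "c 2 = 0"
    using k A(2) by auto
  moreover have "c 0 = 0" "c 1 = 0"
    using 23 k arg_cong[OF sum, of "\<lambda>X. Re (X $ 1 $ 1)"] arg_cong[OF sum, of "\<lambda>X. Re (X $ 2 $ 2)"] by simp_all
  ultimately show ?thesis
    using exhaust_4_from_0[of i] by auto
qed

text \<open>The null vectors span only four of the eight real dimensions of \<open>cmat2\<close>, so
  the dual basis has many linear extensions and one is chosen. Its values are meaningful on the span
  of the null vectors.\<close>

definition coord :: "(4 \<Rightarrow> complex^2) \<Rightarrow> 4 \<Rightarrow> cmat2 \<Rightarrow> real" where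
  "coord v = (SOME L. (\<forall>i. linear (L i)) \<and> (\<forall>i j. L i (null_vector (v j)) = (if i = j then 1 else 0)))"

lemma coord_spec:
  assumes "positively_labelled v"
  shows "linear (coord v i)" "coord v i (null_vector (v j)) = (if i = j then 1 else 0)"
proof -
  let ?n = "\<lambda>i. null_vector (v i)"
  \<comment> \<open>Linear independence concerns the set of null vectors; injectivity carries it
    over to the labelled family.\<close>
  have inj: "inj ?n"
  proof (rule injI, rule ccontr)
    fix i j assume eq: "?n i = ?n j" and ne: "i \<noteq> j"
    define c where "c l = (if l = i then 1 else if l = j then - 1 else 0 :: real)" for l
    have "(\<Sum>l\<in>UNIV. c l *\<^sub>R ?n l) = (\<Sum>l\<in>{i, j}. c l *\<^sub>R ?n l)"
      by (rule sum.mono_neutral_right) (auto simp: c_def)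
    also have "\<dots> = 0"
      using ne eq by (simp add: c_def)
    finally show False
      using null_vectors_independent[OF assms, of c i] by (simp add: c_def)
  qed
  have "independent (range ?n)"
  proof (rule independent_if_scalars_zero)
    fix f x assume "(\<Sum>x\<in>range ?n. f x *\<^sub>R x) = 0" "x \<in> range ?n"
    then show "f x = 0"
      using null_vectors_independent[OF assms, of "f \<circ> ?n"] inj
      by (auto simp: sum.reindex)
  qed simp
  then have "\<exists>L. linear L \<and> (\<forall>x\<in>range ?n. L x = (if x = ?n i then 1 else 0 :: real))" for i
    by (rule linear_independent_extend)
  then obtain L where "\<And>i. linear (L i)" "\<And>i j. L i (?n j) = (if ?n j = ?n i then 1 else 0 :: real)"
    by (metis rangeI)
  moreover have "?n j = ?n i \<longleftrightarrow> i = j" for i j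
    using inj_eq[OF inj, of j i] by blast
  ultimately have "\<exists>L. (\<forall>i. linear (L i)) \<and> (\<forall>i j. L i (?n j) = (if i = j then 1 else 0 :: real))"
    by (intro exI[of _ L]) simp
  then have "(\<forall>i. linear (coord v i)) \<and> (\<forall>i j. coord v i (?n j) = (if i = j then 1 else 0))"
    unfolding coord_def by (rule someI_ex)
  then show "linear (coord v i)" "coord v i (null_vector (v j)) = (if i = j then 1 else 0)"
    by blast+
qed

lemma coord_sum:
  assumes "positively_labelled v"
  shows "coord v i (\<Sum>j\<in>S. c j *\<^sub>R null_vector (v j)) = (if i \<in> S then c i else 0)"
proof -
  have "coord v i (\<Sum>j\<in>S. c j *\<^sub>R null_vector (v j)) = (\<Sum>j\<in>S. c j * (if i = j then 1 else 0))"
    by (simp only: linear_sum[OF coord_spec(1)[OF assms]] linear_scale[OF coord_spec(1)[OF assms]]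
        coord_spec(2)[OF assms] real_scaleR_def)
  then show ?thesis
    by (simp add: if_distrib cong: if_cong)
qed

lemma coord_simps:
  assumes "positively_labelled v"
  shows "coord v i (X + Y) = coord v i X + coord v i Y" "coord v i (c *\<^sub>R X) = c * coord v i X"
  using coord_spec(1)[OF assms] by (simp_all add: linear_add linear_scale)

lemma continuous_on_coord: "positively_labelled v \<Longrightarrow> continuous_on S (coord v i)"
  by (simp add: coord_spec linear_continuous_on linear_conv_bounded_linear[symmetric])

lemma sum_zero_extend:
  fixes f :: "'n::finite \<Rightarrow> 'b::real_vector"
  assumes "\<And>i. i \<notin> S \<Longrightarrow> c i = 0"
  shows "(\<Sum>i\<in>S. c i *\<^sub>R f i) = (\<Sum>i\<in>UNIV. c i *\<^sub>R f i)"
  by (rule sum.mono_neutral_left) (use assms in auto)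

text \<open>The equation for \<open>X\<close> says that \<open>X\<close> lies in the span of the
  null vectors; signs of \<open>coord\<close> alone cannot tell this, since \<open>coord\<close> is
  extended to all matrices.\<close>

lemma ideal_simplex_iff:
  assumes "positively_labelled v"
  shows "X \<in> ideal_simplex v S \<longleftrightarrow> X \<in> H3 \<and> X = (\<Sum>i\<in>UNIV. coord v i X *\<^sub>R null_vector (v i)) \<and>
    (\<forall>i\<in>S. 0 \<le> coord v i X) \<and> (\<forall>i\<in>- S. coord v i X = 0)" (is "?l \<longleftrightarrow> ?r")
proof
  assume ?l
  then obtain c where c: "X \<in> H3" "\<forall>i\<in>S. 0 \<le> c i" "X = (\<Sum>i\<in>S. c i *\<^sub>R null_vector (v i))"
    by (auto simp: ideal_simplex_def)
  then have co: "coord v i X = (if i \<in> S then c i else 0)" for i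
    using coord_sum[OF assms] by simp
  then have "X = (\<Sum>i\<in>S. coord v i X *\<^sub>R null_vector (v i))"
    using c(3) by simp
  also have "\<dots> = (\<Sum>i\<in>UNIV. coord v i X *\<^sub>R null_vector (v i))"
    by (rule sum_zero_extend) (simp add: co)
  finally show ?r
    using c co by simp
next
  assume r: ?r
  then have "(\<Sum>i\<in>S. coord v i X *\<^sub>R null_vector (v i)) = (\<Sum>i\<in>UNIV. coord v i X *\<^sub>R null_vector (v i))"
    by (intro sum_zero_extend) blast
  then have "X = (\<Sum>i\<in>S. coord v i X *\<^sub>R null_vector (v i))"
    using r by metis
  then show ?l
    using r unfolding ideal_simplex_def mem_Collect_eq by meson
qed

lemma ideal_tetrahedron_iff:
  assumes "positively_labelled v"
  shows "X \<in> ideal_tetrahedron v \<longleftrightarrow>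
    X \<in> H3 \<and> X = (\<Sum>i\<in>UNIV. coord v i X *\<^sub>R null_vector (v i)) \<and> (\<forall>i. 0 \<le> coord v i X)"
  unfolding ideal_simplex_iff[OF assms] by (simp only: Compl_UNIV_eq Ball_def empty_iff UNIV_I simp_thms)

lemma ideal_simplex_iff_tetrahedron:
  assumes "positively_labelled v"
  shows "X \<in> ideal_simplex v S \<longleftrightarrow> X \<in> ideal_tetrahedron v \<and> (\<forall>i\<in>- S. coord v i X = 0)"
proof -
  have "(\<forall>i\<in>S. 0 \<le> f i) \<and> (\<forall>i\<in>- S. f i = 0) \<longleftrightarrow> (\<forall>i. 0 \<le> f i) \<and> (\<forall>i\<in>- S. f i = 0)" for f :: "4 \<Rightarrow> real"
    by (metis ComplI order_refl)
  then show ?thesis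
    unfolding ideal_tetrahedron_iff[OF assms] ideal_simplex_iff[OF assms, of X S] by (simp only: conj_assoc)
qed


section \<open>The barycenter\<close>

text \<open>Rescaling the four null vectors makes the Gram matrix invariant under the Klein four-group;
  the barycenter is then the multiple of their sum on the hyperboloid.\<close>

definition gram :: "(4 \<Rightarrow> complex^2) \<Rightarrow> 4 \<Rightarrow> 4 \<Rightarrow> real" where
  "gram v i j = mink (null_vector (v i)) (null_vector (v j))"

definition balance :: "(4 \<Rightarrow> complex^2) \<Rightarrow> 4 \<Rightarrow> real" where
  "balance v i = 1 / sqrt (\<Prod>j\<in>- {i}. gram v i j)"

definition balanced_null :: "(4 \<Rightarrow> complex^2) \<Rightarrow> 4 \<Rightarrow> cmat2" where
  "balanced_null v i = balance v i *\<^sub>R null_vector (v i)"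

lemma gram_commute: "gram v i j = gram v j i"
  by (simp add: gram_def mink_commute)

lemma gram_pos: "positively_labelled v \<Longrightarrow> i \<noteq> j \<Longrightarrow> 0 < gram v i j"
  by (simp add: gram_def mink_null_vector positively_labelled_bracket_nonzero)

lemma balance_pos: "positively_labelled v \<Longrightarrow> 0 < balance v i"
  unfolding balance_def by (auto intro!: divide_pos_pos prod_pos gram_pos)

lemma balanced_null_self: "mink (balanced_null v i) (balanced_null v i) = 0"
  by (simp add: balanced_null_def mink_linear)

lemma balanced_null_pos:
  "positively_labelled v \<Longrightarrow> i \<noteq> j \<Longrightarrow> 0 < mink (balanced_null v i) (balanced_null v j)"
  using gram_pos[of v i j] by (simp add: balanced_null_def mink_linear gram_def balance_pos)

text \<open>After rescaling, the Gram entry of the edge \<open>{i, k}\<close> is the inverse square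
  root of the product of the four Gram entries over the edges other than \<open>{i, k}\<close> and
  \<open>{j, l}\<close>. This expression is the same for both of these opposite edges.\<close>

lemma balanced_null_opposite:
  assumes v: "positively_labelled v" and dist: "distinct [i, j, k, l]"
  shows "mink (balanced_null v i) (balanced_null v k) = mink (balanced_null v j) (balanced_null v l)"
proof -
  let ?g = "gram v"
  have g: "0 < ?g i j" "0 < ?g i k" "0 < ?g i l" "0 < ?g j k" "0 < ?g j l" "0 < ?g k l"
    using dist by (auto intro!: gram_pos[OF v])
  have bal: "balance v i = 1 / sqrt (?g i j * ?g i k * ?g i l)"
    if "distinct [i, j, k, l]" for i j k l
  proof -
    have "distinct [j, k, l, i]"
      using that by auto
    then have "- {i} = {j, k, l}"
      by (rule Compl_4_distinct)
    then show ?thesis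
      using that by (simp add: balance_def mult.assoc)
  qed
  have b: "balance v i = 1 / sqrt (?g i j * ?g i k * ?g i l)" "balance v k = 1 / sqrt (?g i k * ?g j k * ?g k l)"
    "balance v j = 1 / sqrt (?g i j * ?g j l * ?g j k)" "balance v l = 1 / sqrt (?g j l * ?g i l * ?g k l)"
    using bal[of i j k l] bal[of k i j l] bal[of j i l k] bal[of l j i k] dist
    by (auto simp: gram_commute[of v j i] gram_commute[of v k i] gram_commute[of v k j]
        gram_commute[of v l i] gram_commute[of v l j] gram_commute[of v l k])
  have aux: "1 / sqrt (x * w * y) * (1 / sqrt (w * x' * y')) * w = 1 / sqrt (x * y * x' * y')"
    if "0 < w" for w x y x' y' :: real
  proof -
    have "sqrt (x * w * y) * sqrt (w * x' * y') = sqrt (w\<^sup>2 * (x * y * x' * y'))"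
      unfolding real_sqrt_mult[symmetric] by (simp only: power2_eq_square mult_ac)
    also have "\<dots> = w * sqrt (x * y * x' * y')"
      using that by (simp only: real_sqrt_mult real_sqrt_abs abs_of_pos)
    finally show ?thesis
      using that by simp
  qed
  have "balance v i * balance v k * ?g i k = balance v j * balance v l * ?g j l"
    unfolding b using g by (simp only: aux) (simp only: mult_ac)
  then show ?thesis
    unfolding balanced_null_def mink_linear gram_def by (simp only: mult_ac)
qed

lemma coord_balanced_null:
  "positively_labelled v \<Longrightarrow> coord v i (balanced_null v j) = (if i = j then balance v j else 0)"
  by (simp add: balanced_null_def coord_simps coord_spec)

text \<open>Null vectors have norm 0, so the norm of the combination is its mixed term alone: the
  edge is a hyperbola branch on which the product of the two weights is constant.\<close>

lemma ideal_edge_iff: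
  assumes v: "positively_labelled v" and "i \<noteq> j"
  shows "X \<in> ideal_simplex v {i, j} \<longleftrightarrow>
    (\<exists>\<alpha> \<beta>. 0 \<le> \<alpha> \<and> 0 \<le> \<beta> \<and> 2 * \<alpha> * \<beta> * mink (balanced_null v i) (balanced_null v j) = 1 \<and>
       X = \<alpha> *\<^sub>R balanced_null v i + \<beta> *\<^sub>R balanced_null v j)" (is "?l \<longleftrightarrow> ?r")
proof -
  let ?m = "balanced_null v"
  have norm: "mink (\<alpha> *\<^sub>R ?m i + \<beta> *\<^sub>R ?m j) (\<alpha> *\<^sub>R ?m i + \<beta> *\<^sub>R ?m j) = 2 * \<alpha> * \<beta> * mink (?m i) (?m j)" for \<alpha> \<beta>
    by (simp add: mink_linear balanced_null_self mink_commute[of "?m j" "?m i"])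
  show ?thesis
  proof
    assume ?l
    then obtain c where c: "X \<in> H3" "0 \<le> c i" "0 \<le> c j"
      "X = c i *\<^sub>R null_vector (v i) + c j *\<^sub>R null_vector (v j)"
      using \<open>i \<noteq> j\<close> by (auto simp: ideal_simplex_def)
    have X: "X = (c i / balance v i) *\<^sub>R ?m i + (c j / balance v j) *\<^sub>R ?m j"
      using c(4) balance_pos[OF v, of i] balance_pos[OF v, of j] by (simp add: balanced_null_def)
    then have "2 * (c i / balance v i) * (c j / balance v j) * mink (?m i) (?m j) = 1"
      using norm H3_mink[OF c(1)] by metis
    moreover have "0 \<le> c i / balance v i" "0 \<le> c j / balance v j"
      using c(2,3) balance_pos[OF v, of i] balance_pos[OF v, of j] by simp_all
    ultimately show ?r
      using X by blast
  next
    assume ?r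
    then obtain \<alpha> \<beta> where *: "0 \<le> \<alpha>" "0 \<le> \<beta>" "2 * \<alpha> * \<beta> * mink (?m i) (?m j) = 1"
      "X = \<alpha> *\<^sub>R ?m i + \<beta> *\<^sub>R ?m j"
      by blast
    define c where "c l = (if l = i then \<alpha> * balance v i else \<beta> * balance v j)" for l
    have X: "X = (\<Sum>l\<in>{i, j}. c l *\<^sub>R null_vector (v l))"
      using \<open>i \<noteq> j\<close> *(4) by (simp add: c_def balanced_null_def)
    have c: "0 \<le> c l" for l
      using *(1,2) balance_pos[OF v, of i] balance_pos[OF v, of j] by (simp add: c_def)
    have "X \<in> H3"
      by (rule null_combination_in_H3[OF X c]) (use * norm in auto)
    then show ?l
      unfolding ideal_simplex_def by (intro CollectI conjI exI[of _ c] ballI \<open>X \<in> H3\<close> c X)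
  qed
qed

section \<open>Common perpendiculars of opposite edges\<close>

lemma mink_tangent_part:
  assumes "mink X X = 1"
  shows "mink (tangent_part X P) (tangent_part X Q) = mink P Q - mink P X * mink Q X"
  using assms
  by (simp add: tangent_part_def mink_diff_left mink_diff_right mink_scaleR_left mink_scaleR_right
      mink_commute[of X P] mink_commute[of X Q] algebra_simps)

lemma perpendicular_at_iff:
  assumes "X \<in> H3"
  shows "perpendicular_at X L N \<longleftrightarrow> X \<in> L \<inter> N \<and> (\<forall>P\<in>L. \<forall>Q\<in>N. mink P Q = mink P X * mink Q X)"
  unfolding perpendicular_at_def mink_tangent_part[OF H3_mink[OF assms]] by simp

text \<open>The perpendicular joins the points of the two edges where the balanced null vectors have
  equal weights. Orthogonality holds because, by \<open>balanced_null_opposite\<close>,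
  \<open>m i\<close> and \<open>m j\<close> have the same product with
  \<open>m k + m l\<close>.\<close>

lemma common_perpendicular_edges:
  assumes v: "positively_labelled v" and dist: "distinct [i, j, k, l]"
  defines "m \<equiv> balanced_null v"
  obtains N where "common_perpendicular N (ideal_simplex v {i, j}) (ideal_simplex v {k, l})"
    "\<And>X a b. X \<in> H3 \<Longrightarrow> X = a *\<^sub>R (m i + m j) + b *\<^sub>R (m k + m l) \<Longrightarrow> X \<in> N"
proof -
  define \<alpha> \<gamma> where "\<alpha> = 1 / sqrt (2 * mink (m i) (m j))" and "\<gamma> = 1 / sqrt (2 * mink (m k) (m l))"
  define P Q where "P = \<alpha> *\<^sub>R (m i + m j)" and "Q = \<gamma> *\<^sub>R (m k + m l)"
  define N where "N = {X \<in> H3. \<exists>a b. X = a *\<^sub>R P + b *\<^sub>R Q}"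
  have mid: "mid *\<^sub>R (m i + m j) \<in> ideal_simplex v {i, j}" "0 < mid" "2 * mid * mid * mink (m i) (m j) = 1"
    if "i \<noteq> j" "mid = 1 / sqrt (2 * mink (m i) (m j))" for i j mid
  proof -
    have g: "0 < mink (m i) (m j)"
      using that(1) balanced_null_pos[OF v] by (simp add: m_def)
    then show "0 < mid" "2 * mid * mid * mink (m i) (m j) = 1"
      unfolding that(2) by (simp_all add: power2_eq_square[symmetric])
    then show "mid *\<^sub>R (m i + m j) \<in> ideal_simplex v {i, j}"
      unfolding ideal_edge_iff[OF v that(1)] m_def
      by (intro exI[of _ mid]) (auto simp: scaleR_add_right)
  qed
  have P: "P \<in> ideal_simplex v {i, j}" "0 < \<alpha>" "2 * \<alpha> * \<alpha> * mink (m i) (m j) = 1"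
    using mid[of i j \<alpha>] dist by (auto simp: P_def \<alpha>_def)
  have Q: "Q \<in> ideal_simplex v {k, l}" "0 < \<gamma>" "2 * \<gamma> * \<gamma> * mink (m k) (m l) = 1"
    using mid[of k l \<gamma>] dist by (auto simp: Q_def \<gamma>_def)
  have H3: "P \<in> H3" "Q \<in> H3"
    using P Q by (auto simp: ideal_simplex_def)
  have N: "X \<in> N" if "X \<in> H3" "X = a *\<^sub>R P + b *\<^sub>R Q" for X a b
    using that by (auto simp: N_def)
  have PQN: "P \<in> N" "Q \<in> N"
    using N[of P 1 0] N[of Q 0 1] H3 by auto
  \<comment> \<open>Stated with its own labels, so that it serves both feet with the roles of the
    edges exchanged.\<close>
  have perp: "mink P' Q' = mink P' P * mink Q' P"
    if dist: "distinct [i, j, k, l]" and P: "P = \<alpha> *\<^sub>R (m i + m j)" "2 * \<alpha> * \<alpha> * mink (m i) (m j) = 1"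
      and Q: "Q = \<gamma> *\<^sub>R (m k + m l)" and P': "P' \<in> ideal_simplex v {i, j}" and Q': "Q' = a *\<^sub>R P + b *\<^sub>R Q"
    for i j k l P Q P' Q' a b \<alpha> \<gamma>
  proof -
    define G y z where "G = mink (m i) (m j)" and "y = mink (m i) (m k)" and "z = mink (m i) (m l)"
    have gr: "mink (m i) (m j) = G" "mink (m j) (m i) = G" "mink (m i) (m k) = y" "mink (m k) (m i) = y"
      "mink (m j) (m l) = y" "mink (m l) (m j) = y" "mink (m i) (m l) = z" "mink (m l) (m i) = z"
      "mink (m j) (m k) = z" "mink (m k) (m j) = z"
      using balanced_null_opposite[OF v, of i j k l] balanced_null_opposite[OF v, of i j l k] dist
      by (auto simp: G_def y_def z_def m_def mink_commute)
    obtain s t where P'': "P' = s *\<^sub>R m i + t *\<^sub>R m j"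
      using P' dist by (auto simp: ideal_edge_iff[OF v] m_def)
    have G: "2 * \<alpha> * \<alpha> * G = 1"
      using P(2) by (simp add: G_def)
    have P'P: "mink P' P = \<alpha> * (s + t) * G" and P'Q: "mink P' Q = \<gamma> * (s + t) * (y + z)"
      and QP: "mink Q P = 2 * \<alpha> * \<gamma> * (y + z)" and PP: "mink P P = 1"
      using G unfolding P'' P(1) Q
      by (simp_all add: mink_linear gr balanced_null_self m_def[symmetric] balanced_null_self[of v, folded m_def])
        (simp_all add: algebra_simps)
    have "mink P' Q' = a * mink P' P + b * mink P' Q"
      unfolding Q' by (simp add: mink_linear)
    also have "mink P' Q = mink P' P * mink Q P"
    proof -
      have "mink P' P * mink Q P = \<gamma> * (s + t) * (y + z) * (2 * \<alpha> * \<alpha> * G)"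
        unfolding P'P QP by simp
      then show ?thesis
        unfolding G P'Q by simp
    qed
    also have "a * mink P' P + b * (mink P' P * mink Q P) = mink P' P * (a * mink P P + b * mink Q P)"
      by (simp add: PP algebra_simps)
    also have "a * mink P P + b * mink Q P = mink Q' P"
      unfolding Q' by (simp add: mink_linear)
    finally show ?thesis .
  qed
  have "coord v i P \<noteq> coord v i Q"
    using P(2) balance_pos[OF v, of i] dist
    by (simp add: P_def Q_def m_def coord_simps[OF v] coord_balanced_null[OF v])
  then have "P \<noteq> Q"
    by metis
  then have "geodesic N"
    unfolding geodesic_def N_def using H3 by blast
  moreover have "perpendicular_at P (ideal_simplex v {i, j}) N"
    unfolding perpendicular_at_iff[OF H3(1)]
    using perp[OF dist P_def P(3) Q_def] P PQN by (auto simp: N_def)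
  moreover have "perpendicular_at Q (ideal_simplex v {k, l}) N"
  proof -
    have "distinct [k, l, i, j]"
      using dist by auto
    from perp[OF this Q_def Q(3) P_def] show ?thesis
      unfolding perpendicular_at_iff[OF H3(2)]
      using Q PQN by (auto simp: N_def) (metis add.commute)
  qed
  ultimately have "common_perpendicular N (ideal_simplex v {i, j}) (ideal_simplex v {k, l})"
    unfolding common_perpendicular_def by blast
  moreover have "X \<in> N" if "X \<in> H3" "X = a *\<^sub>R (m i + m j) + b *\<^sub>R (m k + m l)" for X a b
    using N[OF that(1), of "a / \<alpha>" "b / \<gamma>"] that P(2) Q(2) by (simp add: P_def Q_def)
  ultimately show thesis
    by (rule that)
qed

text \<open>Sum and difference of the two equations give
  \<open>\<alpha> * \<gamma> = \<beta> * \<delta>\<close> and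
  \<open>\<alpha> * \<delta> = \<beta> * \<gamma>\<close>, and multiplying these leaves equal
  squares. The pairs are the weights of the feet of a perpendicular on two opposite edges;
  \<open>y\<close> and \<open>z\<close> are the products of balanced null vectors across.\<close>

lemma foot_of_perpendicular:
  fixes \<alpha> \<beta> \<gamma> \<delta> y z :: real
  assumes "0 < \<alpha>" "0 < \<beta>" "0 < \<gamma>" "0 < \<delta>" "0 < y" "0 < z"
    and 1: "\<alpha> * (\<gamma> * y + \<delta> * z) = \<beta> * (\<gamma> * z + \<delta> * y)"
    and 2: "\<gamma> * (\<alpha> * y + \<beta> * z) = \<delta> * (\<alpha> * z + \<beta> * y)"
  shows "\<alpha> = \<beta>" "\<gamma> = \<delta>"
proof -
  have "(\<alpha> * \<gamma>) * y = (\<beta> * \<delta>) * y"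
    using 1 2 by algebra
  then have a: "\<alpha> * \<gamma> = \<beta> * \<delta>"
    using \<open>0 < y\<close> by simp
  with 1 have "(\<alpha> * \<delta>) * z = (\<beta> * \<gamma>) * z"
    by algebra
  then have b: "\<alpha> * \<delta> = \<beta> * \<gamma>"
    using \<open>0 < z\<close> by simp
  have "\<alpha>\<^sup>2 * (\<gamma> * \<delta>) = (\<alpha> * \<gamma>) * (\<alpha> * \<delta>)"
    by (simp add: power2_eq_square)
  also have "\<dots> = \<beta>\<^sup>2 * (\<gamma> * \<delta>)"
    unfolding a b by (simp add: power2_eq_square)
  finally have "\<alpha>\<^sup>2 = \<beta>\<^sup>2"
    using assms by simp
  then show "\<alpha> = \<beta>"
    using assms by (simp add: power2_eq_iff)
  then show "\<gamma> = \<delta>"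
    using a assms by simp
qed

lemma perpendicular_at_edge:
  assumes v: "positively_labelled v" and "i \<noteq> j"
    and perp: "perpendicular_at X (ideal_simplex v {i, j}) N" and "Y \<in> N"
  defines "m \<equiv> balanced_null v"
  obtains \<alpha> \<beta> where "0 < \<alpha>" "0 < \<beta>" "X = \<alpha> *\<^sub>R m i + \<beta> *\<^sub>R m j" "\<alpha> * mink (m i) Y = \<beta> * mink (m j) Y"
proof -
  have X: "X \<in> ideal_simplex v {i, j}" "X \<in> H3"
    using perp by (auto simp: perpendicular_at_def ideal_simplex_def)
  then obtain \<alpha> \<beta> where *: "0 \<le> \<alpha>" "0 \<le> \<beta>" "2 * \<alpha> * \<beta> * mink (m i) (m j) = 1"
    "X = \<alpha> *\<^sub>R m i + \<beta> *\<^sub>R m j"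
    unfolding ideal_edge_iff[OF v \<open>i \<noteq> j\<close>] m_def by blast
  \<comment> \<open>A second point of the edge: doubling one weight and halving the other preserves
    the norm. Orthogonality tested on this one point already yields the relation.\<close>
  define P where "P = (2 * \<alpha>) *\<^sub>R m i + (\<beta> / 2) *\<^sub>R m j"
  have "P \<in> ideal_simplex v {i, j}"
    unfolding ideal_edge_iff[OF v \<open>i \<noteq> j\<close>] m_def[symmetric]
    using * by (intro exI[of _ "2 * \<alpha>"] exI[of _ "\<beta> / 2"]) (simp add: P_def)
  then have "mink P Y = mink P X * mink Y X"
    using perp \<open>Y \<in> N\<close> unfolding perpendicular_at_iff[OF X(2)] by blast
  moreover have "mink P X = 5 / 4"
    using *(3) by (simp add: P_def *(4) mink_linear balanced_null_self[of v, folded m_def] mink_commute[of "m j" "m i"])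
  moreover have "mink P Y = 2 * (\<alpha> * mink (m i) Y) + \<beta> * mink (m j) Y / 2"
    "mink Y X = \<alpha> * mink (m i) Y + \<beta> * mink (m j) Y"
    unfolding mink_commute[of Y X] by (simp_all add: P_def *(4) mink_linear)
  ultimately have "\<alpha> * mink (m i) Y = \<beta> * mink (m j) Y"
    by simp
  moreover have "0 < \<alpha>" "0 < \<beta>"
    using *(1-3) by (auto simp: order_less_le)
  ultimately show thesis
    using that *(4) by blast
qed

text \<open>Orthogonality at both feet forces equal weights by \<open>foot_of_perpendicular\<close>.
  The feet are linearly independent, having coordinates at different vertices, so they span the
  plane that cuts out \<open>N\<close>.\<close>

lemma common_perpendicular_span:
  assumes v: "positively_labelled v" and dist: "distinct [i, j, k, l]"
    and N: "common_perpendicular N (ideal_simplex v {i, j}) (ideal_simplex v {k, l})" and "X \<in> N"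
  defines "m \<equiv> balanced_null v"
  obtains s t where "X = s *\<^sub>R (m i + m j) + t *\<^sub>R (m k + m l)"
proof -
  obtain X1 X2 where X1: "perpendicular_at X1 (ideal_simplex v {i, j}) N"
    and X2: "perpendicular_at X2 (ideal_simplex v {k, l}) N"
    using N by (auto simp: common_perpendicular_def)
  then have XN: "X1 \<in> N" "X2 \<in> N"
    by (auto simp: perpendicular_at_def)
  have ij: "i \<noteq> j" "k \<noteq> l"
    using dist by auto
  obtain \<alpha> \<beta> where a: "0 < \<alpha>" "0 < \<beta>" "X1 = \<alpha> *\<^sub>R m i + \<beta> *\<^sub>R m j" "\<alpha> * mink (m i) X2 = \<beta> * mink (m j) X2"
    using perpendicular_at_edge[OF v ij(1) X1 XN(2)] unfolding m_def by blast
  obtain \<gamma> \<delta> where c: "0 < \<gamma>" "0 < \<delta>" "X2 = \<gamma> *\<^sub>R m k + \<delta> *\<^sub>R m l" "\<gamma> * mink (m k) X1 = \<delta> * mink (m l) X1"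
    using perpendicular_at_edge[OF v ij(2) X2 XN(1)] unfolding m_def by blast
  have gr: "mink (m j) (m l) = mink (m i) (m k)" "mink (m j) (m k) = mink (m i) (m l)"
    using balanced_null_opposite[OF v, of i j k l] balanced_null_opposite[OF v, of i j l k] dist
    by (auto simp: m_def)
  have "0 < mink (m i) (m k)" "0 < mink (m i) (m l)"
    using dist by (auto simp: m_def intro!: balanced_null_pos[OF v])
  moreover have 1: "\<alpha> * (\<gamma> * mink (m i) (m k) + \<delta> * mink (m i) (m l)) = \<beta> * (\<gamma> * mink (m i) (m l) + \<delta> * mink (m i) (m k))"
    using a(4) by (simp add: c(3) mink_linear gr)
  moreover have 2: "\<gamma> * (\<alpha> * mink (m i) (m k) + \<beta> * mink (m i) (m l)) = \<delta> * (\<alpha> * mink (m i) (m l) + \<beta> * mink (m i) (m k))"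
    using c(4) by (simp add: a(3) mink_linear gr mink_commute[of "m k"] mink_commute[of "m l"])
  ultimately have "\<alpha> = \<beta>" "\<gamma> = \<delta>"
    using foot_of_perpendicular[OF a(1,2) c(1,2) _ _ 1 2] by auto
  then have X12: "X1 = \<alpha> *\<^sub>R (m i + m j)" "X2 = \<gamma> *\<^sub>R (m k + m l)"
    using a c by (simp_all add: scaleR_add_right)
  obtain P Q where PQ: "N = {X \<in> H3. \<exists>a b. X = a *\<^sub>R P + b *\<^sub>R Q}"
    using N by (auto simp: common_perpendicular_def geodesic_def)
  obtain a1 b1 a2 b2 a0 b0 where *: "X1 = a1 *\<^sub>R P + b1 *\<^sub>R Q" "X2 = a2 *\<^sub>R P + b2 *\<^sub>R Q" "X = a0 *\<^sub>R P + b0 *\<^sub>R Q"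
    using XN \<open>X \<in> N\<close> unfolding PQ by blast
  \<comment> \<open>The determinant of the feet expressed in the points \<open>P\<close> and
    \<open>Q\<close> that define the geodesic; Cramer's rule then expresses \<open>P\<close> and
    \<open>Q\<close> in the feet.\<close>
  define D where "D = a1 * b2 - a2 * b1"
  have D: "b2 *\<^sub>R X1 - b1 *\<^sub>R X2 = D *\<^sub>R P" "a1 *\<^sub>R X2 - a2 *\<^sub>R X1 = D *\<^sub>R Q"
    unfolding * D_def by (simp_all add: algebra_simps)
  have "D \<noteq> 0"
  proof
    assume "D = 0"
    then have eq: "b2 *\<^sub>R X1 = b1 *\<^sub>R X2" "a1 *\<^sub>R X2 = a2 *\<^sub>R X1"
      using D by simp_all
    have "coord v i X1 = \<alpha> * balance v i" "coord v i X2 = 0"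
      using dist by (simp_all add: X12 m_def coord_simps[OF v] coord_balanced_null[OF v])
    then have "b2 = 0" "a2 = 0"
      using arg_cong[OF eq(1), of "coord v i"] arg_cong[OF eq(2), of "coord v i"] a(1) balance_pos[OF v, of i]
      by (simp_all add: coord_simps[OF v])
    then have "X2 = 0"
      using *(2) by simp
    moreover have "mink X2 X2 = 1"
      using XN PQ H3_mink by blast
    ultimately show False
      by simp
  qed
  have "D *\<^sub>R X = a0 *\<^sub>R (D *\<^sub>R P) + b0 *\<^sub>R (D *\<^sub>R Q)"
    unfolding * by (simp add: algebra_simps)
  also have "\<dots> = (a0 * b2 - b0 * a2) *\<^sub>R X1 + (b0 * a1 - a0 * b1) *\<^sub>R X2"
    unfolding D[symmetric] by (simp add: algebra_simps)
  finally have "(1 / D) *\<^sub>R (D *\<^sub>R X) = (1 / D) *\<^sub>R ((a0 * b2 - b0 * a2) *\<^sub>R X1 + (b0 * a1 - a0 * b1) *\<^sub>R X2)"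
    by simp
  then have "X = ((a0 * b2 - b0 * a2) / D * \<alpha>) *\<^sub>R (m i + m j) + ((b0 * a1 - a0 * b1) / D * \<gamma>) *\<^sub>R (m k + m l)"
    using \<open>D \<noteq> 0\<close> unfolding X12 by (simp add: scaleR_add_right)
  then show thesis
    by (rule that)
qed

lemma barycenter_balanced:
  assumes v: "positively_labelled v"
  obtains c where "0 < c" "barycenter v = (\<Sum>i\<in>UNIV. c *\<^sub>R balanced_null v i)" "barycenter v \<in> H3"
proof -
  let ?m = "balanced_null v"
  define M where "M = (\<Sum>i\<in>UNIV. ?m i)"
  define c where "c = 1 / sqrt (mink M M)"
  define B where "B = c *\<^sub>R M"
  have "0 \<le> mink (?m i) (?m j)" for i j
    using balanced_null_pos[OF v, of i j] balanced_null_self[of v i] by (cases "i = j") auto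
  then have pos: "0 < (\<Sum>i\<in>UNIV. \<Sum>j\<in>UNIV. mink (?m i) (?m j))"
    by (intro sum_pos2[of _ 0] sum_pos2[of _ 1] sum_nonneg balanced_null_pos[OF v]) auto
  have "mink M M = (\<Sum>i\<in>UNIV. \<Sum>j\<in>UNIV. mink (?m i) (?m j))"
    unfolding M_def mink_sum_left by (simp add: mink_sum_right)
  with pos have MM: "0 < mink M M"
    by simp
  then have c: "0 < c" "c * c * mink M M = 1"
    by (simp_all add: c_def)
  have Bsum: "B = (\<Sum>i\<in>UNIV. (c * balance v i) *\<^sub>R null_vector (v i))"
    by (simp add: B_def M_def scaleR_sum_right balanced_null_def)
  have B: "B \<in> H3"
    by (rule null_combination_in_H3[OF Bsum])
      (use c balance_pos[OF v] in \<open>auto simp: B_def mink_linear intro: less_imp_le\<close>)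
  define is_bary where "is_bary X \<longleftrightarrow> X \<in> H3 \<and> (\<forall>e. card e = 2 \<longrightarrow>
    (\<exists>N. common_perpendicular N (ideal_simplex v e) (ideal_simplex v (- e)) \<and> X \<in> N))" for X
  have "is_bary B"
    unfolding is_bary_def
  proof (intro conjI allI impI B)
    fix e :: "4 set" assume "card e = 2"
    then obtain i j k l where e: "distinct [i, j, k, l]" "e = {i, j}" "- e = {k, l}"
      by (rule card_2_labels)
    obtain N where N: "common_perpendicular N (ideal_simplex v {i, j}) (ideal_simplex v {k, l})"
      "\<And>X a b. X \<in> H3 \<Longrightarrow> X = a *\<^sub>R (?m i + ?m j) + b *\<^sub>R (?m k + ?m l) \<Longrightarrow> X \<in> N"
      using common_perpendicular_edges[OF v e(1)] by blast
    have "B = c *\<^sub>R (?m i + ?m j) + c *\<^sub>R (?m k + ?m l)"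
      unfolding B_def M_def sum_4_distinct[OF e(1)] by (simp add: scaleR_add_right)
    then show "\<exists>N. common_perpendicular N (ideal_simplex v e) (ideal_simplex v (- e)) \<and> B \<in> N"
      using N B e by metis
  qed
  moreover have "X = B" if X: "is_bary X" for X
  proof -
    \<comment> \<open>The perpendicular of \<open>{i, j}\<close> and \<open>{k, l}\<close> equates
      the normalised coordinates at \<open>i\<close> and \<open>j\<close>; the three edges at the
      label 0 together equate all four.\<close>
    have ratio: "coord v i X / balance v i = coord v j X / balance v j" if dist: "distinct [i, j, k, l]" for i j k l
    proof -
      have "card {i, j} = 2" "- {i, j} = {k, l}"
        using dist Compl_4_distinct[OF dist] by auto
      then obtain N where "common_perpendicular N (ideal_simplex v {i, j}) (ideal_simplex v {k, l})" "X \<in> N"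
        using X unfolding is_bary_def by metis
      then obtain s t where "X = s *\<^sub>R (?m i + ?m j) + t *\<^sub>R (?m k + ?m l)"
        by (rule common_perpendicular_span[OF v dist])
      then have "coord v i X = s * balance v i" "coord v j X = s * balance v j"
        using dist by (auto simp: coord_simps[OF v] coord_balanced_null[OF v])
      then show ?thesis
        using balance_pos[OF v, of i] balance_pos[OF v, of j] by simp
    qed
    define s where "s = coord v 0 X / balance v 0"
    have "coord v i X / balance v i = s" for i
      using exhaust_4_from_0[of i] ratio[of 0 1 2 3] ratio[of 0 2 1 3] ratio[of 0 3 1 2]
      by (auto simp: s_def)
    then have co: "coord v i X = s * balance v i" for i
      using balance_pos[OF v, of i] by (metis less_irrefl nonzero_divide_eq_eq)
    \<comment> \<open>Knowing the coordinates is not enough until \<open>X\<close> is known to lie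
      in the span of the null vectors, which a single common perpendicular provides.\<close>
    have "X = (\<Sum>i\<in>UNIV. coord v i X *\<^sub>R null_vector (v i))"
    proof -
      have "card {0, 1 :: 4} = 2" "- {0, 1 :: 4} = {2, 3}" "distinct [0, 1, 2, 3 :: 4]"
        using Compl_4_distinct[of 0 1 2 3] by auto
      then obtain N where "common_perpendicular N (ideal_simplex v {0, 1}) (ideal_simplex v {2, 3})" "X \<in> N"
        using X unfolding is_bary_def by metis
      then obtain s t where st: "X = s *\<^sub>R (?m 0 + ?m 1) + t *\<^sub>R (?m 2 + ?m 3)"
        by (rule common_perpendicular_span[OF v \<open>distinct [0, 1, 2, 3 :: 4]\<close>])
      have "coord v 0 X = s * balance v 0" "coord v 1 X = s * balance v 1"
        "coord v 2 X = t * balance v 2" "coord v 3 X = t * balance v 3"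
        by (simp_all add: st coord_simps[OF v] coord_balanced_null[OF v])
      then show ?thesis
        by (simp add: sum_4_from_0) (simp add: st balanced_null_def scaleR_add_right)
    qed
    then have Xs: "X = s *\<^sub>R M"
      unfolding co by (simp add: M_def scaleR_sum_right balanced_null_def)
    have XH: "X \<in> H3"
      using X by (simp add: is_bary_def)
    have "s * s * mink M M = c * c * mink M M"
      using H3_mink[OF XH] c(2) by (simp add: Xs mink_linear)
    then have "s\<^sup>2 = c\<^sup>2"
      using MM by (simp add: power2_eq_square)
    \<comment> \<open>The norm determines \<open>s\<close> up to sign; the negative sign would give
      a point on the other sheet of the hyperboloid.\<close>
    then consider "s = c" | "s = - c"
      using power2_eq_iff by blast
    then show "X = B"
    proof cases
      case 2
      then have "X = - B"
        by (simp add: Xs B_def)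
      then have "Re (trace X) = - Re (trace B)"
        by (simp add: trace_def sum_2)
      then show ?thesis
        using B XH by (auto simp: H3_def)
    qed (simp add: Xs B_def)
  qed
  ultimately have "barycenter v = B"
    unfolding barycenter_def is_bary_def by (rule the_equality)
  then show thesis
    using that[of c] c(1) B by (simp add: B_def M_def scaleR_sum_right)
qed

lemma barycenter_coords:
  assumes v: "positively_labelled v"
  shows "0 < coord v i (barycenter v)"
    and "barycenter v = (\<Sum>i\<in>UNIV. coord v i (barycenter v) *\<^sub>R null_vector (v i))"
proof -
  obtain c where c: "0 < c" "barycenter v = (\<Sum>i\<in>UNIV. c *\<^sub>R balanced_null v i)"
    using barycenter_balanced[OF v] by blast
  then have b: "barycenter v = (\<Sum>i\<in>UNIV. (c * balance v i) *\<^sub>R null_vector (v i))"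
    by (simp add: balanced_null_def)
  then have co: "coord v i (barycenter v) = c * balance v i" for i
    using coord_sum[OF v] by simp
  then show "0 < coord v i (barycenter v)"
    using c balance_pos[OF v] by simp
  show "barycenter v = (\<Sum>i\<in>UNIV. coord v i (barycenter v) *\<^sub>R null_vector (v i))"
    unfolding co by (rule b)
qed


section \<open>Cones over the faces\<close>

definition bary_ratio :: "(4 \<Rightarrow> complex^2) \<Rightarrow> 4 \<Rightarrow> cmat2 \<Rightarrow> real" where
  "bary_ratio v i X = coord v i X / coord v i (barycenter v)"

definition open_tetrahedron :: "(4 \<Rightarrow> complex^2) \<Rightarrow> cmat2 set" where
  "open_tetrahedron v = {X \<in> ideal_tetrahedron v. \<forall>i. 0 < coord v i X}"

definition open_face :: "(4 \<Rightarrow> complex^2) \<Rightarrow> 4 \<Rightarrow> cmat2 set" where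
  "open_face v q = {X \<in> ideal_tetrahedron v. coord v q X = 0 \<and> (\<forall>i. i \<noteq> q \<longrightarrow> 0 < coord v i X)}"

lemma bary_ratio_pos_iff: "positively_labelled v \<Longrightarrow> 0 < bary_ratio v i X \<longleftrightarrow> 0 < coord v i X"
  and bary_ratio_nonneg_iff: "positively_labelled v \<Longrightarrow> 0 \<le> bary_ratio v i X \<longleftrightarrow> 0 \<le> coord v i X"
  and bary_ratio_zero_iff: "positively_labelled v \<Longrightarrow> bary_ratio v i X = 0 \<longleftrightarrow> coord v i X = 0"
  using barycenter_coords(1)[of v i]
  by (auto simp: bary_ratio_def zero_less_divide_iff zero_le_divide_iff)

lemma coord_nonneg: "positively_labelled v \<Longrightarrow> X \<in> ideal_tetrahedron v \<Longrightarrow> 0 \<le> coord v i X"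
  by (meson ideal_tetrahedron_iff)

text \<open>Off \<open>S\<close> only the barycenter contributes, so its weight
  \<open>\<beta>\<close> is the common value of the normalised coordinates there; on
  \<open>S\<close> they exceed \<open>\<beta>\<close> by the contribution of the null
  vectors.\<close>

lemma bary_cone_iff:
  assumes v: "positively_labelled v"
  shows "X \<in> bary_cone v S \<longleftrightarrow> X \<in> ideal_tetrahedron v \<and>
    (\<exists>\<beta>\<ge>0. (\<forall>i\<in>- S. bary_ratio v i X = \<beta>) \<and> (\<forall>i\<in>S. \<beta> \<le> bary_ratio v i X))" (is "?l \<longleftrightarrow> ?r")
proof -
  let ?n = "\<lambda>i. null_vector (v i)" and ?b = "\<lambda>i. coord v i (barycenter v)"
  have b: "0 < ?b i" for i
    by (rule barycenter_coords[OF v])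
  have bn: "barycenter v = (\<Sum>i\<in>UNIV. ?b i *\<^sub>R ?n i)"
    by (rule barycenter_coords[OF v])
  show ?thesis
  proof
    assume ?l
    then obtain c \<beta> where *: "X \<in> H3" "\<forall>i\<in>S. 0 \<le> c i" "0 \<le> \<beta>" "X = (\<Sum>i\<in>S. c i *\<^sub>R ?n i) + \<beta> *\<^sub>R barycenter v"
      by (auto simp: bary_cone_def)
    have co: "coord v i X = (if i \<in> S then c i else 0) + \<beta> * ?b i" for i
      unfolding *(4) by (simp add: coord_simps[OF v] coord_sum[OF v])
    have "(\<Sum>i\<in>S. c i *\<^sub>R ?n i) = (\<Sum>i\<in>UNIV. (if i \<in> S then c i else 0) *\<^sub>R ?n i)"
      by (subst sum_zero_extend[of S "\<lambda>i. if i \<in> S then c i else 0", symmetric]) auto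
    moreover have "\<beta> *\<^sub>R barycenter v = (\<Sum>i\<in>UNIV. (\<beta> * ?b i) *\<^sub>R ?n i)"
      by (subst bn) (simp add: scaleR_sum_right)
    ultimately have "X = (\<Sum>i\<in>UNIV. ((if i \<in> S then c i else 0) + \<beta> * ?b i) *\<^sub>R ?n i)"
      unfolding *(4) by (simp only: scaleR_add_left sum.distrib)
    then have X: "X = (\<Sum>i\<in>UNIV. coord v i X *\<^sub>R ?n i)"
      unfolding co .
    have nonneg: "0 \<le> coord v i X" for i
      unfolding co using *(2,3) b[of i] by simp
    have "X \<in> ideal_tetrahedron v"
      unfolding ideal_tetrahedron_iff[OF v] using *(1) X nonneg by metis
    moreover have "\<forall>i\<in>- S. bary_ratio v i X = \<beta>" "\<forall>i\<in>S. \<beta> \<le> bary_ratio v i X"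
      unfolding bary_ratio_def co using *(2) b by (auto simp: field_simps less_imp_neq[THEN not_sym])
    ultimately show ?r
      using *(3) by metis
  next
    assume r: ?r
    then obtain \<beta> where *: "0 \<le> \<beta>" "\<And>i. i \<notin> S \<Longrightarrow> bary_ratio v i X = \<beta>" "\<And>i. i \<in> S \<Longrightarrow> \<beta> \<le> bary_ratio v i X"
      by (metis ComplI)
    define c where "c i = coord v i X - \<beta> * ?b i" for i
    have co: "coord v i X = bary_ratio v i X * ?b i" for i
      unfolding bary_ratio_def using b[of i] by simp
    have c: "0 \<le> c i" if "i \<in> S" for i
      unfolding c_def co using mult_right_mono[OF *(3)[OF that], of "?b i"] b[of i] by simp
    have c0: "c i = 0" if "i \<notin> S" for i
      unfolding c_def co using *(2)[OF that] by simp
    have "(\<Sum>i\<in>S. c i *\<^sub>R ?n i) = (\<Sum>i\<in>UNIV. c i *\<^sub>R ?n i)"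
      by (rule sum_zero_extend) (rule c0)
    also have "\<dots> = (\<Sum>i\<in>UNIV. coord v i X *\<^sub>R ?n i) - \<beta> *\<^sub>R (\<Sum>i\<in>UNIV. ?b i *\<^sub>R ?n i)"
      by (simp add: c_def scaleR_diff_left sum_subtractf scaleR_sum_right)
    also have "\<dots> = X - \<beta> *\<^sub>R barycenter v"
      using r bn unfolding ideal_tetrahedron_iff[OF v] by metis
    finally have "X = (\<Sum>i\<in>S. c i *\<^sub>R ?n i) + \<beta> *\<^sub>R barycenter v"
      by (simp add: algebra_simps)
    moreover have "X \<in> H3"
      using r by (simp add: ideal_simplex_def)
    ultimately show ?l
      unfolding bary_cone_def using c *(1) by blast
  qed
qed

text \<open>The closed cone over the face is where the ratio at \<open>q\<close> is minimal, and the
  cone over the edge \<open>- {p, q}\<close> is where the ratio at \<open>p\<close> ties with it.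
  Removing the three edge cones removes the ties.\<close>

lemma half_suspension_iff:
  assumes v: "positively_labelled v"
  shows "X \<in> half_suspension v q \<longleftrightarrow>
    X \<in> ideal_tetrahedron v \<and> (\<forall>i. i \<noteq> q \<longrightarrow> bary_ratio v q X < bary_ratio v i X)" (is "?l \<longleftrightarrow> ?r")
proof -
  have edges: "{e. e \<subseteq> - {q} \<and> card e = 2} = (\<lambda>p. - {p, q}) ` (- {q})"
  proof (intro equalityI subsetI)
    fix e :: "4 set" assume e: "e \<in> {e. e \<subseteq> - {q} \<and> card e = 2}"
    then have "card (- e) = 2"
      by (simp add: Compl_eq_Diff_UNIV card_Diff_subset)
    then obtain a b where "- e = {a, b}" "a \<noteq> b"
      by (auto simp: card_2_iff)
    moreover from this e have "q = a \<or> q = b"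
      by blast
    ultimately have "\<exists>p. p \<noteq> q \<and> - e = {p, q}"
      by (metis insert_commute)
    then show "e \<in> (\<lambda>p. - {p, q}) ` (- {q})"
      by (metis ComplI double_complement image_eqI singletonD)
  next
    fix e :: "4 set" assume "e \<in> (\<lambda>p. - {p, q}) ` (- {q})"
    then show "e \<in> {e. e \<subseteq> - {q} \<and> card e = 2}"
      by (auto simp: Compl_eq_Diff_UNIV card_Diff_subset)
  qed
  let ?b = "bary_ratio v"
  have nonneg: "0 \<le> ?b q X" if "X \<in> ideal_tetrahedron v"
    using that v by (simp add: bary_ratio_nonneg_iff coord_nonneg)
  have face: "X \<in> bary_cone v (- {q}) \<longleftrightarrow> X \<in> ideal_tetrahedron v \<and> (\<forall>i. i \<noteq> q \<longrightarrow> ?b q X \<le> ?b i X)"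
    unfolding bary_cone_iff[OF v] using nonneg by auto
  have edge: "X \<in> bary_cone v (- {p, q}) \<longleftrightarrow> X \<in> ideal_tetrahedron v \<and> ?b p X = ?b q X \<and>
      (\<forall>i. i \<noteq> q \<longrightarrow> ?b q X \<le> ?b i X)" for p
    unfolding bary_cone_iff[OF v] using nonneg by auto
  have "X \<in> half_suspension v q \<longleftrightarrow> X \<in> bary_cone v (- {q}) \<and> (\<forall>p. p \<noteq> q \<longrightarrow> X \<notin> bary_cone v (- {p, q}))"
    unfolding half_suspension_def edges by auto
  then show ?thesis
    unfolding face edge by (metis order_less_le)
qed

lemma half_suspension_disjoint:
  "positively_labelled v \<Longrightarrow> X \<in> half_suspension v q \<Longrightarrow> X \<in> half_suspension v q' \<Longrightarrow> q' = q"
  by (metis half_suspension_iff less_asym)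

text \<open>All coordinates other than the smallest are positive. Hence a point of a half suspension
  can be identified with another point only across the face in question.\<close>

lemma half_suspension_subset:
  assumes v: "positively_labelled v"
  shows "half_suspension v q \<subseteq> open_tetrahedron v \<union> open_face v q"
proof
  fix X assume X: "X \<in> half_suspension v q"
  then have T: "X \<in> ideal_tetrahedron v" and less: "\<And>i. i \<noteq> q \<Longrightarrow> bary_ratio v q X < bary_ratio v i X"
    by (auto simp: half_suspension_iff[OF v])
  have q: "0 \<le> bary_ratio v q X"
    using T by (simp add: bary_ratio_nonneg_iff[OF v] coord_nonneg[OF v])
  then have "0 < coord v i X" if "i \<noteq> q" for i
    using less[OF that] by (simp add: bary_ratio_pos_iff[OF v, symmetric])
  moreover have "coord v q X = 0 \<or> 0 < coord v q X"
    using coord_nonneg[OF v T, of q] by auto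
  ultimately show "X \<in> open_tetrahedron v \<union> open_face v q"
    using T unfolding open_tetrahedron_def open_face_def by (auto, metis)
qed

lemma open_face_subset_half_suspension:
  assumes v: "positively_labelled v"
  shows "open_face v q \<subseteq> half_suspension v q"
  unfolding open_face_def half_suspension_iff[OF v] subset_eq
  by (simp add: bary_ratio_zero_iff[OF v, THEN iffD2] bary_ratio_pos_iff[OF v])

text \<open>Once the edge itself is removed, the weight of the barycenter is positive and bounds all
  ratios from below. So every crossing takes place in the interior of a tetrahedron.\<close>

lemma open_edge_cone_subset:
  assumes v: "positively_labelled v"
  shows "open_edge_cone v (- {p, q}) \<subseteq> open_tetrahedron v"
proof
  fix X assume X: "X \<in> open_edge_cone v (- {p, q})"
  then have "X \<in> bary_cone v (- {p, q})" "X \<notin> ideal_simplex v (- {p, q})"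
    by (auto simp: open_edge_cone_def)
  then obtain \<beta> where *: "X \<in> ideal_tetrahedron v" "0 \<le> \<beta>" "\<forall>i\<in>{p, q}. bary_ratio v i X = \<beta>"
    "\<forall>i\<in>- {p, q}. \<beta> \<le> bary_ratio v i X" "\<not> (\<forall>i\<in>{p, q}. coord v i X = 0)"
    unfolding bary_cone_iff[OF v] ideal_simplex_iff_tetrahedron[OF v, of X "- {p, q}"] by auto
  then have "0 < \<beta>"
    using bary_ratio_zero_iff[OF v] by (metis order_less_le)
  then have "0 < bary_ratio v i X" for i
    using *(3,4) by (cases "i \<in> {p, q}") (auto intro: less_le_trans)
  then show "X \<in> open_tetrahedron v"
    using *(1) by (simp add: open_tetrahedron_def bary_ratio_pos_iff[OF v])
qed

section \<open>Openness and connectedness of the pieces\<close>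

lemma continuous_on_bary_ratio: "positively_labelled v \<Longrightarrow> continuous_on S (bary_ratio v i)"
  unfolding bary_ratio_def using barycenter_coords(1)[of v i]
  by (intro continuous_intros continuous_on_coord) auto

lemma openin_half_suspension:
  assumes v: "positively_labelled v"
  shows "openin (top_of_set (ideal_tetrahedron v)) (half_suspension v q)"
proof -
  have "half_suspension v q = (\<Inter>i\<in>UNIV. {X \<in> ideal_tetrahedron v. i \<noteq> q \<longrightarrow> bary_ratio v q X < bary_ratio v i X})"
    by (auto simp: half_suspension_iff[OF v])
  moreover have "openin (top_of_set (ideal_tetrahedron v))
      {X \<in> ideal_tetrahedron v. i \<noteq> q \<longrightarrow> bary_ratio v q X < bary_ratio v i X}" for i
  proof (cases "i = q")
    case False
    have "continuous_on (ideal_tetrahedron v) (\<lambda>X. bary_ratio v i X - bary_ratio v q X)"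
      by (intro continuous_intros continuous_on_bary_ratio[OF v])
    from continuous_openin_preimage_gen[OF this open_greaterThan, of 0] False show ?thesis
      by (simp add: vimage_def Int_def)
  qed simp
  ultimately show ?thesis
    by (simp only:) (intro openin_INT2, simp_all)
qed

lemma openin_open_tetrahedron:
  assumes v: "positively_labelled v"
  shows "openin (top_of_set (ideal_tetrahedron v)) (open_tetrahedron v)"
proof -
  have "open_tetrahedron v = (\<Inter>i\<in>UNIV. {X \<in> ideal_tetrahedron v. 0 < coord v i X})"
    by (auto simp: open_tetrahedron_def)
  moreover have "openin (top_of_set (ideal_tetrahedron v)) {X \<in> ideal_tetrahedron v. 0 < coord v i X}" for i
    using continuous_openin_preimage_gen[OF continuous_on_coord[OF v] open_greaterThan, of "ideal_tetrahedron v" i 0]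
    by (simp add: vimage_def Int_def)
  ultimately show ?thesis
    by (simp only:) (intro openin_INT2, simp_all)
qed

lemma mink_ideal_tetrahedron_nonneg:
  assumes v: "positively_labelled v" and "X \<in> ideal_tetrahedron v" "Y \<in> ideal_tetrahedron v"
  shows "0 \<le> mink X Y"
proof -
  have sum: "(\<Sum>i\<in>UNIV. coord v i X *\<^sub>R null_vector (v i)) = X" "(\<Sum>i\<in>UNIV. coord v i Y *\<^sub>R null_vector (v i)) = Y"
    using assms by (simp_all only: ideal_tetrahedron_iff)
  have "0 \<le> mink (\<Sum>i\<in>UNIV. a i *\<^sub>R null_vector (v i)) (\<Sum>i\<in>UNIV. b i *\<^sub>R null_vector (v i))"
    if "\<And>i. 0 \<le> a i" "\<And>i. 0 \<le> b i" for a b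
    unfolding mink_sum_left mink_sum_right mink_scaleR_left mink_scaleR_right
    by (intro sum_nonneg mult_nonneg_nonneg mink_null_vector_nonneg that)
  from this[of "\<lambda>i. coord v i X" "\<lambda>i. coord v i Y"] show ?thesis
    unfolding sum using coord_nonneg[OF v] assms(2,3) by blast
qed

text \<open>A straight segment between two points has positive norm, so it can be projected back to the
  hyperboloid.\<close>

lemma connected_in_tetrahedron:
  assumes v: "positively_labelled v"
    and P: "\<And>X Y a b. P (\<lambda>i. coord v i X) \<Longrightarrow> P (\<lambda>i. coord v i Y) \<Longrightarrow> 0 \<le> a \<Longrightarrow> 0 \<le> b \<Longrightarrow> 0 < a + b \<Longrightarrow>
      P (\<lambda>i. coord v i (a *\<^sub>R X + b *\<^sub>R Y))"
  shows "connected {X \<in> ideal_tetrahedron v. P (\<lambda>i. coord v i X)}" (is "connected ?S")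
proof (rule path_connected_imp_connected, unfold path_connected_def, intro ballI)
  fix X Y assume XY: "X \<in> ?S" "Y \<in> ?S"
  define W where "W t = (1 - t) *\<^sub>R X + t *\<^sub>R Y" for t :: real
  define g where "g t = (1 / sqrt (mink (W t) (W t))) *\<^sub>R W t" for t
  have n: "mink X X = 1" "mink Y Y = 1" "0 \<le> mink X Y" "mink Y X = mink X Y"
    using XY H3_mink mink_ideal_tetrahedron_nonneg[OF v] mink_commute by (auto simp: ideal_simplex_def)
  have W: "mink (W t) (W t) = (1 - t)\<^sup>2 + t\<^sup>2 + 2 * (t * (1 - t) * mink X Y)" for t
    unfolding W_def by (simp only: mink_linear n) (simp add: power2_eq_square algebra_simps)
  have pos: "0 < mink (W t) (W t)" if "t \<in> {0..1}" for t
  proof -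
    have "0 \<le> t * (1 - t) * mink X Y"
      using that n by simp
    moreover have "0 < (1 - t)\<^sup>2 + t\<^sup>2"
      by (metis diff_zero sum_power2_gt_zero_iff zero_neq_one)
    ultimately show ?thesis
      unfolding W by linarith
  qed
  have "g t \<in> ?S" if t: "t \<in> {0..1}" for t
  proof -
    define s where "s = 1 / sqrt (mink (W t) (W t))"
    have s: "0 < s" "s * s * mink (W t) (W t) = 1"
      using pos[OF t] by (simp_all add: s_def)
    have gt: "g t = (s * (1 - t)) *\<^sub>R X + (s * t) *\<^sub>R Y"
      by (simp add: g_def W_def s_def scaleR_add_right)
    have XY': "X = (\<Sum>i\<in>UNIV. coord v i X *\<^sub>R null_vector (v i))" "Y = (\<Sum>i\<in>UNIV. coord v i Y *\<^sub>R null_vector (v i))"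
      using XY by (simp_all only: ideal_tetrahedron_iff[OF v] mem_Collect_eq)
    have co: "coord v i (g t) = s * (1 - t) * coord v i X + s * t * coord v i Y" for i
      unfolding gt by (simp add: coord_simps[OF v])
    have nonneg: "0 \<le> coord v i (g t)" for i
      unfolding co using s t XY coord_nonneg[OF v] by simp
    have "g t = (s * (1 - t)) *\<^sub>R (\<Sum>i\<in>UNIV. coord v i X *\<^sub>R null_vector (v i)) +
        (s * t) *\<^sub>R (\<Sum>i\<in>UNIV. coord v i Y *\<^sub>R null_vector (v i))"
      unfolding gt using XY' by metis
    also have "\<dots> = (\<Sum>i\<in>UNIV. coord v i (g t) *\<^sub>R null_vector (v i))"
      unfolding co by (simp add: scaleR_sum_right sum.distrib scaleR_add_left)
    finally have sum: "g t = (\<Sum>i\<in>UNIV. coord v i (g t) *\<^sub>R null_vector (v i))" .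
    have "mink (g t) (g t) = 1"
      using s(2) by (simp add: g_def s_def[symmetric] mink_linear)
    then have "g t \<in> H3"
      by (intro null_combination_in_H3[OF sum]) (auto intro: nonneg)
    then have "g t \<in> ideal_tetrahedron v"
      unfolding ideal_tetrahedron_iff[OF v] using sum nonneg by metis
    moreover have "P (\<lambda>i. coord v i (g t))"
      unfolding gt by (rule P) (use XY s t in \<open>auto simp: distrib_left[symmetric]\<close>)
    ultimately show ?thesis
      by simp
  qed
  moreover have "path g"
    unfolding path_def g_def
  proof (intro continuous_intros)
    show "continuous_on {0..1} (\<lambda>t. mink (W t) (W t))"
      unfolding W by (intro continuous_intros)
    show "continuous_on {0..1} W"
      unfolding W_def by (intro continuous_intros)
    show "\<forall>t\<in>{0..1}. sqrt (mink (W t) (W t)) \<noteq> 0"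
      using pos by fastforce
  qed
  moreover have "pathstart g = X" "pathfinish g = Y"
    by (simp_all add: pathstart_def pathfinish_def g_def W_def n)
  ultimately show "\<exists>g. path g \<and> path_image g \<subseteq> ?S \<and> pathstart g = X \<and> pathfinish g = Y"
    by (auto simp: path_image_def intro!: exI[of _ g])
qed

lemma connected_ideal_tetrahedron: "positively_labelled v \<Longrightarrow> connected (ideal_tetrahedron v)"
  using connected_in_tetrahedron[of v "\<lambda>_. True"] by simp

lemma connected_open_face:
  assumes v: "positively_labelled v"
  shows "connected (open_face v q)"
proof -
  have "0 < a * x + b * y" if "0 < x" "0 < y" "0 \<le> a" "0 \<le> b" "0 < a + b" for a b x y :: real
    using that by (metis add_cancel_left_left add_nonneg_pos add_pos_nonneg mult_nonneg_nonneg mult_pos_pos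
        order_less_le)
  then show ?thesis
    unfolding open_face_def by (intro connected_in_tetrahedron[OF v]) (simp_all add: coord_simps[OF v])
qed

section \<open>Isometries matching the vertices of two faces\<close>

lemma act_face_coords:
  assumes v: "positively_labelled v" and v': "positively_labelled v'" and \<sigma>: "bij \<sigma>"
    and A: "\<And>j. j \<noteq> q \<Longrightarrow> same_ideal_point (A *v v j) (v' (\<sigma> j))" "det A = 1"
    and X: "X \<in> ideal_simplex v (- {q})"
  shows "act A X \<in> ideal_simplex v' (- {\<sigma> q})"
    and "j \<noteq> q \<Longrightarrow> 0 < coord v j X \<Longrightarrow> 0 < coord v' (\<sigma> j) (act A X)"
proof -
  \<comment> \<open>Ideal points fix null vectors only up to positive factors, so the isometry
    preserves the signs of the coordinates but not in general their values.\<close>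
  have "\<exists>k>0. null_vector (A *v v j) = k *\<^sub>R null_vector (v' (\<sigma> j))" if "j \<noteq> q" for j
    using null_vector_same_ideal_point[OF same_ideal_point_sym[OF A(1)[OF that]]] by metis
  then obtain k where k: "\<And>j. j \<noteq> q \<Longrightarrow> 0 < k j"
    "\<And>j. j \<noteq> q \<Longrightarrow> null_vector (A *v v j) = k j *\<^sub>R null_vector (v' (\<sigma> j))"
    by metis
  obtain c where c: "X \<in> H3" "\<forall>i\<in>- {q}. 0 \<le> c i" "X = (\<Sum>i\<in>- {q}. c i *\<^sub>R null_vector (v i))"
    using X by (auto simp: ideal_simplex_def)
  define c' where "c' i = c (inv \<sigma> i) * k (inv \<sigma> i)" for i
  have inv: "inv \<sigma> (\<sigma> i) = i" for i
    using \<sigma> by (simp add: bij_is_inj)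
  have inj: "\<sigma> i = \<sigma> j \<longleftrightarrow> i = j" for i j
    by (metis inv)
  have im: "\<sigma> ` (- {q}) = - {\<sigma> q}"
    using \<sigma> by (simp add: bij_image_Compl_eq)
  have "act A X = (\<Sum>i\<in>- {q}. c' (\<sigma> i) *\<^sub>R null_vector (v' (\<sigma> i)))"
    unfolding c(3) act_sum act_scaleR act_null_vector
    by (rule sum.cong) (auto simp: c'_def inv k)
  also have "\<dots> = (\<Sum>i\<in>- {\<sigma> q}. c' i *\<^sub>R null_vector (v' i))"
    unfolding im[symmetric] by (subst sum.reindex) (auto simp: inj_on_def inj)
  finally have sum: "act A X = (\<Sum>i\<in>- {\<sigma> q}. c' i *\<^sub>R null_vector (v' i))" .
  have c': "0 \<le> c' i" if "i \<in> - {\<sigma> q}" for i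
  proof -
    have "i \<in> \<sigma> ` (- {q})"
      using that by (simp only: im)
    then obtain j where "j \<noteq> q" "i = \<sigma> j"
      by blast
    then show ?thesis
      using c(2) k(1) by (simp add: c'_def inv less_imp_le)
  qed
  have "act A X \<in> H3"
    by (rule null_combination_in_H3[OF sum]) (use c' in \<open>auto simp: mink_act[OF A(2)] H3_mink[OF c(1)]\<close>)
  then show "act A X \<in> ideal_simplex v' (- {\<sigma> q})"
    unfolding ideal_simplex_def by (intro CollectI conjI exI[of _ c'] ballI c' sum)
  assume "j \<noteq> q" "0 < coord v j X"
  then have "0 < c j"
    unfolding c(3) coord_sum[OF v] by (simp split: if_splits)
  then show "0 < coord v' (\<sigma> j) (act A X)"
    unfolding sum coord_sum[OF v'] using \<open>j \<noteq> q\<close> k(1) by (simp add: inj c'_def inv)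
qed

lemma open_face_eq:
  assumes v: "positively_labelled v"
  shows "open_face v q = {X \<in> ideal_simplex v (- {q}). \<forall>i. i \<noteq> q \<longrightarrow> 0 < coord v i X}"
  unfolding open_face_def ideal_simplex_iff_tetrahedron[OF v, of _ "- {q}"] by auto

lemma act_open_face:
  assumes "positively_labelled v" "positively_labelled v'" "bij \<sigma>"
    and "\<And>j. j \<noteq> q \<Longrightarrow> same_ideal_point (A *v v j) (v' (\<sigma> j))" "det A = 1"
    and X: "X \<in> open_face v q"
  shows "act A X \<in> open_face v' (\<sigma> q)"
proof -
  have "0 < coord v' i (act A X)" if "i \<noteq> \<sigma> q" for i
  proof -
    obtain j where "i = \<sigma> j"
      using assms(3) by (metis bij_pointE)
    then show ?thesis
      using act_face_coords(2)[OF assms(1-5), where X = X and j = j] X that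
      by (auto simp: open_face_eq[OF assms(1)])
  qed
  then show ?thesis
    using act_face_coords(1)[OF assms(1-5), where X = X] X
    by (simp add: open_face_eq[OF assms(1)] open_face_eq[OF assms(2)])
qed

text \<open>Two of the null vectors already give a positive mixed term, so the norm is positive and
  can be scaled to 1. This provides points of the open face in all positive directions of its
  span.\<close>

lemma positive_combination_in_open_face:
  assumes v: "positively_labelled v" and c: "\<And>i. 0 < c i"
  obtains s where "0 < s" "s *\<^sub>R (\<Sum>i\<in>- {q}. c i *\<^sub>R null_vector (v i)) \<in> open_face v q"
proof -
  let ?n = "\<lambda>i. null_vector (v i)"
  define W where "W = (\<Sum>i\<in>- {q}. c i *\<^sub>R ?n i)"
  have g: "0 \<le> mink (c i *\<^sub>R ?n i) (c j *\<^sub>R ?n j)" for i j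
    using c by (simp add: mink_linear mink_null_vector_nonneg less_imp_le)
  have "card (- {q}) = 3"
    by (simp add: Compl_eq_Diff_UNIV card_Diff_subset)
  then obtain a b where "{a, b} \<subseteq> - {q}" "a \<noteq> b"
    by (auto simp: card_3_iff)
  then have ab: "a \<noteq> q" "b \<noteq> q" "a \<noteq> b"
    by auto
  have "0 < mink W W"
    unfolding W_def mink_sum_left
  proof (rule sum_pos2[of _ a])
    show "0 < mink (c a *\<^sub>R ?n a) (\<Sum>i\<in>- {q}. c i *\<^sub>R ?n i)"
      unfolding mink_sum_right
      by (rule sum_pos2[of _ b]) (use g c ab gram_pos[OF v, of a b] in \<open>auto simp: mink_linear gram_def\<close>)
  qed (use ab g in \<open>auto simp: mink_sum_right intro!: sum_nonneg\<close>)
  define s where "s = 1 / sqrt (mink W W)"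
  have s: "0 < s" "s * s * mink W W = 1"
    using \<open>0 < mink W W\<close> by (simp_all add: s_def)
  have sW: "s *\<^sub>R W = (\<Sum>i\<in>- {q}. (s * c i) *\<^sub>R ?n i)"
    by (simp add: W_def scaleR_sum_right)
  have sc: "0 \<le> s * c i" for i
    using s c[of i] by simp
  have "s *\<^sub>R W \<in> H3"
    by (rule null_combination_in_H3[OF sW]) (use s sc in \<open>auto simp: mink_linear\<close>)
  then have "s *\<^sub>R W \<in> ideal_simplex v (- {q})"
    unfolding ideal_simplex_def by (intro CollectI conjI exI[of _ "\<lambda>i. s * c i"] ballI sc sW)
  moreover have "0 < coord v i (s *\<^sub>R W)" if "i \<noteq> q" for i
    using that s(1) c[of i] unfolding sW coord_sum[OF v] by simp
ultimately have "s *\<^sub>R W \<in> open_face v q"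
    by (simp add: open_face_eq[OF v])
  then show thesis
    using that s(1) by (simp add: W_def)
qed

text \<open>A single null vector of the face is the difference of two positive combinations, with
  weights 2 and 1 at \<open>j\<close>. Linearity therefore carries agreement on the open face over
  to its ideal vertices.\<close>

lemma act_eq_on_open_face:
  assumes v: "positively_labelled v" and det: "det A = 1" "det B = 1"
    and eq: "\<And>X. X \<in> open_face v q \<Longrightarrow> act A X = act B X" and "j \<noteq> q"
  shows "same_ideal_point (A *v v j) (B *v v j)"
proof -
  let ?n = "\<lambda>i. null_vector (v i)"
  have comb: "act A (\<Sum>i\<in>- {q}. c i *\<^sub>R ?n i) = act B (\<Sum>i\<in>- {q}. c i *\<^sub>R ?n i)"
    if c: "\<And>i. 0 < c i" for c
  proof -
    obtain s where "0 < s" "s *\<^sub>R (\<Sum>i\<in>- {q}. c i *\<^sub>R ?n i) \<in> open_face v q"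
      using positive_combination_in_open_face[OF v c] .
    then show ?thesis
      using eq by (fastforce simp: act_scaleR)
  qed
  have "(\<Sum>i\<in>- {q}. (if i = j then 2 else 1) *\<^sub>R ?n i) = (\<Sum>i\<in>- {q}. 1 *\<^sub>R ?n i) + ?n j"
    using \<open>j \<noteq> q\<close> by (simp add: sum.remove[of "- {q}" j] scaleR_2)
  then have "act A (?n j) = act B (?n j)"
    using comb[of "\<lambda>i. if i = j then 2 else 1"] comb[of "\<lambda>_. 1"] by (simp add: act_add)
  then have "null_vector (A *v v j) = null_vector (B *v v j)"
    by (simp add: act_null_vector)
  moreover have "C *v v j \<noteq> 0" if "det C = 1" for C :: cmat2
  proof
    assume "C *v v j = 0"
    then have "bracket (C *v v j) (C *v v q) = 0"
      by (simp add: bracket_def)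
    then show False
      using that positively_labelled_bracket_nonzero[OF v \<open>j \<noteq> q\<close>] by (simp add: bracket_mult)
  qed
  ultimately show ?thesis
    using det by (intro null_vector_eq_imp_same_ideal_point)
qed

lemma gluing_isometry_exists:
  assumes v: "positively_labelled v" and v': "positively_labelled v'" and \<sigma>: "bij \<sigma>"
  obtains A where "det A = 1" "\<And>j. j \<noteq> q \<Longrightarrow> same_ideal_point (A *v v j) (v' (\<sigma> j))"
proof -
  obtain a b c where abc: "distinct [q, a, b, c]"
  proof -
    have "card (- {q}) = 3"
      by (simp add: Compl_eq_Diff_UNIV card_Diff_subset)
    then obtain a b c where "- {q} = {a, b, c}" "a \<noteq> b" "b \<noteq> c" "a \<noteq> c"
      by (auto simp: card_3_iff)
    then show thesis
      by (intro that[of a b c]) auto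
  qed
  have ne: "\<sigma> i \<noteq> \<sigma> j" if "i \<noteq> j" for i j
    using that \<sigma> by (metis bij_pointE)
  have "bracket (v a) (v b) \<noteq> 0" "bracket (v c) (v b) \<noteq> 0" "bracket (v c) (v a) \<noteq> 0"
    using abc by (auto intro!: positively_labelled_bracket_nonzero[OF v])
  then obtain F where F: "frame F (v a) (v b) (v c)"
    by (rule frame_exists)
  have "bracket (v' (\<sigma> a)) (v' (\<sigma> b)) \<noteq> 0" "bracket (v' (\<sigma> c)) (v' (\<sigma> b)) \<noteq> 0"
    "bracket (v' (\<sigma> c)) (v' (\<sigma> a)) \<noteq> 0"
    using abc by (auto intro!: positively_labelled_bracket_nonzero[OF v'] ne)
  then obtain F' where F': "frame F' (v' (\<sigma> a)) (v' (\<sigma> b)) (v' (\<sigma> c))"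
    by (rule frame_exists)
  have dets: "det F \<noteq> 0" "det F' \<noteq> 0"
    using F F' by (auto simp: frame_def)
  then obtain G where G: "F ** G = mat 1" "G ** F = mat 1"
    by (metis invertible_def invertible_det_nz)
  define B where "B = F' ** G"
  have BF: "B ** F = F'"
    by (simp add: B_def matrix_mul_assoc[symmetric] G)
  have detB: "det B \<noteq> 0"
    using dets BF by (metis det_mul mult_eq_0_iff)
  define s where "s = 1 / csqrt (det B)"
  have s: "s \<noteq> 0" "s * s * det B = 1"
    using detB by (simp_all add: s_def power_divide flip: power2_eq_square)
  define A where "A = mat s ** B"
  have "det A = s * s * det B"
    by (simp add: A_def det_mul) (simp add: det_2 mat_def)
  then have "det A = 1"
    using s by simp
  moreover have "same_ideal_point (A *v v j) (v' (\<sigma> j))" if "j \<noteq> q" for j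
  proof -
    have "same_ideal_point (B *v v i) (v' (\<sigma> i))" if "same_ideal_point (F *v e) (v i)" "same_ideal_point (F' *v e) (v' (\<sigma> i))" for i e
      using same_ideal_point_mult[OF that(1), of B] that(2)
      by (metis BF matrix_vector_mul_assoc same_ideal_point_sym same_ideal_point_trans)
    then have "same_ideal_point (B *v v a) (v' (\<sigma> a))" "same_ideal_point (B *v v b) (v' (\<sigma> b))" "same_ideal_point (B *v v c) (v' (\<sigma> c))"
      using F F' unfolding frame_def by blast+
    moreover have "j = a \<or> j = b \<or> j = c"
      using that UNIV_4_distinct[OF abc] by blast
    ultimately show ?thesis
      using s(1) by (auto simp: A_def same_ideal_point_scaled_matrix)
  qed
  ultimately show thesis
    by (rule that)
qed

text \<open>Three ideal points determine a matrix up to a scalar, determinant 1 leaves a sign, and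
  \<open>act\<close> is insensitive to it.\<close>

lemma gluing_isometry_unique:
  assumes v: "positively_labelled v"
    and A: "det A = 1" "\<And>j. j \<noteq> q \<Longrightarrow> same_ideal_point (A *v v j) (w j)"
    and B: "det B = 1" "\<And>j. j \<noteq> q \<Longrightarrow> same_ideal_point (B *v v j) (w j)"
  shows "act A X = act B X"
proof -
  have "card (- {q}) = 3"
    by (simp add: Compl_eq_Diff_UNIV card_Diff_subset)
  then obtain a b c where abc: "- {q} = {a, b, c}" "a \<noteq> b" "b \<noteq> c" "a \<noteq> c"
    by (auto simp: card_3_iff)
  then have q: "a \<noteq> q" "b \<noteq> q" "c \<noteq> q"
    by auto
  obtain F where F: "frame F (v a) (v b) (v c)"
    using frame_exists[of "v a" "v b" "v c"] positively_labelled_bracket_nonzero[OF v] abc by metis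
  have "frame (C ** F) (w a) (w b) (w c)" if "det C = 1" "\<And>j. j \<noteq> q \<Longrightarrow> same_ideal_point (C *v v j) (w j)" for C
    using frame_cong[OF frame_transform[OF _ F, of C]] that q by simp
  then have "frame (A ** F) (w a) (w b) (w c)" "frame (B ** F) (w a) (w b) (w c)"
    using A B by blast+
  then obtain k where k: "B ** F = mat k ** (A ** F)"
    by (rule frame_unique)
  have "det F \<noteq> 0"
    using F by (simp add: frame_def)
  then obtain G where G: "F ** G = mat 1"
    by (metis invertible_def invertible_det_nz)
  have B': "B = mat k ** A"
    using arg_cong[OF k, of "\<lambda>M. M ** G"] by (simp add: matrix_mul_assoc[symmetric] G)
  have "det (mat k :: cmat2) = k * k"
    by (simp add: det_2 mat_def)
  then have "k * k = 1"
    using arg_cong[OF B', of det] A(1) B(1) by (simp add: det_mul)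
  then have "k = 1 \<or> k = - 1"
    by (metis square_eq_1_iff)
  then show ?thesis
    unfolding B' by (rule act_scaled[symmetric])
qed


section \<open>Lifting through coverings and quotients\<close>

text \<open>The uniqueness theorem of the library requires a normed total space.\<close>

lemma covering_lift_unique:
  fixes p :: "'b::topological_space \<Rightarrow> 'a::topological_space" and g h :: "'c::topological_space \<Rightarrow> 'b"
  assumes cov: "covering_space C p S" and T: "connected T"
    and g: "continuous_on T g" "g ` T \<subseteq> C" and h: "continuous_on T h" "h ` T \<subseteq> C"
    and eq: "\<And>x. x \<in> T \<Longrightarrow> p (g x) = p (h x)"
    and a: "a \<in> T" "g a = h a" and x: "x \<in> T"
  shows "g x = h x"
proof -
  define E where "E = {x \<in> T. g x = h x}"
  \<comment> \<open>Whether \<open>g\<close> and \<open>h\<close> agree is locally constant: over an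
    evenly covered set they lie either on one sheet, where \<open>p\<close> is injective, or on two
    disjoint sheets.\<close>
  have loc: "\<exists>U. openin (top_of_set T) U \<and> y \<in> U \<and> (\<forall>z\<in>U. g z = h z \<longleftrightarrow> g y = h y)"
    if y: "y \<in> T" for y
  proof -
    have "p (g y) \<in> S"
      using cov g(2) y by (auto simp: covering_space_def)
    then obtain O' V where V: "p (g y) \<in> O'" "\<Union>V = C \<inter> p -` O'" "\<forall>u\<in>V. openin (top_of_set C) u"
      "pairwise disjnt V" "\<forall>u\<in>V. \<exists>q. homeomorphism u O' p q"
      using cov unfolding covering_space_def by metis
    have "g y \<in> \<Union>V" "h y \<in> \<Union>V"
      using V(1,2) y g(2) h(2) eq[OF y] by auto
    then obtain u u' where u: "u \<in> V" "g y \<in> u" "u' \<in> V" "h y \<in> u'"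
      by blast
    define U where "U = (T \<inter> g -` u) \<inter> (T \<inter> h -` u')"
    have "openin (top_of_set C) u" "openin (top_of_set C) u'"
      using V(3) u by blast+
    then have "openin (top_of_set T) U"
      unfolding U_def using g h
      by (intro openin_Int[OF continuous_openin_preimage[of T g C u] continuous_openin_preimage[of T h C u']])
        (simp_all only: image_subset_iff_funcset)
    moreover have "y \<in> U"
      using y u by (simp add: U_def)
    moreover have "g z = h z \<longleftrightarrow> g y = h y" if z: "z \<in> U" for z
    proof -
      obtain q where "homeomorphism u O' p q"
        using V(5) u(1) by blast
      then have inj: "inj_on p u"
        by (intro inj_on_inverseI[of u q p]) (rule homeomorphism_apply1)
      have z': "z \<in> T" "g z \<in> u" "h z \<in> u'"
        using z by (auto simp: U_def)
      show ?thesis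
      proof (cases "u' = u")
        case True
        then show ?thesis
          using inj z' u eq y by (simp add: inj_on_def)
      next
        case False
        then have "u \<inter> u' = {}"
          using V(4) u by (auto simp: pairwise_def disjnt_def)
        then show ?thesis
          using z' u by auto
      qed
    qed
    ultimately show ?thesis
      by blast
  qed
  have "openin (top_of_set T) E"
  proof (subst openin_subopen, intro ballI)
    fix y assume "y \<in> E"
    then obtain U where "openin (top_of_set T) U" "y \<in> U" "\<forall>z\<in>U. g z = h z"
      using loc[of y] by (auto simp: E_def)
    then show "\<exists>U. openin (top_of_set T) U \<and> y \<in> U \<and> U \<subseteq> E"
      using openin_imp_subset by (fastforce simp: E_def)
  qed
  moreover have "openin (top_of_set T) (T - E)"
  proof (subst openin_subopen, intro ballI)
    fix y assume "y \<in> T - E"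
    then obtain U where "openin (top_of_set T) U" "y \<in> U" "\<forall>z\<in>U. g z \<noteq> h z"
      using loc[of y] by (auto simp: E_def)
    then show "\<exists>U. openin (top_of_set T) U \<and> y \<in> U \<and> U \<subseteq> T - E"
      using openin_imp_subset by (fastforce simp: E_def)
  qed
  then have "closedin (top_of_set T) E"
    by (simp add: closedin_def E_def)
  ultimately have "E = {} \<or> E = T"
    using T unfolding connected_clopen by blast
  then show ?thesis
    using a x by (auto simp: E_def)
qed

text \<open>Over a saturated open set, a lift of the quotient map descends to a continuous local
  section of the covering, which every other lift has to follow.\<close>

lemma lift_follows_section:
  fixes p :: "'b::topological_space \<Rightarrow> 'a::topological_space" and g :: "'c::topological_space \<Rightarrow> 'b"
  assumes quot: "quotient_map X (top_of_set Y) \<pi>" and cov: "covering_space C p Y"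
    and U: "openin X U" "\<And>x y. x \<in> U \<Longrightarrow> y \<in> topspace X \<Longrightarrow> \<pi> y = \<pi> x \<Longrightarrow> y \<in> U"
    and f: "\<And>V. open V \<Longrightarrow> openin X {x \<in> U. f x \<in> V}" "f ` U \<subseteq> C" "\<And>x. x \<in> U \<Longrightarrow> p (f x) = \<pi> x"
    and f_cong: "\<And>x y. x \<in> U \<Longrightarrow> y \<in> U \<Longrightarrow> \<pi> x = \<pi> y \<Longrightarrow> f x = f y"
    and J: "connected J" "continuous_on J g" "g ` J \<subseteq> C" "\<And>s. s \<in> J \<Longrightarrow> p (g s) \<in> \<pi> ` U"
    and s0: "s0 \<in> J" "x0 \<in> U" "g s0 = f x0"
    and s: "s \<in> J" "x \<in> U" "p (g s) = \<pi> x"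
  shows "g s = f x"
proof -
  \<comment> \<open>The descended section. By \<open>f_cong\<close> its value does not depend on the
    chosen preimage.\<close>
  define h where "h y = f (SOME x. x \<in> U \<and> \<pi> x = y)" for y
  have h: "h (\<pi> x) = f x" if "x \<in> U" for x
  proof -
    have "\<exists>y. y \<in> U \<and> \<pi> y = \<pi> x"
      using that by blast
    from someI_ex[OF this] show ?thesis
      unfolding h_def using that f_cong by blast
  qed
  have sub: "U \<subseteq> topspace X"
    using U(1) by (rule openin_subset)
  have "\<pi> ` topspace X = Y"
    using quot by (simp add: quotient_map_def)
  then have im: "\<pi> ` U \<subseteq> Y"
    using sub by blast
  have "continuous_on (\<pi> ` U) h"
    unfolding continuous_openin_preimage_eq
  proof (intro allI impI)
    fix V :: "'b set" assume "open V"
    define W where "W = \<pi> ` U \<inter> h -` V"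
    \<comment> \<open>Because \<open>U\<close> is saturated, no point outside \<open>U\<close> has
      its image in \<open>W\<close>; so the openness of \<open>W\<close> in the quotient is that of
      a subset of \<open>U\<close>.\<close>
    have "{x \<in> topspace X. \<pi> x \<in> W} = {x \<in> U. f x \<in> V}"
    proof (intro equalityI subsetI)
      fix x assume "x \<in> {x \<in> topspace X. \<pi> x \<in> W}"
      then obtain y where "x \<in> topspace X" "y \<in> U" "\<pi> x = \<pi> y" "h (\<pi> x) \<in> V"
        by (auto simp: W_def)
      then show "x \<in> {x \<in> U. f x \<in> V}"
        using U(2)[of y x] h[of x] by auto
    next
      fix x assume "x \<in> {x \<in> U. f x \<in> V}"
      then show "x \<in> {x \<in> topspace X. \<pi> x \<in> W}"
        using sub h by (auto simp: W_def)
    qed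
    then have "openin X {x \<in> topspace X. \<pi> x \<in> W}"
      using f(1)[OF \<open>open V\<close>] by simp
    moreover have "W \<subseteq> Y"
      using im by (auto simp: W_def)
    ultimately have "openin (top_of_set Y) W"
      using quot by (simp add: quotient_map_def)
    then show "openin (top_of_set (\<pi> ` U)) (\<pi> ` U \<inter> h -` V)"
      unfolding W_def[symmetric] by (rule openin_subset_trans) (use im in \<open>auto simp: W_def\<close>)
  qed
  moreover have "continuous_on (g ` J) p"
    using cov J(3) continuous_on_subset by (auto simp: covering_space_def)
  then have "continuous_on J (p \<circ> g)"
    by (rule continuous_on_compose[OF J(2)])
  moreover have "(p \<circ> g) ` J \<subseteq> \<pi> ` U"
    using J(4) by auto
  ultimately have cont: "continuous_on J (h \<circ> (p \<circ> g))"
    by (meson continuous_on_compose continuous_on_subset)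
  have "g s = (h \<circ> (p \<circ> g)) s"
  proof (rule covering_lift_unique[OF cov J(1-3) cont _ _ s0(1) _ s(1)])
    show "(h \<circ> (p \<circ> g)) ` J \<subseteq> C"
      using J(4) h f(2) by fastforce
    show "p (g x) = p ((h \<circ> (p \<circ> g)) x)" if "x \<in> J" for x
      using J(4)[OF that] h f(3) by auto
    show "g s0 = (h \<circ> (p \<circ> g)) s0"
      using s0 h f(3) by simp
  qed
  then show ?thesis
    using s h by simp
qed

lemma openin_sum_topology_slice:
  assumes "T \<in> I" "openin (X T) K"
  shows "openin (sum_topology X I) ({T} \<times> K)"
proof -
  have "{x. (i, x) \<in> {T} \<times> K} = (if i = T then K else {})" for i
    by auto
  then show ?thesis
    unfolding openin_sum_topology using assms openin_subset[OF assms(2)] by auto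
qed


section \<open>Developing along a curve\<close>

locale developed_triangulation =
  fixes Y :: "'a::topological_space set" and Yt :: "'b::topological_space set"
    and tets :: "'t set" and glue :: "'t gluing"
    and Z :: "'t \<Rightarrow> 4 set \<Rightarrow> complex" and v :: "'t \<Rightarrow> 4 \<Rightarrow> complex^2"
    and \<pi> :: "'t \<times> cmat2 \<Rightarrow> 'a" and p :: "'b \<Rightarrow> 'a" and dev :: "'b \<Rightarrow> cmat2"
  assumes triangulation: "ideal_triangulation Y tets glue Z v \<pi>"
    and cover: "universal_cover Yt p Y"
    and developing: "developing_map Yt p tets v \<pi> dev"
begin

definition tet_sum :: "('t \<times> cmat2) topology" where
  "tet_sum = sum_topology (\<lambda>T. top_of_set (ideal_tetrahedron (v T))) tets"

definition sheet :: "'t \<Rightarrow> (cmat2 \<Rightarrow> 'b) \<Rightarrow> cmat2 \<Rightarrow> bool" where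
  "sheet T \<phi> A \<longleftrightarrow> lifted_tetrahedron Yt p v \<pi> T \<phi> \<and> det A = 1 \<and>
     (\<forall>X\<in>ideal_tetrahedron (v T). dev (\<phi> X) = act A X)"

lemma covering: "covering_space Yt p Y"
  using cover by (simp add: universal_cover_def)

lemma quotient: "quotient_map tet_sum (top_of_set Y) \<pi>"
  using triangulation by (simp add: ideal_triangulation_def tet_sum_def)

lemma topspace_tet_sum: "(T, X) \<in> topspace tet_sum \<longleftrightarrow> T \<in> tets \<and> X \<in> ideal_tetrahedron (v T)"
  by (auto simp: tet_sum_def)

lemma labelled: "T \<in> tets \<Longrightarrow> positively_labelled (v T)"
  using triangulation by (simp add: ideal_triangulation_def)

lemma glue_facts:
  assumes "glue T i = Some (T', \<sigma>)"
  shows "T \<in> tets" "T' \<in> tets" "bij \<sigma>" "\<not> evenperm \<sigma>" "(T', \<sigma> i) \<noteq> (T, i)" "glue T' (\<sigma> i) = Some (T, inv \<sigma>)"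
  using triangulation assms unfolding ideal_triangulation_def face_pairing_def by blast+

lemma sheet_exists:
  assumes "T \<in> tets" "X \<in> ideal_tetrahedron (v T)" "y \<in> Yt" "p y = \<pi> (T, X)"
  obtains \<phi> A where "sheet T \<phi> A" "\<phi> X = y"
  using developing assms unfolding developing_map_def sheet_def by metis

lemma sheet_facts:
  assumes "sheet T \<phi> A"
  shows "continuous_on (ideal_tetrahedron (v T)) \<phi>" "\<phi> ` ideal_tetrahedron (v T) \<subseteq> Yt" "det A = 1"
    and "X \<in> ideal_tetrahedron (v T) \<Longrightarrow> p (\<phi> X) = \<pi> (T, X)"
    and "X \<in> ideal_tetrahedron (v T) \<Longrightarrow> dev (\<phi> X) = act A X"
  using assms unfolding sheet_def lifted_tetrahedron_def by auto

section \<open>Fibres of the quotient map\<close>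

lemma glued_points_face:
  assumes "glued_points glue v (T, X) (T', X')" "X \<in> open_face (v T) q"
  obtains \<sigma> A where "glue T q = Some (T', \<sigma>)" "det A = 1"
    "\<And>j. j \<noteq> q \<Longrightarrow> same_ideal_point (A *v v T j) (v T' (\<sigma> j))" "X' = act A X"
proof -
  obtain i \<sigma> A where *: "glue T i = Some (T', \<sigma>)" "det A = 1"
    "\<forall>j. j \<noteq> i \<longrightarrow> same_ideal_point (A *v v T j) (v T' (\<sigma> j))"
    "X \<in> ideal_simplex (v T) (- {i})" "X' = act A X"
    using assms(1) unfolding glued_points_def by auto
  \<comment> \<open>A point of an open face has only one vanishing coordinate, so no other face can
    be involved.\<close>
  have "coord (v T) i X = 0"
    using ideal_simplex_iff_tetrahedron[OF labelled[OF glue_facts(1)[OF *(1)]], THEN iffD1, OF *(4)] by simp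
  then have "i = q"
    using assms(2) by (auto simp: open_face_def)
  then show thesis
    using that * by blast
qed

lemma glued_points_interior:
  assumes "glued_points glue v (T, X) y" "X \<in> open_tetrahedron (v T)"
  shows False
proof -
  obtain i T' \<sigma> where *: "glue T i = Some (T', \<sigma>)" "X \<in> ideal_simplex (v T) (- {i})"
    using assms(1) unfolding glued_points_def by (cases y) auto
  have "coord (v T) i X = 0"
    using ideal_simplex_iff_tetrahedron[OF labelled[OF glue_facts(1)[OF *(1)]], THEN iffD1, OF *(2)] by simp
  then show False
    using assms(2) unfolding open_tetrahedron_def by (metis (mono_tags, lifting) mem_Collect_eq less_irrefl)
qed

lemma inverse_isometry:
  assumes "det (A :: cmat2) = 1"
  obtains B where "det B = 1" "B ** A = mat 1" "A ** B = mat 1"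
proof -
  obtain B where B: "A ** B = mat 1" "B ** A = mat 1"
    using assms by (metis invertible_def invertible_det_nz zero_neq_one)
  then have "det B = 1"
    by (metis assms det_I det_mul mult_1)
  then show thesis
    using that B by blast
qed

lemma glued_points_sym:
  assumes "glued_points glue v x y"
  shows "glued_points glue v y x"
proof -
  obtain T X T' X' where xy: "x = (T, X)" "y = (T', X')"
    by (cases x, cases y) auto
  obtain i \<sigma> A where *: "glue T i = Some (T', \<sigma>)" "det A = 1"
    "\<And>j. j \<noteq> i \<Longrightarrow> same_ideal_point (A *v v T j) (v T' (\<sigma> j))"
    "X \<in> ideal_simplex (v T) (- {i})" "X' = act A X"
    using assms unfolding glued_points_def xy by auto
  note g = glue_facts[OF *(1)]
  obtain B where B: "det B = 1" "B ** A = mat 1" "A ** B = mat 1"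
    using inverse_isometry[OF *(2)] .
  have "same_ideal_point (B *v v T' j) (v T (inv \<sigma> j))" if "j \<noteq> \<sigma> i" for j
  proof -
    have "inv \<sigma> j \<noteq> i" "\<sigma> (inv \<sigma> j) = j"
      using that g(3) by (auto simp: bij_is_surj surj_f_inv_f)
    then have "same_ideal_point (v T' j) (A *v v T (inv \<sigma> j))"
      using *(3) same_ideal_point_sym by metis
    then show ?thesis
      using same_ideal_point_mult[of _ _ B] B(2) by (metis matrix_vector_mul_assoc matrix_vector_mul_lid)
  qed
  moreover have "X' \<in> ideal_simplex (v T') (- {\<sigma> i})"
    unfolding *(5) using act_face_coords(1)[OF labelled[OF g(1)] labelled[OF g(2)] g(3) *(3,2,4)] .
  moreover have "X = act B X'"
    unfolding *(5) by (simp add: act_mult[symmetric] B)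
  ultimately show ?thesis
    unfolding glued_points_def xy using g(6) B(1) by blast
qed

text \<open>A single gluing can be reversed by a single gluing, so closure under forward steps
  controls the whole equivalence class. Fibres of \<open>\<pi>\<close> are computed by exhibiting
  such closed sets.\<close>

lemma glued_class:
  assumes "equivclp (glued_points glue v) x y" "x \<in> S"
    and closed: "\<And>x y. x \<in> S \<Longrightarrow> glued_points glue v x y \<Longrightarrow> y \<in> S"
  shows "y \<in> S"
  using assms(1,2) by (induction rule: equivclp_induct) (use closed glued_points_sym in blast)+

lemma \<pi>_eq_imp_equiv:
  assumes "x \<in> topspace tet_sum" "y \<in> topspace tet_sum" "\<pi> y = \<pi> x"
  shows "equivclp (glued_points glue v) x y"
proof -
  have "x \<in> Sigma tets (\<lambda>T. ideal_tetrahedron (v T))" "y \<in> Sigma tets (\<lambda>T. ideal_tetrahedron (v T))"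
    using assms(1,2) by (auto simp: tet_sum_def)
  then show ?thesis
    using triangulation assms(3) unfolding ideal_triangulation_def by metis
qed

lemma open_tetrahedron_subset: "open_tetrahedron w \<subseteq> ideal_tetrahedron w"
  by (auto simp: open_tetrahedron_def)

lemma open_face_subset: "open_face w q \<subseteq> ideal_tetrahedron w"
  by (auto simp: open_face_def)

lemma half_suspension_subset_tetrahedron:
  "T \<in> tets \<Longrightarrow> half_suspension (v T) q \<subseteq> ideal_tetrahedron (v T)"
  using half_suspension_iff[OF labelled] by blast

lemma \<pi>_interior:
  assumes "T \<in> tets" "X \<in> open_tetrahedron (v T)" "y \<in> topspace tet_sum" "\<pi> y = \<pi> (T, X)"
  shows "y = (T, X)"
proof -
  have "(T, X) \<in> topspace tet_sum"
    using assms open_tetrahedron_subset by (auto simp: topspace_tet_sum)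
  from \<pi>_eq_imp_equiv[OF this assms(3,4)] have "y \<in> {(T, X)}"
    by (rule glued_class) (use glued_points_interior assms(2) in blast)+
  then show ?thesis
    by simp
qed

text \<open>From the neighbouring face the only gluing leads back, and the composed isometry fixes
  the three vertices of the face, hence acts as the identity. So the class stops after one
  step.\<close>

lemma \<pi>_face:
  assumes T: "T \<in> tets" and X: "X \<in> open_face (v T) q" and y: "y \<in> topspace tet_sum" "\<pi> y = \<pi> (T, X)"
    and "y \<noteq> (T, X)"
  obtains T' \<sigma> A where "glue T q = Some (T', \<sigma>)" "det A = 1"
    "\<And>j. j \<noteq> q \<Longrightarrow> same_ideal_point (A *v v T j) (v T' (\<sigma> j))" "y = (T', act A X)"
proof -
  define S where "S = {(T', act A X) | T' \<sigma> A. glue T q = Some (T', \<sigma>) \<and> det A = 1 \<and>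
    (\<forall>j. j \<noteq> q \<longrightarrow> same_ideal_point (A *v v T j) (v T' (\<sigma> j)))}"
  have "(T, X) \<in> topspace tet_sum"
    using T X open_face_subset by (auto simp: topspace_tet_sum)
  from \<pi>_eq_imp_equiv[OF this y] have "y \<in> insert (T, X) S"
  proof (rule glued_class)
    fix x z assume x: "x \<in> insert (T, X) S" and xz: "glued_points glue v x z"
    obtain T2 X2 where z: "z = (T2, X2)"
      by (cases z)
    from x consider "x = (T, X)" | T' \<sigma> A where "x = (T', act A X)" "glue T q = Some (T', \<sigma>)" "det A = 1"
      "\<And>j. j \<noteq> q \<Longrightarrow> same_ideal_point (A *v v T j) (v T' (\<sigma> j))"
      unfolding S_def by blast
    then show "z \<in> insert (T, X) S"
    proof cases
      case 1
      obtain \<sigma> A where "glue T q = Some (T2, \<sigma>)" "det A = 1"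
        "\<And>j. j \<noteq> q \<Longrightarrow> same_ideal_point (A *v v T j) (v T2 (\<sigma> j))" "X2 = act A X"
        using glued_points_face[OF xz[unfolded 1 z] X] by blast
      then have "(T2, X2) \<in> S"
        unfolding S_def by (intro CollectI exI[of _ T2] exI[of _ \<sigma>] exI[of _ A]) simp
      then show ?thesis
        unfolding z by simp
    next
      case 2
      note g = glue_facts[OF 2(2)]
      have face: "act A X \<in> open_face (v T') (\<sigma> q)"
        by (rule act_open_face[OF labelled[OF g(1)] labelled[OF g(2)] g(3) 2(4,3) X])
      obtain \<tau> B where B: "glue T' (\<sigma> q) = Some (T2, \<tau>)" "det B = 1"
        "\<And>j. j \<noteq> \<sigma> q \<Longrightarrow> same_ideal_point (B *v v T' j) (v T2 (\<tau> j))" "X2 = act B (act A X)"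
        using glued_points_face[OF xz[unfolded 2(1) z] face] by blast
      have T2: "T2 = T" "\<tau> = inv \<sigma>"
        using B(1) g(6) by auto
      have "same_ideal_point ((B ** A) *v v T j) (v T j)" if "j \<noteq> q" for j
      proof -
        have "\<sigma> j \<noteq> \<sigma> q" "inv \<sigma> (\<sigma> j) = j"
          using that g(3) by (auto simp: bij_is_inj inj_eq)
        then have "same_ideal_point (B *v v T' (\<sigma> j)) (v T j)"
          using B(3)[of "\<sigma> j"] by (simp add: T2)
        then show ?thesis
          using same_ideal_point_mult[OF 2(4)[OF that], of B]
          by (metis matrix_vector_mul_assoc same_ideal_point_trans)
      qed
      then have "act (B ** A) X = act (mat 1) X"
        by (intro gluing_isometry_unique[OF labelled[OF T], where q = q and w = "v T"])
          (simp_all add: det_mul 2(3) B(2))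
      then show ?thesis
        unfolding z by (simp add: B(4) T2 act_mult)
    qed
  qed simp
  then show thesis
    using that \<open>y \<noteq> (T, X)\<close> unfolding S_def by blast
qed

section \<open>Lifts in a tetrahedron and through a suspension\<close>

lemma openin_tet_slice:
  assumes T: "T \<in> tets" and K: "openin (top_of_set (ideal_tetrahedron (v T))) K"
    and \<phi>: "continuous_on (ideal_tetrahedron (v T)) \<phi>" and "open V"
  shows "openin tet_sum ({T} \<times> {X \<in> K. \<phi> X \<in> V})"
proof -
  have "openin (top_of_set (ideal_tetrahedron (v T))) (K \<inter> (ideal_tetrahedron (v T) \<inter> \<phi> -` V))"
    using K continuous_openin_preimage_gen[OF \<phi> \<open>open V\<close>] by (rule openin_Int)
  moreover have "K \<inter> (ideal_tetrahedron (v T) \<inter> \<phi> -` V) = {X \<in> K. \<phi> X \<in> V}"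
    using openin_imp_subset[OF K] by auto
  ultimately show ?thesis
    unfolding tet_sum_def by (intro openin_sum_topology_slice[OF T]) simp
qed

lemma openin_tet_slice':
  assumes "T \<in> tets" "openin (top_of_set (ideal_tetrahedron (v T))) K"
  shows "openin tet_sum ({T} \<times> K)"
  unfolding tet_sum_def
  using assms by (intro openin_sum_topology_slice[where X = "\<lambda>T. top_of_set (ideal_tetrahedron (v T))"])

text \<open>On the open tetrahedron \<open>\<pi>\<close> is injective, so the sheet itself serves as
  the local section. This bridges the moment of crossing, when the curve lies on an edge cone and in
  no half suspension.\<close>

lemma lift_in_tetrahedron:
  assumes sheet: "sheet T \<phi> A" and T: "T \<in> tets"
    and J: "connected J" "continuous_on J g" "g ` J \<subseteq> Yt"
      "\<And>s. s \<in> J \<Longrightarrow> p (g s) \<in> \<pi> ` ({T} \<times> open_tetrahedron (v T))"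
    and s0: "s0 \<in> J" "X0 \<in> open_tetrahedron (v T)" "g s0 = \<phi> X0"
    and s: "s \<in> J" "X \<in> open_tetrahedron (v T)" "p (g s) = \<pi> (T, X)"
  shows "g s = \<phi> X"
proof -
  note sh = sheet_facts[OF sheet] and op = openin_open_tetrahedron[OF labelled[OF T]]
  have "g s = (\<phi> \<circ> snd) (T, X)"
  proof (rule lift_follows_section[OF quotient covering openin_tet_slice'[OF T op] _ _ _ _ _ J s0(1) _ _ s(1) _ s(3),
        where ?x0.0 = "(T, X0)"])
    show "y \<in> {T} \<times> open_tetrahedron (v T)"
      if "x \<in> {T} \<times> open_tetrahedron (v T)" "y \<in> topspace tet_sum" "\<pi> y = \<pi> x" for x y
      using that \<pi>_interior[OF T] by blast
    show "openin tet_sum {x \<in> {T} \<times> open_tetrahedron (v T). (\<phi> \<circ> snd) x \<in> V}" if "open V" for V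
    proof -
      have "{x \<in> {T} \<times> open_tetrahedron (v T). (\<phi> \<circ> snd) x \<in> V} = {T} \<times> {X \<in> open_tetrahedron (v T). \<phi> X \<in> V}"
        by auto
      then show ?thesis
        using openin_tet_slice[OF T op sh(1) that] by simp
    qed
    show "(\<phi> \<circ> snd) ` ({T} \<times> open_tetrahedron (v T)) \<subseteq> Yt"
      using sh(2) open_tetrahedron_subset by fastforce
    show "p ((\<phi> \<circ> snd) x) = \<pi> x" if "x \<in> {T} \<times> open_tetrahedron (v T)" for x
      using that sh(4)[OF open_tetrahedron_subset[THEN subsetD]] by auto
    show "(\<phi> \<circ> snd) x = (\<phi> \<circ> snd) y"
      if "x \<in> {T} \<times> open_tetrahedron (v T)" "y \<in> {T} \<times> open_tetrahedron (v T)" "\<pi> x = \<pi> y" for x y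
    proof -
      have "x = y"
        using that \<pi>_interior[OF T, of "snd y" x] open_tetrahedron_subset[THEN subsetD] T
        by (auto simp: topspace_tet_sum)
      then show ?thesis
        by simp
    qed
  qed (use s0 s in auto)
  then show ?thesis
    by simp
qed

text \<open>The sheet of the neighbour is chosen to agree with \<open>\<phi>\<close> at one point of
  the common open face. Connectedness spreads the agreement over the face, and comparing the
  developed images there identifies the developed vertices.\<close>

lemma adjacent_sheet:
  assumes sheet: "sheet T \<phi> A" and glue: "glue T q = Some (T', \<sigma>)"
  obtains \<phi>' A' B where "sheet T' \<phi>' A'" "det B = 1"
    "\<And>j. j \<noteq> q \<Longrightarrow> same_ideal_point (B *v v T j) (v T' (\<sigma> j))"
    "\<And>X. X \<in> open_face (v T) q \<Longrightarrow> \<phi>' (act B X) = \<phi> X"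
    "\<And>j. j \<noteq> q \<Longrightarrow> same_ideal_point (A *v v T j) (A' *v v T' (\<sigma> j))"
proof -
  note g = glue_facts[OF glue] and sh = sheet_facts[OF sheet]
  note v = labelled[OF g(1)] and v' = labelled[OF g(2)]
  obtain B where B: "det B = 1" "\<And>j. j \<noteq> q \<Longrightarrow> same_ideal_point (B *v v T j) (v T' (\<sigma> j))"
    using gluing_isometry_exists[OF v v' g(3)] by blast
  have face: "act B X \<in> ideal_tetrahedron (v T')" if "X \<in> open_face (v T) q" for X
    using act_open_face[OF v v' g(3) B(2,1) that] open_face_subset by blast
  have \<pi>: "\<pi> (T', act B X) = \<pi> (T, X)" if X: "X \<in> open_face (v T) q" for X
  proof -
    have "glued_points glue v (T, X) (T', act B X)"
      unfolding glued_points_def using glue B X by (auto simp: open_face_eq[OF v])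
    then have "equivclp (glued_points glue v) (T', act B X) (T, X)"
      by (rule converse_r_into_equivclp)
    moreover have "(T, X) \<in> Sigma tets (\<lambda>T. ideal_tetrahedron (v T))"
      "(T', act B X) \<in> Sigma tets (\<lambda>T. ideal_tetrahedron (v T))"
      using g X face open_face_subset by auto
    ultimately show ?thesis
      using triangulation unfolding ideal_triangulation_def by metis
  qed
  obtain X0 where X0: "X0 \<in> open_face (v T) q"
    using positive_combination_in_open_face[OF v, of "\<lambda>_. 1"] by (metis zero_less_one)
  have "X0 \<in> ideal_tetrahedron (v T)"
    using X0 open_face_subset by blast
  then obtain \<phi>' A' where sheet': "sheet T' \<phi>' A'" "\<phi>' (act B X0) = \<phi> X0"
    using sheet_exists[OF g(2) face[OF X0], of "\<phi> X0"] sh(2,4) \<pi>[OF X0] by (metis image_subset_iff)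
  note sh' = sheet_facts[OF sheet'(1)]
  have eq: "(\<phi>' \<circ> act B) X = \<phi> X" if X: "X \<in> open_face (v T) q" for X
  proof (rule covering_lift_unique[OF covering connected_open_face[OF v] _ _ _ _ _ X0 _ X])
    show "continuous_on (open_face (v T) q) (\<phi>' \<circ> act B)"
      by (rule continuous_on_compose[OF continuous_on_act])
        (rule continuous_on_subset[OF sh'(1)], use face in auto)
    show "continuous_on (open_face (v T) q) \<phi>"
      by (rule continuous_on_subset[OF sh(1) open_face_subset])
    show "(\<phi>' \<circ> act B) ` open_face (v T) q \<subseteq> Yt"
      using face sh'(2) by fastforce
    show "\<phi> ` open_face (v T) q \<subseteq> Yt"
      using sh(2) open_face_subset by fastforce
    show "p ((\<phi>' \<circ> act B) X) = p (\<phi> X)" if "X \<in> open_face (v T) q" for X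
      using sh(4)[OF open_face_subset[THEN subsetD, OF that]] sh'(4)[OF face[OF that]] \<pi>[OF that] by simp
  qed (use sheet' in simp)
  have "act A X = act (A' ** B) X" if X: "X \<in> open_face (v T) q" for X
    using eq[OF X] sh(5)[OF open_face_subset[THEN subsetD, OF X]] sh'(5)[OF face[OF X]] by (simp add: act_mult)
  then have "same_ideal_point (A *v v T j) (A' *v (B *v v T j))" if "j \<noteq> q" for j
    using act_eq_on_open_face[OF v sh(3), where q = q and j = j and B = "A' ** B"] that by (simp add: det_mul sh'(3) B(1) matrix_vector_mul_assoc)
  then have "same_ideal_point (A *v v T j) (A' *v v T' (\<sigma> j))" if "j \<noteq> q" for j
    using that same_ideal_point_mult[OF B(2)[OF that], of A'] same_ideal_point_trans by blast
  then show thesis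
    using that sheet'(1) B eq by simp
qed

text \<open>The sheets of the two tetrahedra along the face fit together over the suspension, which
  is open and saturated, and a lift that starts on one of them has to follow the combined
  section.\<close>

lemma lift_in_suspension:
  assumes sheet: "sheet T \<phi> A" and T: "T \<in> tets"
    and J: "connected J" "continuous_on J g" "g ` J \<subseteq> Yt"
      "\<And>s. s \<in> J \<Longrightarrow> p (g s) \<in> suspension_region glue v \<pi> T q"
    and s0: "s0 \<in> J" "X0 \<in> half_suspension (v T) q" "g s0 = \<phi> X0"
  shows "s \<in> J \<Longrightarrow> X \<in> half_suspension (v T) q \<Longrightarrow> p (g s) = \<pi> (T, X) \<Longrightarrow> g s = \<phi> X"
    and "glue T q = Some (T', \<sigma>) \<Longrightarrow>
      \<exists>\<phi>' A'. sheet T' \<phi>' A' \<and> (\<forall>j. j \<noteq> q \<longrightarrow> same_ideal_point (A *v v T j) (A' *v v T' (\<sigma> j))) \<and>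
        (\<forall>s\<in>J. \<forall>X\<in>half_suspension (v T') (\<sigma> q). p (g s) = \<pi> (T', X) \<longrightarrow> g s = \<phi>' X)"
proof -
  note sh = sheet_facts[OF sheet] and v = labelled[OF T]
  let ?H = "half_suspension (v T) q"
  have H: "?H \<subseteq> ideal_tetrahedron (v T)"
    by (rule half_suspension_subset_tetrahedron[OF T])
  have part2: "(\<forall>s\<in>J. \<forall>X\<in>?H. p (g s) = \<pi> (T, X) \<longrightarrow> g s = \<phi> X) \<and> (\<exists>\<phi>' A'. sheet T' \<phi>' A' \<and>
        (\<forall>j. j \<noteq> q \<longrightarrow> same_ideal_point (A *v v T j) (A' *v v T' (\<sigma> j))) \<and>
        (\<forall>s\<in>J. \<forall>X\<in>half_suspension (v T') (\<sigma> q). p (g s) = \<pi> (T', X) \<longrightarrow> g s = \<phi>' X))"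
    if glue: "glue T q = Some (T', \<sigma>)" for T' \<sigma>
  proof -
    note g = glue_facts[OF glue]
    note v' = labelled[OF g(2)]
    let ?H' = "half_suspension (v T') (\<sigma> q)"
    have H': "?H' \<subseteq> ideal_tetrahedron (v T')"
      by (rule half_suspension_subset_tetrahedron[OF g(2)])
    obtain \<phi>' A' B where adj: "sheet T' \<phi>' A'" "det B = 1"
      "\<And>j. j \<noteq> q \<Longrightarrow> same_ideal_point (B *v v T j) (v T' (\<sigma> j))"
      "\<And>X. X \<in> open_face (v T) q \<Longrightarrow> \<phi>' (act B X) = \<phi> X"
      "\<And>j. j \<noteq> q \<Longrightarrow> same_ideal_point (A *v v T j) (A' *v v T' (\<sigma> j))"
      using adjacent_sheet[OF sheet glue] by blast
    note sh' = sheet_facts[OF adj(1)]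
    define U where "U = {T} \<times> ?H \<union> {T'} \<times> ?H'"
    \<comment> \<open>If the tetrahedron is glued to itself, both halves lie in the same
      \<open>T\<close> but on possibly different sheets. The definition therefore distinguishes
      halves; these are disjoint since they belong to different faces.\<close>
    define f where "f = (\<lambda>(S, X). if S = T \<and> X \<in> ?H then \<phi> X else \<phi>' X)"
    have disj: "\<not> (T' = T \<and> X \<in> ?H)" if "X \<in> ?H'" for X
      using that g(5) half_suspension_disjoint[OF v] by blast
    have f: "X \<in> ?H \<Longrightarrow> f (T, X) = \<phi> X" "X \<in> ?H' \<Longrightarrow> f (T', X) = \<phi>' X" for X
      using disj by (auto simp: f_def)
    \<comment> \<open>Two distinct points with the same image lie on the common open face, where the
      two sheets agree. This gives both the saturation of \<open>U\<close> and the compatibility of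
      \<open>f\<close> with \<open>\<pi>\<close>.\<close>
    have fibre: "y \<in> U \<and> f y = f x" if x: "x \<in> U" and y: "y \<in> topspace tet_sum" "\<pi> y = \<pi> x" for x y
    proof (cases "y = x")
      case False
      have halves: "y \<in> U \<and> f y = f (T, X)" if X: "x = (T, X)" "X \<in> ?H" for X
      proof -
        have "X \<in> open_face (v T) q"
          using half_suspension_subset[OF v] \<pi>_interior[OF T _ y(1)] y(2) X False by blast
        moreover from this obtain T2 \<tau> B2 where *: "glue T q = Some (T2, \<tau>)" "det B2 = 1"
          "\<And>j. j \<noteq> q \<Longrightarrow> same_ideal_point (B2 *v v T j) (v T2 (\<tau> j))" "y = (T2, act B2 X)"
          using \<pi>_face[OF T _ y(1)] y(2) X(1) False by metis
        moreover have "T2 = T'" "\<tau> = \<sigma>"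
          using * glue by auto
        moreover from this have "act B2 X = act B X"
          by (intro gluing_isometry_unique[OF v *(2) _ adj(2,3)]) (use *(3) in auto)
        moreover have "act B X \<in> ?H'" if "X \<in> open_face (v T) q"
          using act_open_face[OF v v' g(3) adj(3,2) that] open_face_subset_half_suspension[OF v'] by blast
        ultimately show ?thesis
          using adj(4) f X(2) by (auto simp: U_def)
      qed
      have halves': "y \<in> U \<and> f y = f (T', X)" if X: "x = (T', X)" "X \<in> ?H'" for X
      proof -
        have "X \<in> open_face (v T') (\<sigma> q)"
          using half_suspension_subset[OF v'] \<pi>_interior[OF g(2) _ y(1)] y(2) X False by blast
        moreover from this obtain T2 \<tau> B2 where *: "glue T' (\<sigma> q) = Some (T2, \<tau>)" "det B2 = 1"
          "\<And>j. j \<noteq> \<sigma> q \<Longrightarrow> same_ideal_point (B2 *v v T' j) (v T2 (\<tau> j))" "y = (T2, act B2 X)"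
          using \<pi>_face[OF g(2) _ y(1)] y(2) X(1) False by metis
        moreover have \<tau>: "T2 = T" "\<tau> = inv \<sigma>"
          using * g(6) by auto
        moreover have inv: "inv \<sigma> (\<sigma> j) = j" for j
          using g(3) by (simp add: bij_is_inj)
        moreover have "bij \<tau>"
          using \<tau> g(3) by (simp add: bij_imp_bij_inv)
        ultimately have face: "act B2 X \<in> open_face (v T) q"
          using act_open_face[OF v' labelled[OF T], of \<tau> "\<sigma> q" B2 X] by simp
        have "same_ideal_point ((B ** B2) *v v T' j) (v T' j)" if "j \<noteq> \<sigma> q" for j
        proof -
          have "inv \<sigma> j \<noteq> q" "\<sigma> (inv \<sigma> j) = j"
            using that g(3) by (auto simp: bij_is_surj surj_f_inv_f)
          then have "same_ideal_point (B *v v T (inv \<sigma> j)) (v T' j)"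
            using adj(3) by metis
          moreover have "same_ideal_point (B2 *v v T' j) (v T (inv \<sigma> j))"
            using *(3)[OF that] \<tau> by simp
          from same_ideal_point_mult[OF this]
          have "same_ideal_point ((B ** B2) *v v T' j) (B *v v T (inv \<sigma> j))"
            by (simp only: matrix_vector_mul_assoc[symmetric])
          ultimately show ?thesis
            by (rule same_ideal_point_trans[rotated])
        qed
        then have "act (B ** B2) X = act (mat 1) X"
          by (intro gluing_isometry_unique[OF v', where q = "\<sigma> q" and w = "v T'"])
            (simp_all add: det_mul adj(2) *(2))
        then have X': "act B (act B2 X) = X"
          by (simp add: act_mult)
        have "act B2 X \<in> ?H"
          using face open_face_subset_half_suspension[OF v] by blast
        then show ?thesis
          using adj(4)[OF face] X' f X(2) *(4) \<tau> by (auto simp: U_def)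
      qed
      show ?thesis
        using x halves halves' unfolding U_def by blast
    qed (use x in simp)
    have openU: "openin tet_sum U"
      unfolding U_def
      by (intro openin_Un openin_tet_slice' T g(2) openin_half_suspension v v')
    have open_f: "openin tet_sum {x \<in> U. f x \<in> V}" if "open V" for V
    proof -
      have "{x \<in> U. f x \<in> V} = {T} \<times> {X \<in> ?H. \<phi> X \<in> V} \<union> {T'} \<times> {X \<in> ?H'. \<phi>' X \<in> V}"
        using f by (auto simp: U_def)
      then show ?thesis
        using openin_tet_slice[OF T openin_half_suspension[OF v] sh(1) that]
          openin_tet_slice[OF g(2) openin_half_suspension[OF v'] sh'(1) that] by auto
    qed
    have Usub: "U \<subseteq> topspace tet_sum"
      using openU by (rule openin_subset)
    have fU: "f x \<in> Yt \<and> p (f x) = \<pi> x" if "x \<in> U" for x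
    proof -
      have "\<phi> X \<in> Yt \<and> p (\<phi> X) = \<pi> (T, X)" if "X \<in> ?H" for X
        using that H sh(2,4) by blast
      moreover have "\<phi>' X \<in> Yt \<and> p (\<phi>' X) = \<pi> (T', X)" if "X \<in> ?H'" for X
        using that H' sh'(2,4) by blast
      ultimately show ?thesis
        using that f by (auto simp: U_def)
    qed
    have region: "suspension_region glue v \<pi> T q = \<pi> ` U"
      by (simp add: suspension_region_def glue U_def image_Un)
    have key: "g s = f x" if "s \<in> J" "x \<in> U" "p (g s) = \<pi> x" for s x
    proof (rule lift_follows_section[OF quotient covering openU _ open_f _ _ _ J(1-3) _ s0(1) _ _ that])
      show "p (g s) \<in> \<pi> ` U" if "s \<in> J" for s
        using J(4)[OF that] region by simp
      show "(T, X0) \<in> U"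
        using s0 by (simp add: U_def)
      show "g s0 = f (T, X0)"
        using s0 f by simp
    qed (use fibre fU Usub in blast)+
    have "g s = \<phi> X" if "s \<in> J" "X \<in> ?H" "p (g s) = \<pi> (T, X)" for s X
      using key[of s "(T, X)"] that f by (simp add: U_def)
    moreover have "g s = \<phi>' X" if "s \<in> J" "X \<in> ?H'" "p (g s) = \<pi> (T', X)" for s X
      using key[of s "(T', X)"] that f by (simp add: U_def)
    ultimately show ?thesis
      using adj(1,5) by blast
  qed
  show "glue T q = Some (T', \<sigma>) \<Longrightarrow>
      \<exists>\<phi>' A'. sheet T' \<phi>' A' \<and> (\<forall>j. j \<noteq> q \<longrightarrow> same_ideal_point (A *v v T j) (A' *v v T' (\<sigma> j))) \<and>
        (\<forall>s\<in>J. \<forall>X\<in>half_suspension (v T') (\<sigma> q). p (g s) = \<pi> (T', X) \<longrightarrow> g s = \<phi>' X)"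
    using part2 by blast
  assume s: "s \<in> J" "X \<in> ?H" "p (g s) = \<pi> (T, X)"
  show "g s = \<phi> X"
  proof (cases "glue T q")
    case None
    \<comment> \<open>Along an unglued face the fibres are single points, so the one half is
      saturated by itself.\<close>
    have single: "y = x" if x: "x \<in> {T} \<times> ?H" and y: "y \<in> topspace tet_sum" "\<pi> y = \<pi> x" for x y
    proof (rule ccontr)
      assume ne: "y \<noteq> x"
      obtain X where X: "x = (T, X)" "X \<in> ?H"
        using x by auto
      then have "X \<in> open_face (v T) q"
        using half_suspension_subset[OF v] \<pi>_interior[OF T _ y(1)] y(2) ne by blast
      then show False
        using \<pi>_face[OF T _ y(1)] y(2) X(1) ne None by (metis option.distinct(1))
    qed
    have sub: "{T} \<times> ?H \<subseteq> topspace tet_sum"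
      using H T by (auto simp: topspace_tet_sum)
    have "g s = (\<phi> \<circ> snd) (T, X)"
    proof (rule lift_follows_section[OF quotient covering openin_tet_slice'[OF T openin_half_suspension[OF v, of q]]
          _ _ _ _ _ J(1-3) _ s0(1) _ _ s(1) _ s(3), where ?x0.0 = "(T, X0)"])
      show "openin tet_sum {x \<in> {T} \<times> ?H. (\<phi> \<circ> snd) x \<in> V}" if "open V" for V
      proof -
        have "{x \<in> {T} \<times> ?H. (\<phi> \<circ> snd) x \<in> V} = {T} \<times> {X \<in> ?H. \<phi> X \<in> V}"
          by auto
        then show ?thesis
          using openin_tet_slice[OF T openin_half_suspension[OF v] sh(1) that] by simp
      qed
      show "p (g s) \<in> \<pi> ` ({T} \<times> ?H)" if "s \<in> J" for s
        using J(4)[OF that] by (simp add: suspension_region_def None)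
      show "p ((\<phi> \<circ> snd) x) = \<pi> x" if "x \<in> {T} \<times> ?H" for x
        using that sh(4) H by auto
      show "(\<phi> \<circ> snd) ` ({T} \<times> ?H) \<subseteq> Yt"
        using sh(2) H by fastforce
      show "(\<phi> \<circ> snd) x = (\<phi> \<circ> snd) y" if "x \<in> {T} \<times> ?H" "y \<in> {T} \<times> ?H" "\<pi> x = \<pi> y" for x y
        using single[OF that(2) _ that(3)] that(1) sub by auto
    qed (use single s0 s in auto)
    then show ?thesis
      by simp
  next
    case (Some a)
    then show ?thesis
      using part2 s by (cases a) blast
  qed
qed

end

text \<open>A common form of the six rules: \<open>x\<close>, \<open>y\<close>, \<open>z\<close> are
  the vertices at infinity, 0, - 1 in the next frame. All three differ from \<open>q\<close>, so
  they belong to the entered face and make sense on both sides of it. The labelling \<open>V\<close>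
  is arbitrary because it will be replaced by developed vertices.\<close>

lemma turning_matrix_frame:
  assumes "turning_matrix glue u (T, c, q) (T2, p2, q2) M" and u: "u\<^sup>2 = - 1"
  obtains a b x y z where "ccw_face q a b c" "x \<noteq> q" "y \<noteq> q" "z \<noteq> q"
    "T2 = T \<and> p2 = q \<and> q2 = z \<and> ccw_face z x y q \<or>
      (\<exists>\<sigma>. glue T q = Some (T2, \<sigma>) \<and> p2 = \<sigma> q \<and> q2 = \<sigma> z \<and>
        (bij \<sigma> \<longrightarrow> \<not> evenperm \<sigma> \<longrightarrow> ccw_face (\<sigma> z) (\<sigma> x) (\<sigma> y) (\<sigma> q)))"
    "\<And>F V Z w. frame F (V a) (V b) (V q) \<Longrightarrow> same_ideal_point (F *v ideal_number (- Z)) (V c) \<Longrightarrow>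
      w\<^sup>2 = - Z \<Longrightarrow> Z \<noteq> 0 \<Longrightarrow> frame (F ** (mat2 w 0 0 (inverse w) ** M)) (V x) (V y) (V z)"
  using assms(1)
proof cases
  case (left a)
  show thesis
    by (rule that[of a q2 a c q2])
      (use left ccw_face_distinct ccw_face_left frame_turning(1)[OF _ _ _ _ u] in auto)
next
  case (right b)
  show thesis
    by (rule that[of q2 b c b q2])
      (use right ccw_face_distinct ccw_face_right frame_turning(2)[OF _ _ _ _ u] in auto)
next
  case (same a b)
  show thesis
    by (rule that[of a b b a c])
      (use same ccw_face_distinct ccw_face_same frame_turning(3)[OF _ _ _ _ u] in auto)
next
  case (across_left a b \<sigma>)
  show thesis
    by (rule that[of a b c a b])
      (use across_left ccw_face_distinct ccw_face_cross_left frame_turning(4)[OF _ _ _ _ u] in auto)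
next
  case (across_right a b \<sigma>)
  show thesis
    by (rule that[of a b b c a])
      (use across_right ccw_face_distinct ccw_face_cross_right frame_turning(5)[OF _ _ _ _ u] in auto)
next
  case (across_below a b \<sigma>)
  show thesis
    by (rule that[of a b a b c])
      (use across_below ccw_face_distinct ccw_face_cross_below frame_turning(6)[OF _ _ _ _ u] in auto)
qed

section \<open>From one crossing to the next\<close>

context developed_triangulation
begin

text \<open>The open tetrahedron is open and saturated, so its image is open in
  \<open>Y\<close>.\<close>

lemma stays_interior:
  assumes T: "T \<in> tets" and X: "X \<in> open_tetrahedron (v T)" "c s = \<pi> (T, X)"
    and c: "continuous_on S c" "c ` S \<subseteq> Y" "s \<in> (S :: real set)"
  obtains e where "0 < e" "\<And>s'. s' \<in> S \<Longrightarrow> \<bar>s' - s\<bar> < e \<Longrightarrow> c s' \<in> \<pi> ` ({T} \<times> open_tetrahedron (v T))"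
proof -
  let ?U = "{T} \<times> open_tetrahedron (v T)"
  have U: "openin tet_sum ?U"
    by (rule openin_tet_slice'[OF T openin_open_tetrahedron[OF labelled[OF T]]])
  then have sub: "?U \<subseteq> topspace tet_sum"
    by (rule openin_subset)
  have "{x \<in> topspace tet_sum. \<pi> x \<in> \<pi> ` ?U} = ?U"
    using sub \<pi>_interior[OF T] by blast
  moreover have "\<pi> ` ?U \<subseteq> Y"
    using sub quotient_imp_surjective_map[OF quotient] by auto
  ultimately have "openin (top_of_set Y) (\<pi> ` ?U)"
    using U quotient[unfolded quotient_map_def, THEN conjunct2, rule_format, of "\<pi> ` ?U"] by simp
  then have "openin (top_of_set S) (S \<inter> c -` (\<pi> ` ?U))"
    by (intro continuous_openin_preimage[of S c Y]) (use c in \<open>simp_all only: image_subset_iff_funcset\<close>)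
  moreover have "s \<in> S \<inter> c -` (\<pi> ` ?U)"
    using X c(3) by auto
  ultimately obtain e where "0 < e" "\<forall>s'\<in>S. dist s' s < e \<longrightarrow> s' \<in> S \<inter> c -` (\<pi> ` ?U)"
    unfolding openin_euclidean_subtopology_iff by meson
  then show thesis
    using that[of e] by (auto simp: dist_real_def)
qed

lemma \<pi>_half_interior:
  assumes T: "T \<in> tets" and "y \<in> \<pi> ` ({T} \<times> half_suspension (v T) q)" "y \<in> \<pi> ` ({T} \<times> open_tetrahedron (v T))"
  obtains X where "X \<in> half_suspension (v T) q" "X \<in> open_tetrahedron (v T)" "y = \<pi> (T, X)"
proof -
  obtain X X' where X: "X \<in> half_suspension (v T) q" "y = \<pi> (T, X)" "X' \<in> open_tetrahedron (v T)" "y = \<pi> (T, X')"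
    using assms by auto
  have "(T, X) = (T, X')"
    using X T half_suspension_subset_tetrahedron[OF T]
    by (intro \<pi>_interior) (auto simp: topspace_tet_sum)
  then show thesis
    using that X by blast
qed

text \<open>The time between two crossings splits into a short stretch inside the open tetrahedron
  \<open>T\<close>, the passage through the suspension, and a short stretch inside
  \<open>T2\<close>. On each of them the lift is forced, and the transversality conditions make the
  stretches overlap.\<close>

lemma crossing_step:
  fixes a b :: real
  assumes sheet: "sheet T \<phi> A" and T: "T \<in> tets" and "a < b"
    and g: "continuous_on {a..b} g" "g ` {a..b} \<subseteq> Yt" "\<And>s. s \<in> {a..b} \<Longrightarrow> p (g s) = c s"
    and X0: "X0 \<in> open_tetrahedron (v T)" "g a = \<phi> X0"
    and enter: "\<forall>\<^sub>F s in at_right a. c s \<in> \<pi> ` ({T} \<times> half_suspension (v T) q)"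
    and region: "\<And>s. a < s \<Longrightarrow> s < b \<Longrightarrow> c s \<in> suspension_region glue v \<pi> T q"
    and exit: "\<forall>\<^sub>F s in at_left b. c s \<in> \<pi> ` ({T2} \<times> half_suspension (v T2) p2)"
    and X2: "T2 \<in> tets" "X2 \<in> open_tetrahedron (v T2)" "c b = \<pi> (T2, X2)"
  shows "T2 = T \<Longrightarrow> p2 = q \<Longrightarrow> g b = \<phi> X2"
    and "glue T q = Some (T2, \<sigma>) \<Longrightarrow> p2 = \<sigma> q \<Longrightarrow>
      \<exists>\<phi>' A'. sheet T2 \<phi>' A' \<and> (\<forall>j. j \<noteq> q \<longrightarrow> same_ideal_point (A *v v T j) (A' *v v T2 (\<sigma> j))) \<and> g b = \<phi>' X2"
proof -
  have pc: "continuous_on Yt p" "p ` Yt = Y"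
    using covering by (auto simp: covering_space_def)
  have "continuous_on {a..b} (p \<circ> g)"
    by (rule continuous_on_compose[OF g(1) continuous_on_subset[OF pc(1) g(2)]])
  then have c: "continuous_on {a..b} c"
    by (rule continuous_on_eq) (simp add: g(3))
  have cY: "c ` {a..b} \<subseteq> Y"
  proof (rule image_subsetI)
    fix s assume s: "s \<in> {a..b}"
    then have "p (g s) \<in> Y"
      using g(2) pc(2) by blast
    then show "c s \<in> Y"
      using g(3)[OF s] by simp
  qed
  have ab: "a \<in> {a..b}" "b \<in> {a..b}"
    using \<open>a < b\<close> by auto
  have ca: "c a = \<pi> (T, X0)"
    using g(3)[OF ab(1)] X0 sheet_facts(4)[OF sheet open_tetrahedron_subset[THEN subsetD, OF X0(1)]] by simp
  obtain s0 X where s0: "a < s0" "s0 < b" "X \<in> half_suspension (v T) q" "c s0 = \<pi> (T, X)" "g s0 = \<phi> X"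
  proof -
    obtain e where e: "0 < e" "\<And>s'. s' \<in> {a..b} \<Longrightarrow> \<bar>s' - a\<bar> < e \<Longrightarrow> c s' \<in> \<pi> ` ({T} \<times> open_tetrahedron (v T))"
      using stays_interior[OF T X0(1) ca c cY ab(1)] by blast
    obtain d where d: "a < d" "\<And>s. a < s \<Longrightarrow> s < d \<Longrightarrow> c s \<in> \<pi> ` ({T} \<times> half_suspension (v T) q)"
      using enter unfolding eventually_at_right_field by blast
    \<comment> \<open>Between \<open>a\<close> and this bound the curve is still inside the open
      tetrahedron and already in the half suspension.\<close>
    have "a < Min {a + e, d, b}"
      using e d \<open>a < b\<close> by simp
    then obtain s0 where s0: "a < s0" "s0 < Min {a + e, d, b}"
      using dense by blast
    then have s0': "s0 < a + e" "s0 < d" "s0 < b"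
      by auto
    have int: "c s \<in> \<pi> ` ({T} \<times> open_tetrahedron (v T))" if "s \<in> {a..s0}" for s
      using that s0 s0' by (intro e(2)) auto
    obtain X where X: "X \<in> half_suspension (v T) q" "X \<in> open_tetrahedron (v T)" "c s0 = \<pi> (T, X)"
    proof (rule \<pi>_half_interior[OF T d(2)[OF s0(1) s0'(2)] int[of s0]])
      show "s0 \<in> {a..s0}"
        using s0(1) by simp
    qed
    have sub: "{a..s0} \<subseteq> {a..b}"
      using s0' by auto
    have "g s0 = \<phi> X"
    proof (rule lift_in_tetrahedron[OF sheet T, where g = g and ?s0.0 = a and J = "{a..s0}"])
      show "continuous_on {a..s0} g" "g ` {a..s0} \<subseteq> Yt"
        using g(1,2) sub by (auto intro: continuous_on_subset)
      show "p (g s) \<in> \<pi> ` ({T} \<times> open_tetrahedron (v T))" if "s \<in> {a..s0}" for s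
        using that int g(3) sub by auto
      show "p (g s0) = \<pi> (T, X)"
        using X(3) g(3)[of s0] s0 s0' by auto
    qed (use s0 X0 X(2) connected_Icc in auto)
    then show thesis
      using that s0(1) s0'(3) X by blast
  qed
  have J: "connected {a<..<b}" "continuous_on {a<..<b} g" "g ` {a<..<b} \<subseteq> Yt"
      "\<And>s. s \<in> {a<..<b} \<Longrightarrow> p (g s) \<in> suspension_region glue v \<pi> T q"
    using g region by (auto intro: continuous_on_subset)
  have s0J: "s0 \<in> {a<..<b}"
    using s0 by simp
  note middle = lift_in_suspension[OF sheet T J s0J s0(3,5)]
  \<comment> \<open>The final stretch is the same whether or not the face is crossed: it only
    matters which sheet carries the lift in the half suspension that is left.\<close>
  have last: "g b = \<phi>2 X2"
    if sheet2: "sheet T2 \<phi>2 A2"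
      and m: "\<And>s X. s \<in> {a<..<b} \<Longrightarrow> X \<in> half_suspension (v T2) p2 \<Longrightarrow> p (g s) = \<pi> (T2, X) \<Longrightarrow> g s = \<phi>2 X"
    for \<phi>2 A2
  proof -
    obtain e where e: "0 < e" "\<And>s'. s' \<in> {a..b} \<Longrightarrow> \<bar>s' - b\<bar> < e \<Longrightarrow> c s' \<in> \<pi> ` ({T2} \<times> open_tetrahedron (v T2))"
      using stays_interior[OF X2 c cY ab(2)] by blast
    obtain d where d: "d < b" "\<And>s. d < s \<Longrightarrow> s < b \<Longrightarrow> c s \<in> \<pi> ` ({T2} \<times> half_suspension (v T2) p2)"
      using exit unfolding eventually_at_left_field by blast
    have "Max {b - e, d, a} < b"
      using e d \<open>a < b\<close> by simp
    then obtain s1 where s1: "Max {b - e, d, a} < s1" "s1 < b"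
      using dense by blast
    then have s1': "b - e < s1" "d < s1" "a < s1"
      by auto
    have int: "c s \<in> \<pi> ` ({T2} \<times> open_tetrahedron (v T2))" if "s \<in> {s1..b}" for s
      using that s1 s1' by (intro e(2)) auto
    obtain X where X: "X \<in> half_suspension (v T2) p2" "X \<in> open_tetrahedron (v T2)" "c s1 = \<pi> (T2, X)"
    proof (rule \<pi>_half_interior[OF X2(1) d(2)[OF s1'(2) s1(2)] int[of s1]])
      show "s1 \<in> {s1..b}"
        using s1(2) by simp
    qed
    have sub: "{s1..b} \<subseteq> {a..b}"
      using s1' by auto
    have ps1: "p (g s1) = \<pi> (T2, X)"
      using X(3) g(3)[of s1] s1 s1' by auto
    have gs1: "g s1 = \<phi>2 X"
      using m[OF _ X(1) ps1] s1 s1' by auto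
    show "g b = \<phi>2 X2"
    proof (rule lift_in_tetrahedron[OF sheet2 X2(1), where g = g and ?s0.0 = s1 and J = "{s1..b}"])
      show "continuous_on {s1..b} g" "g ` {s1..b} \<subseteq> Yt"
        using g(1,2) sub by (auto intro: continuous_on_subset)
      show "p (g s) \<in> \<pi> ` ({T2} \<times> open_tetrahedron (v T2))" if "s \<in> {s1..b}" for s
        using that int g(3) sub by auto
      show "p (g b) = \<pi> (T2, X2)"
        using X2(3) g(3)[of b] ab by auto
    qed (use s1 X(2) gs1 X2(2) connected_Icc in auto)
  qed
  show "g b = \<phi> X2" if "T2 = T" "p2 = q"
    using last[of \<phi> A] sheet middle(1) that by auto
  show "\<exists>\<phi>' A'. sheet T2 \<phi>' A' \<and> (\<forall>j. j \<noteq> q \<longrightarrow> same_ideal_point (A *v v T j) (A' *v v T2 (\<sigma> j))) \<and> g b = \<phi>' X2"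
    if gl: "glue T q = Some (T2, \<sigma>)" and p2: "p2 = \<sigma> q"
  proof -
    obtain \<phi>' A' where *: "sheet T2 \<phi>' A'" "\<forall>j. j \<noteq> q \<longrightarrow> same_ideal_point (A *v v T j) (A' *v v T2 (\<sigma> j))"
      "\<forall>s\<in>{a<..<b}. \<forall>X\<in>half_suspension (v T2) (\<sigma> q). p (g s) = \<pi> (T2, X) \<longrightarrow> g s = \<phi>' X"
      using middle(2)[OF _ gl] by blast
    then have "g b = \<phi>' X2"
      using last[OF *(1)] p2 by blast
    then show ?thesis
      using * by blast
  qed
qed

lemma frame_cross_ratio_vertex:
  assumes T: "T \<in> tets" and A: "det A = 1" and ccw: "ccw_face q a b c"
    and F: "frame F (A *v v T a) (A *v v T b) (A *v v T q)"
  shows "same_ideal_point (F *v ideal_number (- Z T (- {c, q}))) (A *v v T c)" "Z T (- {c, q}) \<noteq> 0"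
proof -
  have dist: "distinct [q, a, b, c]"
    by (rule ccw_face_distinct[OF ccw])
  then have e: "- {c, q} = {a, b}"
    using Compl_4_distinct(1)[of c q a b] by auto
  have "card {a, b} = 2"
    using dist by simp
  then have shape: "has_shape_parameter (v T) {a, b} (Z T {a, b})"
    using triangulation T unfolding ideal_triangulation_def by blast
  note br = positively_labelled_bracket_nonzero[OF labelled[OF T]]
  have "A *v v T c \<noteq> 0"
  proof
    assume "A *v v T c = 0"
    then have "bracket (A *v v T c) (A *v v T q) = 0"
      by (simp add: bracket_def)
    then show False
      using A br[of c q] dist by (auto simp: bracket_mult)
  qed
  moreover have "bracket (A *v v T a) (A *v v T b) \<noteq> 0"
    using A br[of a b] dist by (auto simp: bracket_mult)
  ultimately show "same_ideal_point (F *v ideal_number (- Z T (- {c, q}))) (A *v v T c)"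
    unfolding e using shape_parameter_cross_ratio[OF labelled[OF T] ccw shape] A
    by (intro frame_cross_ratio[OF F]) (simp_all add: bracket_mult)
  show "Z T (- {c, q}) \<noteq> 0"
    using shape unfolding e has_shape_parameter_def by auto
qed

end

lemma meets_edge_cones_cases:
  assumes "meets_edge_cones tets glue v \<pi> \<gamma> k x"
  obtains t where "\<And>i. t i < t (Suc i)" "\<And>i. t (i + k) = t i + 1"
    and "\<And>i T c q. x (i mod k) = (T, c, q) \<Longrightarrow> T \<in> tets \<and> c \<noteq> q \<and>
      \<gamma> (frac (t i)) \<in> \<pi> ` ({T} \<times> open_edge_cone (v T) (- {c, q})) \<and>
      (\<forall>\<^sub>F s in at_left (t i). \<gamma> (frac s) \<in> \<pi> ` ({T} \<times> half_suspension (v T) c)) \<and>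
      (\<forall>\<^sub>F s in at_right (t i). \<gamma> (frac s) \<in> \<pi> ` ({T} \<times> half_suspension (v T) q)) \<and>
      (\<forall>s. t i < s \<and> s < t (Suc i) \<longrightarrow> \<gamma> (frac s) \<in> suspension_region glue v \<pi> T q)"
proof -
  obtain t where t: "\<forall>i. t i < t (Suc i)" "\<forall>i. t (i + k) = t i + 1"
    and m: "\<forall>i. case x (i mod k) of (T, p, q) \<Rightarrow>
           T \<in> tets \<and> p \<noteq> q \<and>
           \<gamma> (frac (t i)) \<in> \<pi> ` ({T} \<times> open_edge_cone (v T) (- {p, q})) \<and>
           (\<forall>\<^sub>F s in at_left (t i). \<gamma> (frac s) \<in> \<pi> ` ({T} \<times> half_suspension (v T) p)) \<and>
           (\<forall>\<^sub>F s in at_right (t i). \<gamma> (frac s) \<in> \<pi> ` ({T} \<times> half_suspension (v T) q)) \<and>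
           (\<forall>s. t i < s \<and> s < t (Suc i) \<longrightarrow> \<gamma> (frac s) \<in> suspension_region glue v \<pi> T q)"
    using assms unfolding meets_edge_cones_def by blast
  show thesis
  proof (rule that)
    show "t i < t (Suc i)" "t (i + k) = t i + 1" for i
      using t by auto
    show "T \<in> tets \<and> c \<noteq> q \<and>
      \<gamma> (frac (t i)) \<in> \<pi> ` ({T} \<times> open_edge_cone (v T) (- {c, q})) \<and>
      (\<forall>\<^sub>F s in at_left (t i). \<gamma> (frac s) \<in> \<pi> ` ({T} \<times> half_suspension (v T) c)) \<and>
      (\<forall>\<^sub>F s in at_right (t i). \<gamma> (frac s) \<in> \<pi> ` ({T} \<times> half_suspension (v T) q)) \<and>
      (\<forall>s. t i < s \<and> s < t (Suc i) \<longrightarrow> \<gamma> (frac s) \<in> suspension_region glue v \<pi> T q)"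
      if "x (i mod k) = (T, c, q)" for i T c q
      using m[rule_format, of i] unfolding that by simp
  qed
qed

section \<open>The lift over one period and its frames\<close>

context developed_triangulation
begin

text \<open>The crossing times fill one period, starting anywhere, so they lie in two periods starting at an
  integer.\<close>

lemma periodic_lift:
  fixes n :: int
  assumes loop: "loop_at Y (p yt0) \<gamma>" and yt0: "yt0 \<in> Yt"
    and lift: "path \<gamma>t" "path_image \<gamma>t \<subseteq> Yt" "pathstart \<gamma>t = yt0" "\<And>s. s \<in> {0..1} \<Longrightarrow> p (\<gamma>t s) = \<gamma> s"
    and deck: "deck_transformation Yt p \<delta>" "\<delta> yt0 = pathfinish \<gamma>t"
  obtains g where "continuous_on {real_of_int n..real_of_int n + 2} g" "g ` {real_of_int n..real_of_int n + 2} \<subseteq> Yt"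
    "\<And>s. s \<in> {real_of_int n..<real_of_int n + 2} \<Longrightarrow> p (g s) = \<gamma> (frac s)"
    "\<And>s. s \<in> {real_of_int n..<real_of_int n + 1} \<Longrightarrow> g (s + 1) = \<delta> (g s)"
proof -
  obtain \<delta>' where "homeomorphism Yt Yt \<delta> \<delta>'"
    using deck(1) by (auto simp: deck_transformation_def)
  then have \<delta>: "continuous_on Yt \<delta>" "\<delta> ` Yt \<subseteq> Yt"
    by (auto simp: homeomorphism_def)
  have p\<delta>: "p (\<delta> y) = p y" if "y \<in> Yt" for y
    using deck(1) that by (simp add: deck_transformation_def)
  define r where "r = real_of_int n"
  \<comment> \<open>The lift of the loop followed by its translate under the deck transformation;
    the pieces meet because \<open>\<delta>\<close> takes the start of the lift to its end.\<close>
  define g where "g s = (if s \<le> r + 1 then \<gamma>t (s - r) else \<delta> (\<gamma>t (s - (r + 1))))" for s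
  have cont: "continuous_on {0..1} \<gamma>t" and im: "\<gamma>t s \<in> Yt" if "s \<in> {0..1}" for s
    using lift(1,2) that by (auto simp: path_def path_image_def)
  have shift: "continuous_on {a..a + 1} (\<lambda>s. \<gamma>t (s - a))" for a
    by (rule continuous_on_compose2[OF cont[of 0]]) (auto intro: continuous_intros)
  have "continuous_on {r..r + 2} g"
    unfolding g_def
  proof (rule continuous_on_cases_le[where h = "\<lambda>s. s"])
    have "{s \<in> {r..r + 2}. s \<le> r + 1} = {r..r + 1}" "{s \<in> {r..r + 2}. r + 1 \<le> s} = {r + 1..r + 1 + 1}"
      by auto
    moreover have "continuous_on {r + 1..r + 1 + 1} (\<lambda>s. \<delta> (\<gamma>t (s - (r + 1))))"
    proof (rule continuous_on_compose2[OF \<delta>(1) shift])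
      show "(\<lambda>s. \<gamma>t (s - (r + 1))) ` {r + 1..r + 1 + 1} \<subseteq> Yt"
        by (intro image_subsetI im) auto
    qed
    ultimately show "continuous_on {s \<in> {r..r + 2}. s \<le> r + 1} (\<lambda>s. \<gamma>t (s - r))"
      "continuous_on {s \<in> {r..r + 2}. r + 1 \<le> s} (\<lambda>s. \<delta> (\<gamma>t (s - (r + 1))))"
      using shift[of r] by (simp_all only:)
    show "\<gamma>t (s - r) = \<delta> (\<gamma>t (s - (r + 1)))" if "s = r + 1" for s
      using that lift(3) deck(2) by (simp add: pathstart_def pathfinish_def)
  qed (auto intro: continuous_intros)
  moreover have "g s \<in> Yt" if "s \<in> {r..r + 2}" for s
    using that im[of "s - r"] im[of "s - (r + 1)"] \<delta>(2) by (auto simp: g_def)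
  moreover have "p (g s) = \<gamma> (frac s)" if s: "s \<in> {r..<r + 2}" for s
  proof -
    have ends: "\<gamma> 0 = \<gamma> 1"
      using loop by (simp add: loop_at_def pathstart_def pathfinish_def)
    consider "s < r + 1" | "s = r + 1" | "r + 1 < s"
      by linarith
    then show ?thesis
    proof cases
      case 1
      then have "frac s = s - r"
        using s by (simp add: frac_unique_iff r_def)
      then show ?thesis
        using 1 s lift(4)[of "s - r"] by (simp add: g_def)
    next
      case 2
      \<comment> \<open>At the junction \<open>g\<close> is still at the end of the first copy while
        \<open>frac s\<close> has returned to 0; the two agree in \<open>Y\<close> because the loop
        is closed.\<close>
      then have "frac s = 0"
        by (simp add: r_def)
      then show ?thesis
        using lift(4)[of 1] ends unfolding \<open>frac s = 0\<close> by (simp add: g_def 2)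
    next
      case 3
      then have "frac s = s - (r + 1)"
        using s by (simp add: frac_unique_iff r_def)
      then show ?thesis
        using 3 s lift(4)[of "s - (r + 1)"] p\<delta>[OF im] by (simp add: g_def)
    qed
  qed
  moreover have "g (s + 1) = \<delta> (g s)" if s: "s \<in> {r..<r + 1}" for s
  proof (cases "s = r")
    case True
    then show ?thesis
      using lift(3) deck(2) by (simp add: g_def pathstart_def pathfinish_def)
  next
    case False
    then show ?thesis
      using s by (simp add: g_def)
  qed
  ultimately show thesis
    using that[of g] by (simp add: image_subset_iff r_def)
qed

text \<open>Besides the frame, the invariant records the sheet that carries the lift at time
  \<open>t i\<close>, since the frame refers to the developed vertices of this sheet. New factors go
  on the right, as each is written in the standard position of the current frame.\<close>

lemma crossing_frames:
  fixes t :: "nat \<Rightarrow> real"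
  assumes u: "u\<^sup>2 = - 1"
    and turn: "\<And>i. i < k \<Longrightarrow> turning_matrix glue u (x i) (x (Suc i mod k)) (M i)"
    and w: "\<And>i. i < k \<Longrightarrow> (w i)\<^sup>2 = - (case crossed_edge (x i) of (T, e) \<Rightarrow> Z T e)"
    and t: "\<And>i. t i < t (Suc i)"
    and x: "\<And>i T c q. x (i mod k) = (T, c, q) \<Longrightarrow> T \<in> tets \<and> c \<noteq> q \<and>
      cv (t i) \<in> \<pi> ` ({T} \<times> open_edge_cone (v T) (- {c, q})) \<and>
      (\<forall>\<^sub>F s in at_left (t i). cv s \<in> \<pi> ` ({T} \<times> half_suspension (v T) c)) \<and>
      (\<forall>\<^sub>F s in at_right (t i). cv s \<in> \<pi> ` ({T} \<times> half_suspension (v T) q)) \<and>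
      (\<forall>s. t i < s \<and> s < t (Suc i) \<longrightarrow> cv s \<in> suspension_region glue v \<pi> T q)"
    and g: "continuous_on {t 0..t k} g" "g ` {t 0..t k} \<subseteq> Yt" "\<And>s. s \<in> {t 0..t k} \<Longrightarrow> p (g s) = cv s"
    and x0: "x (0 mod k) = (T0, c0, q0)" "sheet T0 \<phi>0 A0" "X0 \<in> open_tetrahedron (v T0)"
      "g (t 0) = \<phi>0 X0" "cv (t 0) = \<pi> (T0, X0)"
    and F: "\<And>a b. ccw_face q0 a b c0 \<Longrightarrow> frame F (A0 *v v T0 a) (A0 *v v T0 b) (A0 *v v T0 q0)"
    and "i \<le> k"
  shows "\<exists>T c q \<phi> A X. x (i mod k) = (T, c, q) \<and> sheet T \<phi> A \<and> X \<in> open_tetrahedron (v T) \<and>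
    g (t i) = \<phi> X \<and> cv (t i) = \<pi> (T, X) \<and> (\<forall>a b. ccw_face q a b c \<longrightarrow>
      frame (F ** matrix_product (\<lambda>i. mat2 (w i) 0 0 (inverse (w i)) ** M i) i) (A *v v T a) (A *v v T b) (A *v v T q))"
  using \<open>i \<le> k\<close>
proof (induction i)
  case 0
  show ?case
    using x0 F by (intro exI[of _ T0] exI[of _ c0] exI[of _ q0] exI[of _ \<phi>0] exI[of _ A0] exI[of _ X0]) simp
next
  case (Suc i)
  let ?P = "matrix_product (\<lambda>i. mat2 (w i) 0 0 (inverse (w i)) ** M i)"
  have i: "i < k" "i mod k = i"
    using Suc.prems by auto
  obtain T c q \<phi> A X where IH: "x (i mod k) = (T, c, q)" "sheet T \<phi> A" "X \<in> open_tetrahedron (v T)"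
    "g (t i) = \<phi> X" "cv (t i) = \<pi> (T, X)"
    "\<And>a b. ccw_face q a b c \<Longrightarrow> frame (F ** ?P i) (A *v v T a) (A *v v T b) (A *v v T q)"
    using Suc.IH i by auto
  obtain T2 p2 q2 where x2: "x (Suc i mod k) = (T2, p2, q2)"
    by (cases "x (Suc i mod k)") auto
  note now = x[OF IH(1)] and next' = x[OF x2]
  have T: "T \<in> tets" and T2: "T2 \<in> tets"
    using now next' by auto
  have turn_i: "turning_matrix glue u (T, c, q) (T2, p2, q2) (M i)"
    using turn[OF i(1)] IH(1) x2 i(2) by simp
  obtain X2 where X2: "X2 \<in> open_tetrahedron (v T2)" "cv (t (Suc i)) = \<pi> (T2, X2)"
    using next' open_edge_cone_subset[OF labelled[OF T2]] by blast
  have mono: "t i \<le> t j" if "i \<le> j" for i j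
    using lift_Suc_mono_le[of t, OF less_imp_le[OF t] that] .
  have sub: "{t i..t (Suc i)} \<subseteq> {t 0..t k}"
    using mono[of 0 i] mono[of "Suc i" k] Suc.prems by auto
  have g_i: "continuous_on {t i..t (Suc i)} g" "g ` {t i..t (Suc i)} \<subseteq> Yt"
    "\<And>s. s \<in> {t i..t (Suc i)} \<Longrightarrow> p (g s) = cv s"
    using continuous_on_subset[OF g(1) sub] g(2,3) sub by blast+
  have less: "t i < t (Suc i)"
    by (rule t)
  have enter: "\<forall>\<^sub>F s in at_right (t i). cv s \<in> \<pi> ` ({T} \<times> half_suspension (v T) q)"
    and region: "\<And>s. t i < s \<Longrightarrow> s < t (Suc i) \<Longrightarrow> cv s \<in> suspension_region glue v \<pi> T q"
    and exit: "\<forall>\<^sub>F s in at_left (t (Suc i)). cv s \<in> \<pi> ` ({T2} \<times> half_suspension (v T2) p2)"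
    using now next' by blast+
  note step_facts = IH(2) T less g_i IH(3,4) enter region exit T2 X2
  obtain a b xx y z where tm: "ccw_face q a b c" "xx \<noteq> q" "y \<noteq> q" "z \<noteq> q"
    "T2 = T \<and> p2 = q \<and> q2 = z \<and> ccw_face z xx y q \<or>
      (\<exists>\<sigma>. glue T q = Some (T2, \<sigma>) \<and> p2 = \<sigma> q \<and> q2 = \<sigma> z \<and>
        (bij \<sigma> \<longrightarrow> \<not> evenperm \<sigma> \<longrightarrow> ccw_face (\<sigma> z) (\<sigma> xx) (\<sigma> y) (\<sigma> q)))"
    "\<And>F V Z w. frame F (V a) (V b) (V q) \<Longrightarrow> same_ideal_point (F *v ideal_number (- Z)) (V c) \<Longrightarrow>
      w\<^sup>2 = - Z \<Longrightarrow> Z \<noteq> 0 \<Longrightarrow> frame (F ** (mat2 w 0 0 (inverse w) ** M i)) (V xx) (V y) (V z)"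
    using turning_matrix_frame[OF turn_i u] by blast
  note cr = frame_cross_ratio_vertex[OF T sheet_facts(3)[OF IH(2)] tm(1) IH(6)[OF tm(1)]]
  have wi: "(w i)\<^sup>2 = - Z T (- {c, q})"
    using w[OF i(1)] IH(1) i(2) by simp
  have fr: "frame (F ** ?P (Suc i)) (A *v v T xx) (A *v v T y) (A *v v T z)"
    using tm(6)[of _ "\<lambda>j. A *v v T j", OF IH(6)[OF tm(1)] cr(1) wi cr(2)] by (simp add: matrix_mul_assoc)
  from tm(5) show ?case
  proof (elim disjE exE conjE)
    assume *: "T2 = T" "p2 = q" "q2 = z" "ccw_face z xx y q"
    have "g (t (Suc i)) = \<phi> X2"
      by (rule crossing_step(1)[where c = cv]) (fact step_facts *)+
    moreover have "frame (F ** ?P (Suc i)) (A *v v T a') (A *v v T b') (A *v v T z)" if "ccw_face z a' b' q" for a' b'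
      using ccw_face_unique[OF *(4) that] fr by simp
    ultimately show ?thesis
      using x2 * IH(2) X2 by blast
  next
    fix \<sigma> assume *: "glue T q = Some (T2, \<sigma>)" "p2 = \<sigma> q" "q2 = \<sigma> z"
      "bij \<sigma> \<longrightarrow> \<not> evenperm \<sigma> \<longrightarrow> ccw_face (\<sigma> z) (\<sigma> xx) (\<sigma> y) (\<sigma> q)"
    then have ccw: "ccw_face (\<sigma> z) (\<sigma> xx) (\<sigma> y) (\<sigma> q)"
      using glue_facts[OF *(1)] by blast
    have "\<exists>\<phi>' A'. sheet T2 \<phi>' A' \<and> (\<forall>j. j \<noteq> q \<longrightarrow> same_ideal_point (A *v v T j) (A' *v v T2 (\<sigma> j))) \<and>
        g (t (Suc i)) = \<phi>' X2"
      by (rule crossing_step(2)[where c = cv]) (fact step_facts *)+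
    then obtain \<phi>' A' where sh: "sheet T2 \<phi>' A'" "g (t (Suc i)) = \<phi>' X2"
      "\<And>j. j \<noteq> q \<Longrightarrow> same_ideal_point (A *v v T j) (A' *v v T2 (\<sigma> j))"
      by blast
    \<comment> \<open>The three frame points are vertices of the common face, where the developed
      sheets agree; changing the tetrahedron leaves the frame matrix as it is.\<close>
    have fr': "frame (F ** ?P (Suc i)) (A' *v v T2 (\<sigma> xx)) (A' *v v T2 (\<sigma> y)) (A' *v v T2 (\<sigma> z))"
      by (rule frame_cong[OF fr]) (use sh(3) tm(2-4) in auto)
    have "frame (F ** ?P (Suc i)) (A' *v v T2 a') (A' *v v T2 b') (A' *v v T2 (\<sigma> z))"
      if "ccw_face (\<sigma> z) a' b' (\<sigma> q)" for a' b'
      using ccw_face_unique[OF ccw that] fr' by simp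
    then show ?thesis
      using x2 * sh X2 by blast
  qed
qed

text \<open>The sheet \<open>\<phi>\<close> and the translate of \<open>\<phi>0\<close> are lifts of
  the same tetrahedron through a common point, hence equal. Developing them shows that the holonomy
  takes the vertices of one sheet to those of the other.\<close>

lemma sheets_deck_related:
  assumes T: "T \<in> tets" and sheets: "sheet T \<phi>0 A0" "sheet T \<phi> A"
    and deck: "deck_transformation Yt p \<delta>" "\<And>y. y \<in> Yt \<Longrightarrow> dev (\<delta> y) = act R (dev y)" "det R = 1"
    and X: "X \<in> ideal_tetrahedron (v T)" "\<phi> X = \<delta> (\<phi>0 X)"
  shows "same_ideal_point (R *v (A0 *v v T j)) (A *v v T j)"
proof -
  note sh0 = sheet_facts[OF sheets(1)] and sh = sheet_facts[OF sheets(2)]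
  obtain \<delta>' where "homeomorphism Yt Yt \<delta> \<delta>'"
    using deck(1) by (auto simp: deck_transformation_def)
  then have \<delta>: "continuous_on Yt \<delta>" "\<delta> ` Yt \<subseteq> Yt"
    by (auto simp: homeomorphism_def)
  have p\<delta>: "p (\<delta> y) = p y" if "y \<in> Yt" for y
    using deck(1) that by (simp add: deck_transformation_def)
  have Yt: "\<phi>0 X \<in> Yt" if "X \<in> ideal_tetrahedron (v T)" for X
    using sh0(2) that by blast
  have eq: "\<phi> X' = (\<delta> \<circ> \<phi>0) X'" if X': "X' \<in> ideal_tetrahedron (v T)" for X'
  proof (rule covering_lift_unique[OF covering connected_ideal_tetrahedron[OF labelled[OF T]] sh(1,2) _ _ _ X(1) _ X'])
    show "continuous_on (ideal_tetrahedron (v T)) (\<delta> \<circ> \<phi>0)"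
      by (rule continuous_on_compose[OF sh0(1) continuous_on_subset[OF \<delta>(1) sh0(2)]])
    show "(\<delta> \<circ> \<phi>0) ` ideal_tetrahedron (v T) \<subseteq> Yt"
      using \<delta>(2) Yt by auto
    show "p (\<phi> X) = p ((\<delta> \<circ> \<phi>0) X)" if "X \<in> ideal_tetrahedron (v T)" for X
      using sh(4)[OF that] sh0(4)[OF that] p\<delta>[OF Yt[OF that]] by simp
  qed (use X in simp)
  \<comment> \<open>The vertices are compared on a face that contains \<open>j\<close>; the one
    opposite \<open>j + 1\<close> is such a face.\<close>
  have "act (R ** A0) X' = act A X'" if X': "X' \<in> open_face (v T) (j + 1)" for X'
  proof -
    have X'': "X' \<in> ideal_tetrahedron (v T)"
      using X' open_face_subset by blast
    have "act A X' = dev (\<delta> (\<phi>0 X'))"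
      using sh(5)[OF X''] eq[OF X''] by simp
    also have "\<dots> = act (R ** A0) X'"
      using deck(2)[OF Yt[OF X'']] sh0(5)[OF X''] by (simp add: act_mult)
    finally show ?thesis
      by simp
  qed
  then have "same_ideal_point ((R ** A0) *v v T j) (A *v v T j)"
    by (intro act_eq_on_open_face[OF labelled[OF T], where q = "j + 1"])
      (simp_all add: det_mul deck(3) sh0(3) sh(3))
  then show ?thesis
    by (simp add: matrix_vector_mul_assoc)
qed

end

section \<open>The trace of the holonomy up to sign\<close>

lemma trace_conjugate:
  assumes "(F :: cmat2) ** P = mat c ** (R ** F)" "det F \<noteq> 0"
  shows "trace P = c * trace R"
proof -
  obtain G where G: "G ** F = mat 1" "F ** G = mat 1"
    using assms(2) by (metis invertible_def invertible_det_nz)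
  have "P = G ** (F ** P)"
    by (simp add: matrix_mul_assoc G)
  also have "trace \<dots> = trace ((F ** P) ** G)"
    by (rule trace_mul_sym)
  also have "(F ** P) ** G = mat c ** R"
    unfolding assms(1) by (simp add: matrix_mul_assoc[symmetric] G)
  also have "trace (mat c ** R) = c * trace R"
    by (simp add: trace_def sum_2 matrix_matrix_mult_2 mat_def algebra_simps)
  finally show ?thesis .
qed

theorem proposition2p5:
  fixes Y :: "'a::topological_space set" and Yt :: "'b::topological_space set"
    and tets :: "'t set" and glue :: "'t gluing"
    and Z :: "'t \<Rightarrow> 4 set \<Rightarrow> complex" and v :: "'t \<Rightarrow> 4 \<Rightarrow> complex^2"
    and \<pi> :: "'t \<times> cmat2 \<Rightarrow> 'a" and p :: "'b \<Rightarrow> 'a"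
    and dev :: "'b \<Rightarrow> cmat2" and yt0 :: 'b
    and r :: "(real \<Rightarrow> 'a) \<Rightarrow> cmat2 set" and \<gamma> :: "real \<Rightarrow> 'a"
    and k :: nat and x :: "nat \<Rightarrow> 't crossing" and M :: "nat \<Rightarrow> cmat2"
    and u :: complex and w :: "nat \<Rightarrow> complex" and rhat :: "cmat2"
  assumes "shape_relations tets Z"
    and "gluing_relations tets glue Z"
    and "ideal_triangulation Y tets glue Z v \<pi>"
    and "universal_cover Yt p Y"
    and "developing_map Yt p tets v \<pi> dev"
    and "yt0 \<in> Yt"
    and "holonomy Y Yt p yt0 dev r"
    and "loop_at Y (p yt0) \<gamma>"
    and "1 \<le> k"
    and "meets_edge_cones tets glue v \<pi> \<gamma> k x"
    and "u\<^sup>2 = - 1"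
    and "\<And>i. i < k \<Longrightarrow> turning_matrix glue u (x i) (x (Suc i mod k)) (M i)"
    and "\<And>i. i < k \<Longrightarrow> (w i)\<^sup>2 = - (case crossed_edge (x i) of (T, e) \<Rightarrow> Z T e)"
    and "rhat \<in> r \<gamma>"
  shows "\<exists>\<epsilon>\<in>{1, - 1 :: complex}. trace rhat =
    \<epsilon> * (\<Sum>s\<in>{..<k} \<rightarrow>\<^sub>E {1, - 1}.
           (\<Prod>i<k. sign_entry (M i) (s i) (s (Suc i mod k))) * (\<Prod>i<k. w i powi s i))"
proof -
  interpret developed_triangulation Y Yt tets glue Z v \<pi> p dev
    by unfold_locales (use assms in auto)
  let ?N = "\<lambda>i. mat2 (w i) 0 0 (inverse (w i)) ** M i"
  obtain \<gamma>t \<delta> R where lift: "path \<gamma>t" "path_image \<gamma>t \<subseteq> Yt" "pathstart \<gamma>t = yt0"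
      "\<And>s. s \<in> {0..1} \<Longrightarrow> p (\<gamma>t s) = \<gamma> s"
    and deck: "deck_transformation Yt p \<delta>" "\<delta> yt0 = pathfinish \<gamma>t"
    and R: "det R = 1" "r \<gamma> = psl_class R" "\<And>y. y \<in> Yt \<Longrightarrow> dev (\<delta> y) = act R (dev y)"
    using assms(7)[unfolded holonomy_def, rule_format, OF assms(8)] by blast
  obtain t where t: "\<And>i. t i < t (Suc i)" "\<And>i. t (i + k) = t i + 1"
    and x: "\<And>i T c q. x (i mod k) = (T, c, q) \<Longrightarrow> T \<in> tets \<and> c \<noteq> q \<and>
      \<gamma> (frac (t i)) \<in> \<pi> ` ({T} \<times> open_edge_cone (v T) (- {c, q})) \<and>
      (\<forall>\<^sub>F s in at_left (t i). \<gamma> (frac s) \<in> \<pi> ` ({T} \<times> half_suspension (v T) c)) \<and>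
      (\<forall>\<^sub>F s in at_right (t i). \<gamma> (frac s) \<in> \<pi> ` ({T} \<times> half_suspension (v T) q)) \<and>
      (\<forall>s. t i < s \<and> s < t (Suc i) \<longrightarrow> \<gamma> (frac s) \<in> suspension_region glue v \<pi> T q)"
    using meets_edge_cones_cases[OF assms(10)] by blast
  define n where "n = \<lfloor>t 0\<rfloor>"
  have t0: "real_of_int n \<le> t 0" "t 0 < real_of_int n + 1"
    by (simp_all add: n_def)
  have tk: "t k = t 0 + 1"
    using t(2)[of 0] by simp
  obtain g where g: "continuous_on {real_of_int n..real_of_int n + 2} g" "g ` {real_of_int n..real_of_int n + 2} \<subseteq> Yt"
    "\<And>s. s \<in> {real_of_int n..<real_of_int n + 2} \<Longrightarrow> p (g s) = \<gamma> (frac s)"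
    "\<And>s. s \<in> {real_of_int n..<real_of_int n + 1} \<Longrightarrow> g (s + 1) = \<delta> (g s)"
    using periodic_lift[OF assms(8,6) lift deck] by blast
  have sub: "{t 0..t k} \<subseteq> {real_of_int n..real_of_int n + 2}" "{t 0..t k} \<subseteq> {real_of_int n..<real_of_int n + 2}"
    using t0 tk by auto
  have g': "continuous_on {t 0..t k} g" "g ` {t 0..t k} \<subseteq> Yt" "\<And>s. s \<in> {t 0..t k} \<Longrightarrow> p (g s) = \<gamma> (frac s)"
    using g(1-3) sub by (auto intro: continuous_on_subset)
  have period: "g (t k) = \<delta> (g (t 0))"
    using g(4)[of "t 0"] t0 tk by simp
  have t0k: "t 0 \<in> {t 0..t k}"
    using tk by simp
  obtain T c q where x0: "x (0 mod k) = (T, c, q)"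
    by (cases "x (0 mod k)") auto
  have T: "T \<in> tets"
    using x[OF x0] by simp
  obtain X where X: "X \<in> open_tetrahedron (v T)" "\<gamma> (frac (t 0)) = \<pi> (T, X)"
    using x[OF x0] open_edge_cone_subset[OF labelled[OF T]] by blast
  have XT: "X \<in> ideal_tetrahedron (v T)"
    using X(1) open_tetrahedron_subset by blast
  obtain \<phi>0 A0 where sheet0: "sheet T \<phi>0 A0" "\<phi>0 X = g (t 0)"
    using sheet_exists[OF T XT, of "g (t 0)"] g'(2) g'(3)[OF t0k] X(2) t0k by (metis image_subset_iff)
  \<comment> \<open>The rule of the first turn names the ends \<open>a\<close>, \<open>b\<close> of
    the first edge in the order given by the orientation; the initial frame is built on
    them.\<close>
  have "turning_matrix glue u (x 0) (x (Suc 0 mod k)) (M 0)"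
    using assms(9) by (intro assms(12)) simp
  then obtain a b where ccw: "ccw_face q a b c"
  proof (cases "x (Suc 0 mod k)")
    case (fields T2 p2 q2)
    with \<open>turning_matrix glue u (x 0) (x (Suc 0 mod k)) (M 0)\<close> x0
    have "turning_matrix glue u (T, c, q) (T2, p2, q2) (M 0)"
      by simp
    then show ?thesis
    proof (rule turning_matrix_frame[OF _ assms(11)])
      fix a b assume "ccw_face q a b c"
      then show ?thesis
        by (rule that)
    qed
  qed
  have dist: "distinct [q, a, b, c]"
    by (rule ccw_face_distinct[OF ccw])
  have "bracket (A0 *v v T i) (A0 *v v T j) \<noteq> 0" if "i \<noteq> j" for i j
    using positively_labelled_bracket_nonzero[OF labelled[OF T] that] sheet_facts(3)[OF sheet0(1)]
    by (simp add: bracket_mult)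
  then have "bracket (A0 *v v T a) (A0 *v v T b) \<noteq> 0" "bracket (A0 *v v T q) (A0 *v v T b) \<noteq> 0"
    "bracket (A0 *v v T q) (A0 *v v T a) \<noteq> 0"
    using dist by auto
  then obtain F where F: "frame F (A0 *v v T a) (A0 *v v T b) (A0 *v v T q)"
    by (rule frame_exists)
  have F': "frame F (A0 *v v T a') (A0 *v v T b') (A0 *v v T q)" if "ccw_face q a' b' c" for a' b'
    using F ccw_face_unique[OF ccw that] by simp
  obtain T' c' q' \<phi> A X' where final: "x (k mod k) = (T', c', q')" "sheet T' \<phi> A" "X' \<in> open_tetrahedron (v T')"
    "g (t k) = \<phi> X'" "\<gamma> (frac (t k)) = \<pi> (T', X')"
    "\<And>a b. ccw_face q' a b c' \<Longrightarrow> frame (F ** matrix_product ?N k) (A *v v T' a) (A *v v T' b) (A *v v T' q')"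
    using crossing_frames[where cv = "\<lambda>s. \<gamma> (frac s)" and i = k, OF assms(11-13) t(1) x g' x0 sheet0(1) X(1) sheet0(2)[symmetric] X(2) F' order_refl]
    by blast
  have same: "T' = T" "c' = c" "q' = q"
    using final(1) x0 by auto
  \<comment> \<open>The crossing with index \<open>k\<close> is again the first one, and equal
    images of interior points come from equal points. So the final sheet meets the translate of the
    initial sheet.\<close>
  have "(T', X') = (T, X)"
  proof (rule \<pi>_interior[OF T X(1)])
    show "(T', X') \<in> topspace tet_sum"
      using final(3) same T open_tetrahedron_subset by (auto simp: topspace_tet_sum)
    have "frac (t k) = frac (t 0)"
      unfolding tk by (simp add: frac_1_eq)
    then show "\<pi> (T', X') = \<pi> (T, X)"
      using final(5) X(2) by simp
  qed
  then have "\<phi> X = \<delta> (\<phi>0 X)"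
    using final(4) period sheet0(2) by simp
  then have rel: "same_ideal_point (R *v (A0 *v v T j)) (A *v v T j)" for j
    using sheets_deck_related[OF T sheet0(1) _ deck(1) R(3) R(1) XT] final(2) same by blast
  \<comment> \<open>Two frames for the same vertices of the final sheet: the initial frame moved by
    the holonomy, and the initial frame multiplied by all factors of one period.\<close>
  have "frame (R ** F) (A *v v T a) (A *v v T b) (A *v v T q)"
    using R(1) by (intro frame_cong[OF frame_transform[OF _ F] rel rel rel]) simp
  moreover have "frame (F ** matrix_product ?N k) (A *v v T a) (A *v v T b) (A *v v T q)"
    using final(6) ccw same by simp
  ultimately obtain \<kappa> where \<kappa>: "F ** matrix_product ?N k = mat \<kappa> ** (R ** F)"
    by (rule frame_unique)
  have detF: "det F \<noteq> 0"
    using F by (simp add: frame_def)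
  have detN: "det (?N i) = 1" if i: "i < k" for i
  proof -
    obtain T c q where xi: "x (i mod k) = (T, c, q)"
      by (cases "x (i mod k)") auto
    have "w i \<noteq> 0"
    proof
      assume "w i = 0"
      then have "Z T (- {c, q}) = 0"
        using assms(13)[OF i] xi i by simp
      moreover have "T \<in> tets" "card (- {c, q}) = 2"
        using x[OF xi] by (simp_all add: Compl_eq_Diff_UNIV card_Diff_subset)
      ultimately show False
        using triangulation unfolding ideal_triangulation_def has_shape_parameter_def by fastforce
    qed
    then have "det (mat2 (w i) 0 0 (inverse (w i))) = 1"
      by (simp add: det_2)
    moreover have "u * u = - 1" "u \<noteq> 0"
      using assms(11) by (auto simp: power2_eq_square)
    with assms(12)[OF i] have "det (M i) = 1"
      by cases (simp_all add: det_2)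
    ultimately show ?thesis
      by (simp add: det_mul)
  qed
  \<comment> \<open>Both the product over the period and the holonomy have determinant 1, so
    comparing determinants leaves only a sign for the scalar.\<close>
  have "det (mat \<kappa> :: cmat2) = \<kappa> * \<kappa>"
    by (simp add: det_2 mat_def)
  then have "\<kappa> * \<kappa> = 1"
    using arg_cong[OF \<kappa>, of det] detF R(1) det_matrix_product[of k ?N, OF detN] by (simp add: det_mul)
  then have \<kappa>1: "\<kappa> = 1 \<or> \<kappa> = - 1"
    by (metis square_eq_1_iff)
  have "trace (matrix_product ?N k) = \<kappa> * trace R"
    by (rule trace_conjugate[OF \<kappa> detF])
  then have "trace R = \<kappa> * trace (matrix_product ?N k)"
    using \<kappa>1 by auto
  moreover have "trace rhat = trace R \<or> trace rhat = - trace R"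
    using assms(14) unfolding R(2) psl_class_def by (auto simp: trace_def sum_2)
  ultimately have "trace rhat = trace (matrix_product ?N k) \<or> trace rhat = - trace (matrix_product ?N k)"
    using \<kappa>1 by auto
  then show ?thesis
    unfolding trace_state_sum[OF assms(9)] by auto
qed

end
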